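(* Let $\mathfrak g=\mathfrak g(A,\Psi)$ be a BKM superalgebra with quasi Dynkin diagram $(G,\Psi)$ (vertex set $I$), and let $\mathcal{LS}(G,\Psi)$ be the associated free partially commutative Lie superalgebra. Fix a nonzero $\mathbf k\in\mathbb Z_+[I]$ such that $k_i\le 1$ for $i\in I^{re}\sqcup\Psi_0$. Then: (1) The root space $\mathfrak g_{\eta(\mathbf k)}$ can be identified with the grade space $\mathcal{LS}_{\mathbf k}(G,\Psi)$: the natural grade preserving surjective homomorphism $\mathcal{LS}(G,\Psi)\to\mathfrak n_+$, $e_i\mapsto e_i$, restricts to a linear isomorphism $\mathcal{LS}_{\mathbf k}(G,\Psi)\cong\mathfrak g_{\eta(\mathbf k)}$. In particular $\operatorname{mult}\eta(\mathbf k)=\dim\mathcal{LS}_{\mathbf k}(G,\Psi)$. (2) The root space $\mathfrak g_{\eta(\mathbf k)}$ is independent of the Serre relations, i.e. the ideal of $\mathcal{LS}(G,\Psi)$ generated by the Serre elements has zero component in degree $\mathbf k$.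
   Context: BKM superalgebras (over $\mathbb C$). Let $I=\{1,\dots,n\}$ or $I=\mathbb N$, and $\Psi\subseteq I$. A BKM supermatrix is a matrix $A=(a_{ij})_{i,j\in I}$ together with $\Psi$ such that: $a_{ii}=2$ or $a_{ii}\le 0$; $a_{ij}\le 0$ if $i\ne j$; $a_{ij}=0\iff a_{ji}=0$; $a_{ij}\in\mathbb Z$ if $a_{ii}=2$; $a_{ij}\in 2\mathbb Z$ if $a_{ii}=2$ and $i\in\Psi$; $A$ is symmetrizable ($DA$ symmetric for some diagonal $D$ with positive entries). Put $I^{re}=\{i:a_{ii}=2\}$, $\Psi^{re}=\Psi\cap I^{re}$, $\Psi_0=\{i\in\Psi:a_{ii}=0\}$. The BKM superalgebra $\mathfrak g(A,\Psi)$ is the Lie superalgebra generated by $e_i,f_i,h_i$ ($i\in I$), with $h_i$ even, $e_i,f_i$ odd if $i\in\Psi$ and even otherwise, and relations: $[h_i,h_j]=0$; $[h_i,e_j]=a_{ij}e_j$, $[h_i,f_j]=-a_{ij}f_j$; $[e_i,f_j]=\delta_{ij}h_i$; the Serre relations: $(\mathrm{ad}\,e_i)^{1-a_{ij}}e_j=0=(\mathrm{ad}\,f_i)^{1-a_{ij}}f_j$ if $i\in I^{re}$, $i\neq j$; $(\mathrm{ad}\,e_i)^{1-a_{ij}/2}e_j=0=(\mathrm{ad}\,f_i)^{1-a_{ij}/2}f_j$ if $i\in\Psi^{re}$, $i\ne j$; $(\mathrm{ad}\,e_i)^{1-a_{ii}/2}e_i=0=(\mathrm{ad}\,f_i)^{1-a_{ii}/2}f_i$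 if $i\in\Psi_0$; and the commutation relations $[e_i,e_j]=0=[f_i,f_j]$ if $a_{ij}=0$. The Serre elements are the left-hand sides $(\mathrm{ad}\,e_i)^{1-a_{ij}}e_j$, $(\mathrm{ad}\,e_i)^{1-a_{ij}/2}e_j$, $(\mathrm{ad}\,e_i)^{1-a_{ii}/2}e_i$ under the stated conditions. $\mathfrak g$ is graded by $Q=\bigoplus_{i\in I}\mathbb Z\alpha_i$ with $\deg e_i=\alpha_i$, $\deg f_i=-\alpha_i$, $\deg h_i=0$; $\mathfrak g_\alpha$ is the graded component (root space), $\operatorname{mult}(\alpha)=\dim\mathfrak g_\alpha$, and $\mathfrak n_+=\bigoplus_{\alpha\in Q_+\setminus\{0\}}\mathfrak g_\alpha$ is the subalgebra generated by the $e_i$. One has $\mathfrak g=\mathfrak n_-\oplus\mathfrak h\oplus\mathfrak n_+$. $\mathbb Z_+[I]$ is the set of finitely supported tuples $\mathbf k=(k_i:i\in I)$ of non-negative integers; $\eta(\mathbf k)=\sum k_i\alpha_i$. The quasi Dynkin diagram $(G,\Psi)$ is the simple graph $G$ with vertex set $I$, where $i\ne j$ are adjacent iff $a_{ij}\ne0$, together with the set $\Psi$ of odd vertices. $\mathcal{LS}(G,\Psi)$ is the quotient of the free Lie superalgebra on generators $e_i$ ($i\in I$; odd iff $i\in\Psi$) by the ideal generated by $[e_i,e_j]$ for all non-adjacent $i\neq j$; it is graded by $\mathbb Z_+[I]$, with graded components $\mathcal{LS}_{\mathbf k}(G,\Psi)$.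
   Formalization: As printed, (ad e_i)^{1-a_ij/2} e_j = 0 for i in Ψ^re forces e_j = 0 when a_ij < 0, so the claim fails; g is defined here with (ad [e_i,e_i])^{1-a_ij/2} e_j = 0 (same for f) instead, and (2) is shown both for these Serre elements and with the printed ones added. *)

theory Defs
  imports
    "Jordan_Normal_Form.VS_Connect"
    "HOL-Algebra.QuotRing"
    "HOL-Library.Poly_Mapping"
    "HOL-Library.Z2"
    "HOL-Library.Countable"
begin

section \<open>Complex superalgebras\<close>

text \<open>
  The field \<open>mult\<close> of the record is the (in general non-associative) bracket; the field \<open>one\<close>,
  which is forced on us by the record \<open>module\<close>, is never used.
  \<open>homog L p\<close> is the even (\<open>p = 0\<close>) or odd (\<open>p = 1\<close>) part of \<open>L\<close>.
\<close>

record 'a superalg = "(complex, 'a) module" +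
  homog :: "bit \<Rightarrow> 'a set"

definition ad :: "'a superalg \<Rightarrow> 'a \<Rightarrow> 'a \<Rightarrow> 'a" where
  "ad L x y = x \<otimes>\<^bsub>L\<^esub> y"

definition superalg_ideal :: "'a set \<Rightarrow> 'a superalg \<Rightarrow> bool" where
  "superalg_ideal J L \<longleftrightarrow> subspace class_ring J L \<and>
     (\<forall>x\<in>carrier L. \<forall>y\<in>J. x \<otimes>\<^bsub>L\<^esub> y \<in> J \<and> y \<otimes>\<^bsub>L\<^esub> x \<in> J)"

definition ideal_gen :: "'a superalg \<Rightarrow> 'a set \<Rightarrow> 'a set" where
  "ideal_gen L R = \<Inter>{J. superalg_ideal J L \<and> R \<subseteq> J}"

definition subalgebra :: "'a set \<Rightarrow> 'a superalg \<Rightarrow> bool" where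
  "subalgebra B L \<longleftrightarrow> subspace class_ring B L \<and> (\<forall>x\<in>B. \<forall>y\<in>B. x \<otimes>\<^bsub>L\<^esub> y \<in> B)"

definition subalgebra_gen :: "'a superalg \<Rightarrow> 'a set \<Rightarrow> 'a set" where
  "subalgebra_gen L S = \<Inter>{B. subalgebra B L \<and> S \<subseteq> B}"

definition quot :: "'a superalg \<Rightarrow> 'a set \<Rightarrow> 'a set superalg" where
  "quot L J =
     \<lparr>carrier = a_rcosets\<^bsub>L\<^esub> J, mult = rcoset_mult L J, one = J, zero = J, add = set_add L,
      smult = (\<lambda>c X. \<Union>x\<in>X. J +>\<^bsub>L\<^esub> (c \<odot>\<^bsub>L\<^esub> x)),
      homog = (\<lambda>p. (\<lambda>x. J +>\<^bsub>L\<^esub> x) ` homog L p)\<rparr>"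

definition superalg_hom :: "'a superalg \<Rightarrow> 'b superalg \<Rightarrow> ('a \<Rightarrow> 'b) set" where
  "superalg_hom L M = {\<phi> \<in> LinearCombinations.module_hom class_ring L M.
     (\<forall>x\<in>carrier L. \<forall>y\<in>carrier L. \<phi> (x \<otimes>\<^bsub>L\<^esub> y) = \<phi> x \<otimes>\<^bsub>M\<^esub> \<phi> y) \<and>
     (\<forall>p. \<phi> ` homog L p \<subseteq> homog M p)}"

definition dim_of :: "'a superalg \<Rightarrow> 'a set \<Rightarrow> nat" where
  "dim_of L W = vectorspace.dim class_ring (L\<lparr>carrier := W\<rparr>)"

section \<open>Lie superalgebras given by generators and relations\<close>

datatype 'x word = Gen 'x | Br "'x word" "'x word"

primrec word_deg :: "('x \<Rightarrow> 'd::monoid_add) \<Rightarrow> 'x word \<Rightarrow> 'd" where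
  "word_deg deg (Gen x) = deg x"
| "word_deg deg (Br s t) = word_deg deg s + word_deg deg t"

primrec word_eval :: "'a superalg \<Rightarrow> ('x \<Rightarrow> 'a) \<Rightarrow> 'x word \<Rightarrow> 'a" where
  "word_eval L g (Gen x) = g x"
| "word_eval L g (Br s t) = word_eval L g s \<otimes>\<^bsub>L\<^esub> word_eval L g t"

text \<open>The free non-associative superalgebra: formal linear combinations of bracketed words, where
  \<open>par x\<close> is the parity of the generator \<open>x\<close>.\<close>

definition free_nonassoc :: "('x \<Rightarrow> bit) \<Rightarrow> ('x word \<Rightarrow>\<^sub>0 complex) superalg" where
  "free_nonassoc par =
     \<lparr>carrier = UNIV,
      mult = (\<lambda>u v. \<Sum>s\<in>Poly_Mapping.keys u. \<Sum>t\<in>Poly_Mapping.keys v.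
                Poly_Mapping.single (Br s t) (Poly_Mapping.lookup u s * Poly_Mapping.lookup v t)),
      one = 0, zero = 0, add = (+),
      smult = (\<lambda>c. Poly_Mapping.map ((*) c)),
      homog = (\<lambda>p. {u. \<forall>s\<in>Poly_Mapping.keys u. word_deg par s = p})\<rparr>"

definition super_sign :: "bit \<Rightarrow> bit \<Rightarrow> complex" where
  "super_sign p q = (if p = 1 \<and> q = 1 then -1 else 1)"

definition super_identities :: "'a superalg \<Rightarrow> 'a set" where
  "super_identities L =
     {x \<otimes>\<^bsub>L\<^esub> y \<oplus>\<^bsub>L\<^esub> super_sign p q \<odot>\<^bsub>L\<^esub> (y \<otimes>\<^bsub>L\<^esub> x) | p q x y. x \<in> homog L p \<and> y \<in> homog L q} \<union>
     {x \<otimes>\<^bsub>L\<^esub> (y \<otimes>\<^bsub>L\<^esub> z) \<ominus>\<^bsub>L\<^esub>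
        ((x \<otimes>\<^bsub>L\<^esub> y) \<otimes>\<^bsub>L\<^esub> z \<oplus>\<^bsub>L\<^esub> super_sign p q \<odot>\<^bsub>L\<^esub> (y \<otimes>\<^bsub>L\<^esub> (x \<otimes>\<^bsub>L\<^esub> z)))
      | p q x y z. x \<in> homog L p \<and> y \<in> homog L q \<and> z \<in> carrier L}"

definition free_lie :: "('x \<Rightarrow> bit) \<Rightarrow> ('x word \<Rightarrow>\<^sub>0 complex) set superalg" where
  "free_lie par =
     quot (free_nonassoc par) (ideal_gen (free_nonassoc par) (super_identities (free_nonassoc par)))"

definition free_gen :: "('x \<Rightarrow> bit) \<Rightarrow> 'x \<Rightarrow> ('x word \<Rightarrow>\<^sub>0 complex) set" where
  "free_gen par x =
     ideal_gen (free_nonassoc par) (super_identities (free_nonassoc par))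
       +>\<^bsub>free_nonassoc par\<^esub> Poly_Mapping.single (Gen x) 1"

type_synonym 'x presented = "('x word \<Rightarrow>\<^sub>0 complex) set set"

definition presented_lie ::
  "('x \<Rightarrow> bit) \<Rightarrow> ('x word \<Rightarrow>\<^sub>0 complex) set set \<Rightarrow> 'x presented superalg" where
  "presented_lie par R = quot (free_lie par) (ideal_gen (free_lie par) R)"

definition presented_gen ::
  "('x \<Rightarrow> bit) \<Rightarrow> ('x word \<Rightarrow>\<^sub>0 complex) set set \<Rightarrow> 'x \<Rightarrow> 'x presented" where
  "presented_gen par R x = ideal_gen (free_lie par) R +>\<^bsub>free_lie par\<^esub> free_gen par x"

text \<open>For an algebra generated by the family \<open>g\<close>, with relations homogeneous for \<open>deg\<close>, this is the
  component of degree \<open>d\<close> of the grading in which \<open>g x\<close> has degree \<open>deg x\<close>.\<close>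

definition graded_comp ::
  "'a superalg \<Rightarrow> ('x \<Rightarrow> 'a) \<Rightarrow> ('x \<Rightarrow> 'd::monoid_add) \<Rightarrow> 'd \<Rightarrow> 'a set" where
  "graded_comp L g deg d =
     LinearCombinations.module.span class_ring L {word_eval L g w | w. word_deg deg w = d}"

section \<open>BKM supermatrices and Serre elements\<close>

text \<open>The index set is a countable type: up to relabelling, such a type is \<open>{1..n}\<close> with \<open>n \<ge> 1\<close>
  or the set of natural numbers.\<close>

definition bkm_supermatrix :: "('i::countable \<Rightarrow> 'i \<Rightarrow> real) \<Rightarrow> 'i set \<Rightarrow> bool" where
  "bkm_supermatrix A \<Psi> \<longleftrightarrow>
     (\<forall>i. A i i = 2 \<or> A i i \<le> 0) \<and>
     (\<forall>i j. i \<noteq> j \<longrightarrow> A i j \<le> 0) \<and>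
     (\<forall>i j. A i j = 0 \<longleftrightarrow> A j i = 0) \<and>
     (\<forall>i j. A i i = 2 \<longrightarrow> A i j \<in> \<int>) \<and>
     (\<forall>i j. A i i = 2 \<and> i \<in> \<Psi> \<longrightarrow> A i j / 2 \<in> \<int>) \<and>
     (\<exists>d. (\<forall>i. 0 < d i) \<and> (\<forall>i j. d i * A i j = d j * A j i))"

definition I_re :: "('i \<Rightarrow> 'i \<Rightarrow> real) \<Rightarrow> 'i set" where
  "I_re A = {i. A i i = 2}"

definition Psi_re :: "('i \<Rightarrow> 'i \<Rightarrow> real) \<Rightarrow> 'i set \<Rightarrow> 'i set" where
  "Psi_re A \<Psi> = \<Psi> \<inter> I_re A"

definition Psi_0 :: "('i \<Rightarrow> 'i \<Rightarrow> real) \<Rightarrow> 'i set \<Rightarrow> 'i set" where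
  "Psi_0 A \<Psi> = {i \<in> \<Psi>. A i i = 0}"

text \<open>
  Serre elements in \<open>L\<close> for the family \<open>x\<close> (the \<open>e\<^sub>i\<close> or the \<open>f\<^sub>i\<close>).  The second family uses
  \<open>ad [x\<^sub>i, x\<^sub>i]\<close>, where \<open>[x\<^sub>i, x\<^sub>i]\<close> is the even root vector of weight \<open>2\<alpha>\<^sub>i\<close>.  It is often printed
  as \<open>(ad x\<^sub>i)\<close> to the power \<open>1 - a\<^sub>i\<^sub>j/2\<close>, applied to \<open>x\<^sub>j\<close> (\<open>short_odd_serre_elements\<close> below).
  Imposed as a relation, the latter is too strong: if \<open>i\<close> is odd and real, \<open>a\<^sub>i\<^sub>j = -2\<close> and
  \<open>(ad e\<^sub>i)\<^sup>2 e\<^sub>j = 0\<close>, then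
  \<open>0 = [f\<^sub>i, [e\<^sub>i, [e\<^sub>i, e\<^sub>j]]] = (2 + a\<^sub>i\<^sub>j) [e\<^sub>i, e\<^sub>j] - a\<^sub>i\<^sub>j [e\<^sub>i, e\<^sub>j] = 2 [e\<^sub>i, e\<^sub>j]\<close> and
  \<open>0 = [f\<^sub>i, [e\<^sub>i, e\<^sub>j]] = a\<^sub>i\<^sub>j e\<^sub>j\<close>, so \<open>e\<^sub>j = 0\<close>; likewise for every \<open>a\<^sub>i\<^sub>j < 0\<close>.
\<close>

definition serre_elements ::
  "('i \<Rightarrow> 'i \<Rightarrow> real) \<Rightarrow> 'i set \<Rightarrow> 'a superalg \<Rightarrow> ('i \<Rightarrow> 'a) \<Rightarrow> 'a set" where
  "serre_elements A \<Psi> L x =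
     {(ad L (x i) ^^ nat \<lfloor>1 - A i j\<rfloor>) (x j) | i j. i \<in> I_re A \<and> i \<noteq> j} \<union>
     {(ad L (x i \<otimes>\<^bsub>L\<^esub> x i) ^^ nat \<lfloor>1 - A i j / 2\<rfloor>) (x j) | i j. i \<in> Psi_re A \<Psi> \<and> i \<noteq> j} \<union>
     {(ad L (x i) ^^ nat \<lfloor>1 - A i i / 2\<rfloor>) (x i) | i. i \<in> Psi_0 A \<Psi>}"

definition short_odd_serre_elements ::
  "('i \<Rightarrow> 'i \<Rightarrow> real) \<Rightarrow> 'i set \<Rightarrow> 'a superalg \<Rightarrow> ('i \<Rightarrow> 'a) \<Rightarrow> 'a set" where
  "short_odd_serre_elements A \<Psi> L x =
     {(ad L (x i) ^^ nat \<lfloor>1 - A i j / 2\<rfloor>) (x j) | i j. i \<in> Psi_re A \<Psi> \<and> i \<noteq> j}"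

section \<open>BKM superalgebras\<close>

datatype 'i bkm_generator = E 'i | F 'i | H 'i

definition vertex_parity :: "'i set \<Rightarrow> 'i \<Rightarrow> bit" where
  "vertex_parity \<Psi> i = (if i \<in> \<Psi> then 1 else 0)"

primrec bkm_parity :: "'i set \<Rightarrow> 'i bkm_generator \<Rightarrow> bit" where
  "bkm_parity \<Psi> (E i) = vertex_parity \<Psi> i"
| "bkm_parity \<Psi> (F i) = vertex_parity \<Psi> i"
| "bkm_parity \<Psi> (H i) = 0"

primrec bkm_degree :: "'i bkm_generator \<Rightarrow> 'i \<Rightarrow>\<^sub>0 int" where
  "bkm_degree (E i) = Poly_Mapping.single i 1"
| "bkm_degree (F i) = - Poly_Mapping.single i 1"
| "bkm_degree (H i) = 0"

definition bkm_relations ::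
  "('i \<Rightarrow> 'i \<Rightarrow> real) \<Rightarrow> 'i set \<Rightarrow> ('i bkm_generator word \<Rightarrow>\<^sub>0 complex) set set" where
  "bkm_relations A \<Psi> =
     (let L = free_lie (bkm_parity \<Psi>);
          e = (\<lambda>i. free_gen (bkm_parity \<Psi>) (E i));
          f = (\<lambda>i. free_gen (bkm_parity \<Psi>) (F i));
          h = (\<lambda>i. free_gen (bkm_parity \<Psi>) (H i))
      in {h i \<otimes>\<^bsub>L\<^esub> h j | i j. True} \<union>
         {h i \<otimes>\<^bsub>L\<^esub> e j \<ominus>\<^bsub>L\<^esub> complex_of_real (A i j) \<odot>\<^bsub>L\<^esub> e j | i j. True} \<union>
         {h i \<otimes>\<^bsub>L\<^esub> f j \<oplus>\<^bsub>L\<^esub> complex_of_real (A i j) \<odot>\<^bsub>L\<^esub> f j | i j. True} \<union>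
         {e i \<otimes>\<^bsub>L\<^esub> f j \<ominus>\<^bsub>L\<^esub> (if i = j then h i else \<zero>\<^bsub>L\<^esub>) | i j. True} \<union>
         serre_elements A \<Psi> L e \<union> serre_elements A \<Psi> L f \<union>
         {e i \<otimes>\<^bsub>L\<^esub> e j | i j. A i j = 0} \<union> {f i \<otimes>\<^bsub>L\<^esub> f j | i j. A i j = 0})"

definition bkm :: "('i \<Rightarrow> 'i \<Rightarrow> real) \<Rightarrow> 'i set \<Rightarrow> 'i bkm_generator presented superalg" where
  "bkm A \<Psi> = presented_lie (bkm_parity \<Psi>) (bkm_relations A \<Psi>)"

definition bkm_gen ::
  "('i \<Rightarrow> 'i \<Rightarrow> real) \<Rightarrow> 'i set \<Rightarrow> 'i bkm_generator \<Rightarrow> 'i bkm_generator presented" where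
  "bkm_gen A \<Psi> = presented_gen (bkm_parity \<Psi>) (bkm_relations A \<Psi>)"

definition root_space ::
  "('i \<Rightarrow> 'i \<Rightarrow> real) \<Rightarrow> 'i set \<Rightarrow> ('i \<Rightarrow>\<^sub>0 int) \<Rightarrow> 'i bkm_generator presented set" where
  "root_space A \<Psi> \<alpha> = graded_comp (bkm A \<Psi>) (bkm_gen A \<Psi>) bkm_degree \<alpha>"

definition root_mult :: "('i \<Rightarrow> 'i \<Rightarrow> real) \<Rightarrow> 'i set \<Rightarrow> ('i \<Rightarrow>\<^sub>0 int) \<Rightarrow> nat" where
  "root_mult A \<Psi> \<alpha> = dim_of (bkm A \<Psi>) (root_space A \<Psi> \<alpha>)"

definition n_plus :: "('i \<Rightarrow> 'i \<Rightarrow> real) \<Rightarrow> 'i set \<Rightarrow> 'i bkm_generator presented set" where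
  "n_plus A \<Psi> = subalgebra_gen (bkm A \<Psi>) (range (\<lambda>i. bkm_gen A \<Psi> (E i)))"

definition eta :: "('i \<Rightarrow>\<^sub>0 nat) \<Rightarrow> 'i \<Rightarrow>\<^sub>0 int" where
  "eta k = (\<Sum>i\<in>Poly_Mapping.keys k. Poly_Mapping.single i (int (Poly_Mapping.lookup k i)))"

section \<open>Free partially commutative Lie superalgebras\<close>

text \<open>Edge relation of the quasi Dynkin diagram.\<close>

definition dynkin_adj :: "('i \<Rightarrow> 'i \<Rightarrow> real) \<Rightarrow> 'i \<Rightarrow> 'i \<Rightarrow> bool" where
  "dynkin_adj A i j \<longleftrightarrow> i \<noteq> j \<and> A i j \<noteq> 0"

definition LS_relations ::
  "('i \<Rightarrow> 'i \<Rightarrow> bool) \<Rightarrow> 'i set \<Rightarrow> ('i word \<Rightarrow>\<^sub>0 complex) set set" where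
  "LS_relations adj \<Psi> =
     {free_gen (vertex_parity \<Psi>) i \<otimes>\<^bsub>free_lie (vertex_parity \<Psi>)\<^esub> free_gen (vertex_parity \<Psi>) j
      | i j. i \<noteq> j \<and> \<not> adj i j}"

definition LS :: "('i \<Rightarrow> 'i \<Rightarrow> bool) \<Rightarrow> 'i set \<Rightarrow> 'i presented superalg" where
  "LS adj \<Psi> = presented_lie (vertex_parity \<Psi>) (LS_relations adj \<Psi>)"

definition LS_gen :: "('i \<Rightarrow> 'i \<Rightarrow> bool) \<Rightarrow> 'i set \<Rightarrow> 'i \<Rightarrow> 'i presented" where
  "LS_gen adj \<Psi> = presented_gen (vertex_parity \<Psi>) (LS_relations adj \<Psi>)"

definition LS_comp ::
  "('i \<Rightarrow> 'i \<Rightarrow> bool) \<Rightarrow> 'i set \<Rightarrow> ('i \<Rightarrow>\<^sub>0 nat) \<Rightarrow> 'i presented set" where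
  "LS_comp adj \<Psi> k =
     graded_comp (LS adj \<Psi>) (LS_gen adj \<Psi>) (\<lambda>i. Poly_Mapping.single i 1) k"

end

theory Submission
  imports Defs
begin

text \<open>
  For the injectivity of \<open>LS\<^sub>k \<rightarrow> \<gg>\<^sub>\<eta>\<close> we realise \<open>\<gg>\<close> by operators, in place of a PBW theorem.  Let \<open>W\<close> be the
  free non-associative algebra on the index set.  On \<open>W \<oplus> \<hh> \<oplus> W\<close>, a lift of the adjoint representation, let
  \<open>e\<^sub>i\<close> bracket on the positive copy of \<open>W\<close> and act on the negative one by the twisted derivation with
  \<open>f\<^sub>j \<mapsto> \<delta>\<^sub>i\<^sub>j h\<^sub>i\<close>; let \<open>f\<^sub>i\<close> act symmetrically.  Then \<open>[e\<^sub>i, f\<^sub>j] = \<delta>\<^sub>i\<^sub>j h\<^sub>i\<close> holds exactly, before any identity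
  is imposed on \<open>W\<close>.  Let \<open>J\<close> be the ideal of \<open>W\<close> generated by the super identities, the commutation
  relations and the Serre elements.  The rank one computation shows that the twisted derivations preserve \<open>J\<close>,
  so \<open>J \<oplus> 0 \<oplus> J\<close> is invariant, and all relations of \<open>\<gg>\<close> act as zero on the quotient.  Applying a
  positive element \<open>u\<close> of \<open>\<gg>\<close> to the degree derivation (which is added to \<open>\<hh>\<close>) returns \<open>u\<close> up to a nonzero
  factor; hence \<open>u = 0\<close> in \<open>\<gg>\<close> implies \<open>u \<in> J\<close>.

  Every Serre element that is not a commutation relation has degree at least 2 in some real or
  odd isotropic index, so \<open>J\<close> adds nothing in the degrees \<open>k\<close> of the theorem.  Surjectivity is the
  spanning half of the triangular decomposition.
\<close>

section \<open>Free vector spaces\<close>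

text \<open>The usual difficulty is to know that the relations among the e_i alone already define
  n_+ inside the BKM superalgebra. Here the operators are defined by recursion on bracketed words,
  where nothing has to be checked for well-definedness; the whole burden moves to the stability of
  one ideal J. The same J serves both copies, because the relations among the e_i and among the f_i
  have the same form. Two features make this work. The relations generating J have length at least
  two, so elements of J have no coordinate at a generator, and the h_i-component of an opposite
  generator vanishes on J. The Serre elements with ad [e_i, e_i] follow from those of the first
  family, since ad [e_i, e_i] = 2 (ad e_i)^2 for odd e_i. The degree derivation is adjoined because
  the h_i may fail to detect an element: for A = 0 they all act as zero, whereas the degree
  derivation multiplies a word, up to sign, by its length.\<close>

definition scl :: "complex \<Rightarrow> ('a \<Rightarrow>\<^sub>0 complex) \<Rightarrow> 'a \<Rightarrow>\<^sub>0 complex" where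
  "scl c = Poly_Mapping.map ((*) c)"

abbreviation sgl :: "'a \<Rightarrow> 'a \<Rightarrow>\<^sub>0 complex" where
  "sgl w \<equiv> Poly_Mapping.single w 1"

lemma lookup_scl [simp]: "Poly_Mapping.lookup (scl c u) w = c * Poly_Mapping.lookup u w"
  by (simp add: scl_def Poly_Mapping.map.rep_eq when_def)

interpretation pm: Vector_Spaces.vector_space scl
  by unfold_locales (auto intro!: poly_mapping_eqI simp: lookup_add algebra_simps)

lemma scl_single: "scl c (Poly_Mapping.single w d) = Poly_Mapping.single w (c * d)"
  by (intro poly_mapping_eqI) (simp add: lookup_single when_def)

lemma keys_scl: "Poly_Mapping.keys (scl c u) \<subseteq> Poly_Mapping.keys u"
  by (auto simp: in_keys_iff)

definition lin :: "('a \<Rightarrow> 'b \<Rightarrow>\<^sub>0 complex) \<Rightarrow> ('a \<Rightarrow>\<^sub>0 complex) \<Rightarrow> 'b \<Rightarrow>\<^sub>0 complex" where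
  "lin f u = (\<Sum>w\<in>Poly_Mapping.keys u. scl (Poly_Mapping.lookup u w) (f w))"

definition islin :: "(('a \<Rightarrow>\<^sub>0 complex) \<Rightarrow> 'b \<Rightarrow>\<^sub>0 complex) \<Rightarrow> bool" where
  "islin f \<longleftrightarrow> (\<forall>u v. f (u + v) = f u + f v) \<and> (\<forall>c u. f (scl c u) = scl c (f u))"

lemma islin_add: "islin f \<Longrightarrow> f (u + v) = f u + f v"
  and islin_scl: "islin f \<Longrightarrow> f (scl c u) = scl c (f u)"
  by (auto simp: islin_def)

lemma islin_0: "islin f \<Longrightarrow> f 0 = 0"
  using islin_scl[of f 0 0] by simp

lemma islin_minus: "islin f \<Longrightarrow> f (- u) = - f u"
  using islin_scl[of f "-1" u] by simp

lemma islin_diff: "islin f \<Longrightarrow> f (u - v) = f u - f v"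
  using islin_add[of f u "- v"] by (simp add: islin_minus)

lemmas islin_simps = islin_add islin_scl islin_0 islin_minus islin_diff

lemma lin_superset:
  assumes "finite S" "Poly_Mapping.keys u \<subseteq> S"
  shows "lin f u = (\<Sum>w\<in>S. scl (Poly_Mapping.lookup u w) (f w))"
  unfolding lin_def using assms by (intro sum.mono_neutral_left) (auto simp: in_keys_iff)

lemma islin_lin [simp]: "islin (lin f)"
  unfolding islin_def
proof (intro conjI allI)
  fix u v :: "'a \<Rightarrow>\<^sub>0 complex" and c
  have "lin f w = (\<Sum>x\<in>Poly_Mapping.keys u \<union> Poly_Mapping.keys v. scl (Poly_Mapping.lookup w x) (f
      x))"
    if "w \<in> {u, v, u + v}" for w
    using that keys_add[of u v] by (intro lin_superset) auto
  then show "lin f (u + v) = lin f u + lin f v"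
    by (simp add: lookup_add pm.scale_left_distrib sum.distrib)
  have "lin f (scl c u) = (\<Sum>x\<in>Poly_Mapping.keys u. scl (Poly_Mapping.lookup (scl c u) x) (f x))"
    by (intro lin_superset keys_scl) simp
  then show "lin f (scl c u) = scl c (lin f u)"
    by (simp add: lin_def pm.scale_sum_right)
qed

lemmas lin_add [simp] = islin_add[OF islin_lin]
  and lin_scl [simp] = islin_scl[OF islin_lin]
  and lin_0 [simp] = islin_0[OF islin_lin]
  and lin_minus [simp] = islin_minus[OF islin_lin]
  and lin_diff [simp] = islin_diff[OF islin_lin]

lemma lin_sgl [simp]: "lin f (Poly_Mapping.single w c) = scl c (f w)"
  by (cases "c = 0") (auto simp: lin_def)

lemma span_sgl: "u \<in> pm.span (sgl ` Poly_Mapping.keys u)"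
proof -
  have "u = (\<Sum>w\<in>Poly_Mapping.keys u. scl (Poly_Mapping.lookup u w) (sgl w))"
    by (intro poly_mapping_eqI)
      (auto simp: scl_single lookup_sum lookup_single when_def in_keys_iff sum.If_cases if_distrib
          cong: if_cong)
  also have "\<dots> \<in> pm.span (sgl ` Poly_Mapping.keys u)"
    by (intro pm.span_sum pm.span_scale pm.span_base) auto
  finally show ?thesis .
qed

lemma span_induct_sub:
  assumes "u \<in> pm.span S" "pm.subspace {u. P u}" "\<And>x. x \<in> S \<Longrightarrow> P x"
  shows "P u"
  using pm.span_induct[OF assms(1), of P] assms(2,3) by auto

lemma pm_induct:
  assumes "pm.subspace {u. P u}" "\<And>w. P (sgl w)"
  shows "P u"
  using span_induct_sub[OF span_sgl, of P u] assms by auto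

lemma lin_ext:
  assumes "islin f" "islin g" "\<And>w. f (sgl w) = g (sgl w)"
  shows "f u = g u"
  by (rule pm_induct[where P = "\<lambda>u. f u = g u"])
    (use assms in \<open>auto simp: pm.subspace_def islin_simps\<close>)

lemma subspace_vimage: "islin f \<Longrightarrow> pm.subspace T \<Longrightarrow> pm.subspace {u. f u \<in> T}"
  by (auto simp: pm.subspace_def islin_simps)

lemma span_image_sub:
  assumes "islin f" "pm.subspace T" "\<And>x. x \<in> S \<Longrightarrow> f x \<in> T" "u \<in> pm.span S"
  shows "f u \<in> T"
  using span_induct_sub[OF assms(4) subspace_vimage[OF assms(1,2)]] assms(3) by auto

lemma islin_comp: "islin f \<Longrightarrow> islin g \<Longrightarrow> islin (\<lambda>u. f (g u))"
  by (simp add: islin_def)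

lemma islin_id [simp]: "islin (\<lambda>u. u)"
  and islin_plus: "islin f \<Longrightarrow> islin g \<Longrightarrow> islin (\<lambda>u. f u + g u)"
  and islin_minus': "islin f \<Longrightarrow> islin g \<Longrightarrow> islin (\<lambda>u. f u - g u)"
  and islin_scale: "islin f \<Longrightarrow> islin (\<lambda>u. scl c (f u))"
  and islin_zero: "islin (\<lambda>u. 0)"
  by (auto simp: islin_def pm.scale_right_distrib pm.scale_right_diff_distrib mult.commute
      algebra_simps)

lemmas islin_intros = islin_lin islin_id islin_comp[OF islin_lin] islin_plus islin_minus'
    islin_scale islin_zero

lemma islin_lin_param:
  assumes "\<And>w. islin (\<lambda>v. f w v)"
  shows "islin (\<lambda>v. lin (\<lambda>w. f w v) u)"
  unfolding islin_def lin_def using assms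
  by (auto simp: islin_simps pm.scale_right_distrib sum.distrib pm.scale_sum_right mult.commute)

lemma lin_id: "lin sgl u = u"
  by (rule lin_ext) (auto)

lemma lin_cong: "(\<And>w. w \<in> Poly_Mapping.keys u \<Longrightarrow> f w = g w) \<Longrightarrow> lin f u = lin g u"
  by (simp add: lin_def)

lemma lin_in: "pm.subspace T \<Longrightarrow> (\<And>w. w \<in> Poly_Mapping.keys u \<Longrightarrow> f w \<in> T) \<Longrightarrow> lin f u \<in> T"
  unfolding lin_def by (intro pm.subspace_sum pm.subspace_scale) auto

section \<open>The free non-associative algebra\<close>

definition nmul :: "('x word \<Rightarrow>\<^sub>0 complex) \<Rightarrow> ('x word \<Rightarrow>\<^sub>0 complex) \<Rightarrow> 'x word \<Rightarrow>\<^sub>0 complex" where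
  "nmul u v = lin (\<lambda>s. lin (\<lambda>t. sgl (Br s t)) v) u"

lemma islin_nmul_left [simp]: "islin (\<lambda>u. nmul u v)"
  unfolding nmul_def by simp

lemma islin_nmul_right [simp]: "islin (nmul u)"
  unfolding nmul_def by (rule islin_lin_param) simp

lemmas islin_nmul_intros = islin_intros islin_comp[OF islin_nmul_left] islin_comp[OF
    islin_nmul_right]

lemmas nmul_simps [simp] = islin_simps[OF islin_nmul_left] islin_simps[OF islin_nmul_right]

lemma nmul_sgl [simp]: "nmul (sgl s) (sgl t) = sgl (Br s t)"
  by (simp add: nmul_def)

text \<open>The grading monoid is left open, so that one notion covers the parity, the eigenvalue
  under a Cartan element, and the degrees in the positive cone and in the root lattice.\<close>

definition homo :: "('x \<Rightarrow> 'd::monoid_add) \<Rightarrow> 'd \<Rightarrow> ('x word \<Rightarrow>\<^sub>0 complex) set" where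
  "homo deg d = {u. \<forall>w\<in>Poly_Mapping.keys u. word_deg deg w = d}"

lemma homo_sgl [simp]: "sgl w \<in> homo deg d \<longleftrightarrow> word_deg deg w = d"
  by (simp add: homo_def)

lemma subspace_homo [simp]: "pm.subspace (homo deg d)"
  unfolding pm.subspace_def homo_def using keys_add keys_scl by fastforce

lemmas homo_closed = pm.subspace_0[OF subspace_homo] pm.subspace_add[OF subspace_homo]
  pm.subspace_scale[OF subspace_homo] pm.subspace_diff[OF subspace_homo]

lemma homo_span: "homo deg d = pm.span (sgl ` {w. word_deg deg w = d})"
proof
  show "homo deg d \<subseteq> pm.span (sgl ` {w. word_deg deg w = d})"
  proof
    fix u assume "u \<in> homo deg d"
    then have "sgl ` Poly_Mapping.keys u \<subseteq> sgl ` {w. word_deg deg w = d}"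
      by (auto simp: homo_def)
    then show "u \<in> pm.span (sgl ` {w. word_deg deg w = d})"
      using pm.span_mono span_sgl by blast
  qed
  show "pm.span (sgl ` {w. word_deg deg w = d}) \<subseteq> homo deg d"
    by (rule pm.span_minimal) auto
qed

lemma homo_induct:
  assumes "u \<in> homo deg d" "pm.subspace {u. P u}" "\<And>w. word_deg deg w = d \<Longrightarrow> P (sgl w)"
  shows "P u"
  using span_induct_sub[of u "sgl ` {w. word_deg deg w = d}" P] assms by (auto simp: homo_span)

lemma homo_nmul: "u \<in> homo deg d \<Longrightarrow> v \<in> homo deg d' \<Longrightarrow> nmul u v \<in> homo deg (d + d')"
  unfolding nmul_def by (intro lin_in subspace_homo) (auto simp: homo_def[of deg d] homo_def[of deg
      d'])

abbreviation ssign :: "('x \<Rightarrow> bit) \<Rightarrow> 'x word \<Rightarrow> 'x word \<Rightarrow> complex" where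
  "ssign par s t \<equiv> super_sign (word_deg par s) (word_deg par t)"

lemma super_sign_commute: "super_sign p q = super_sign q p"
  and super_sign_square [simp]: "super_sign p q * super_sign p q = 1"
  and super_sign_square' [simp]: "super_sign p q * (super_sign p q * c) = c"
  and super_sign_swap [simp]: "super_sign p q * super_sign q p
      = 1" "super_sign p q * (super_sign q p * c) = c"
  and super_sign_0 [simp]: "super_sign 0 p = 1" "super_sign p 0 = 1"
  and super_sign_11 [simp]: "super_sign 1 1 = -1"
  and super_sign_nonzero [simp]: "super_sign p q \<noteq> 0"
  by (auto simp: super_sign_def)

lemma super_sign_add: "super_sign (p + q) r = super_sign p r * super_sign q r"
  and super_sign_add': "super_sign r (p + q) = super_sign r p * super_sign r q"
  by (cases p; cases q; cases r; simp add: super_sign_def)+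

subsection \<open>Ideals containing the super identities\<close>

definition nideal :: "('x word \<Rightarrow>\<^sub>0 complex) set \<Rightarrow> bool" where
  "nideal J \<longleftrightarrow> pm.subspace J \<and> (\<forall>u. \<forall>v\<in>J. nmul u v \<in> J \<and> nmul v u \<in> J)"

text \<open>A spanning set of the ideal, closed under multiplication by words. If \<open>S\<close>
  consists of homogeneous elements, so does this set (\<open>ideal_gens_homo\<close>); an induction
  over it therefore has a sign and a weight at hand, which an arbitrary element of the ideal would
  not provide.\<close>

inductive_set ideal_gens :: "('x \<Rightarrow> bit) \<Rightarrow> ('x word \<Rightarrow>\<^sub>0 complex) set \<Rightarrow> ('x word \<Rightarrow>\<^sub>0 complex) set"
  for par S where
  ideal_gens_rel: "x \<in> S \<Longrightarrow> x \<in> ideal_gens par S"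
| ideal_gens_anti: "sgl (Br s t) + scl (ssign par s t) (sgl (Br t s)) \<in> ideal_gens par S"
| ideal_gens_jac: "sgl (Br r (Br s t)) - (sgl (Br (Br r s) t)
    + scl (ssign par r s) (sgl (Br s (Br r t)))) \<in> ideal_gens par S"
| ideal_gens_left: "x \<in> ideal_gens par S \<Longrightarrow> nmul (sgl w) x \<in> ideal_gens par S"
| ideal_gens_right: "x \<in> ideal_gens par S \<Longrightarrow> nmul x (sgl w) \<in> ideal_gens par S"

definition super_ideal :: "('x \<Rightarrow> bit) \<Rightarrow> ('x word \<Rightarrow>\<^sub>0 complex) set \<Rightarrow> ('x word \<Rightarrow>\<^sub>0 complex) set" where
  "super_ideal par S = pm.span (ideal_gens par S)"

lemma super_ideal_subspace [simp]: "pm.subspace (super_ideal par S)"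
  by (simp add: super_ideal_def)

lemmas super_ideal_0 [simp] = pm.subspace_0[OF super_ideal_subspace]
lemmas super_ideal_add = pm.subspace_add[OF super_ideal_subspace]
  and super_ideal_diff = pm.subspace_diff[OF super_ideal_subspace]
  and super_ideal_scl = pm.subspace_scale[OF super_ideal_subspace]
  and super_ideal_neg = pm.subspace_neg[OF super_ideal_subspace]

lemma super_ideal_base: "x \<in> ideal_gens par S \<Longrightarrow> x \<in> super_ideal par S"
  by (simp add: super_ideal_def pm.span_base)

lemma super_ideal_rel: "x \<in> S \<Longrightarrow> x \<in> super_ideal par S"
  by (intro super_ideal_base ideal_gens_rel)

lemma super_ideal_left: assumes "v \<in> super_ideal par S" shows "nmul u v \<in> super_ideal par S"
proof (rule pm_induct[where P = "\<lambda>u. nmul u v \<in> super_ideal par S"])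
  show "pm.subspace {u. nmul u v \<in> super_ideal par S}"
    by (intro subspace_vimage) auto
  show "nmul (sgl w) v \<in> super_ideal par S" for w
    using assms unfolding super_ideal_def by (rule span_image_sub[rotated -1]) (auto intro:
        pm.span_base ideal_gens_left)
qed

lemma super_ideal_right: assumes "v \<in> super_ideal par S" shows "nmul v u \<in> super_ideal par S"
proof (rule pm_induct[where P = "\<lambda>u. nmul v u \<in> super_ideal par S"])
  show "pm.subspace {u. nmul v u \<in> super_ideal par S}"
    by (intro subspace_vimage) auto
  show "nmul v (sgl w) \<in> super_ideal par S" for w
    using assms unfolding super_ideal_def 
    by (rule span_image_sub[where f = "\<lambda>v. nmul v (sgl w)", rotated -1]) (auto intro: pm.span_base
        ideal_gens_right)
qed

lemma nideal_super_ideal: "nideal (super_ideal par S)"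
  by (simp add: nideal_def super_ideal_left super_ideal_right)

lemma super_ideal_anti:
  assumes "u \<in> homo par p" "v \<in> homo par q"
  shows "nmul u v + scl (super_sign p q) (nmul v u) \<in> super_ideal par S"
proof (rule homo_induct[OF assms(1)])
  show "pm.subspace {u. nmul u v + scl (super_sign p q) (nmul v u) \<in> super_ideal par S}"
    by (intro subspace_vimage islin_nmul_intros) auto
  fix s assume s: "word_deg par s = p"
  show "nmul (sgl s) v + scl (super_sign p q) (nmul v (sgl s)) \<in> super_ideal par S"
  proof (rule homo_induct[OF assms(2)])
    show "pm.subspace {v. nmul (sgl s) v + scl (super_sign p q) (nmul v (sgl s))
        \<in> super_ideal par S}"
      by (intro subspace_vimage islin_nmul_intros) auto
    show "nmul (sgl s) (sgl t) + scl (super_sign p q) (nmul (sgl t) (sgl s)) \<in> super_ideal par S"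
      if "word_deg par t = q" for t
      using super_ideal_base[OF ideal_gens_anti[of s t par S]] s that by simp
  qed
qed

lemma super_ideal_jac:
  assumes "u \<in> homo par p" "v \<in> homo par q"
  shows "nmul u (nmul v z) - (nmul (nmul u v) z + scl (super_sign p q) (nmul v (nmul u z)))
      \<in> super_ideal par S"
proof (rule homo_induct[OF assms(1)])
  show "pm.subspace {u. nmul u (nmul v z) - (nmul (nmul u v) z
      + scl (super_sign p q) (nmul v (nmul u z))) \<in> super_ideal par S}"
    by (intro subspace_vimage islin_nmul_intros) auto
  fix r assume r: "word_deg par r = p"
  show "nmul (sgl r) (nmul v z) - (nmul (nmul (sgl r) v) z
      + scl (super_sign p q) (nmul v (nmul (sgl r) z))) \<in> super_ideal par S"
  proof (rule homo_induct[OF assms(2)])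
    show "pm.subspace {v. nmul (sgl r) (nmul v z) - (nmul (nmul (sgl r) v) z
        + scl (super_sign p q) (nmul v (nmul (sgl r) z))) \<in> super_ideal par S}"
      by (intro subspace_vimage islin_nmul_intros) auto
    fix s assume s: "word_deg par s = q"
    show "nmul (sgl r) (nmul (sgl s) z) - (nmul (nmul (sgl r) (sgl s)) z
        + scl (super_sign p q) (nmul (sgl s) (nmul (sgl r) z))) \<in> super_ideal par S"
    proof (rule pm_induct[of "\<lambda>z. nmul (sgl r) (nmul (sgl s) z) - (nmul (nmul (sgl r) (sgl s)) z
        + scl (super_sign p q) (nmul (sgl s) (nmul (sgl r) z))) \<in> super_ideal par S"])
      show "pm.subspace {z. nmul (sgl r) (nmul (sgl s) z) - (nmul (nmul (sgl r) (sgl s)) z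
          + scl (super_sign p q) (nmul (sgl s) (nmul (sgl r) z))) \<in> super_ideal par S}"
        by (intro subspace_vimage islin_nmul_intros) auto
      show "nmul (sgl r) (nmul (sgl s) (sgl t)) - (nmul (nmul (sgl r) (sgl s)) (sgl t)
          + scl (super_sign p q) (nmul (sgl s) (nmul (sgl r) (sgl t)))) \<in> super_ideal par S" for t
        using super_ideal_base[OF ideal_gens_jac[of r s t par S]] r s by simp
    qed
  qed
qed

lemma super_ideal_least:
  assumes J: "nideal J" and S: "S \<subseteq> J"
    and anti: "\<And>s t. sgl (Br s t) + scl (ssign par s t) (sgl (Br t s)) \<in> J"
    and jac: "\<And>r s t. sgl (Br r (Br s t)) - (sgl (Br (Br r s) t)
        + scl (ssign par r s) (sgl (Br s (Br r t)))) \<in> J"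
  shows "super_ideal par S \<subseteq> J"
  unfolding super_ideal_def
proof (rule pm.span_minimal)
  show "pm.subspace J" using J by (simp add: nideal_def)
  show "ideal_gens par S \<subseteq> J"
  proof
    fix x assume "x \<in> ideal_gens par S"
    then show "x \<in> J"
    proof induction
      case (ideal_gens_rel x) then show ?case using S by auto
    next
      case (ideal_gens_anti s t) show ?case by (rule anti)
    next
      case (ideal_gens_jac r s t) show ?case by (rule jac)
    next
      case (ideal_gens_left x w) then show ?case using J by (auto simp: nideal_def)
    next
      case (ideal_gens_right x w) then show ?case using J by (auto simp: nideal_def)
    qed
  qed
qed

text \<open>Containing one super ideal already means containing the super identities on words, so
  only the relations remain to be checked.\<close>

lemma super_ideal_least_over:
  assumes "nideal J" "S \<subseteq> J" "super_ideal par S0 \<subseteq> J"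
  shows "super_ideal par S \<subseteq> J"
proof (rule super_ideal_least)
  have "ideal_gens par S0 \<subseteq> J" using assms(3) super_ideal_base by blast
  then show "sgl (Br s t) + scl (ssign par s t) (sgl (Br t s)) \<in> J"
    "sgl (Br r (Br s t)) - (sgl (Br (Br r s) t) + scl (ssign par r s) (sgl (Br s (Br r t))))
        \<in> J" for r s t
    by (auto intro: ideal_gens_anti ideal_gens_jac)
qed (use assms in auto)

lemma super_ideal_mono: "S \<subseteq> super_ideal par S' \<Longrightarrow> super_ideal par S \<subseteq> super_ideal par S'"
  by (rule super_ideal_least_over[OF nideal_super_ideal]) auto

section \<open>A representation of the BKM superalgebra\<close>

primrec ad_word :: "'x word \<Rightarrow> nat \<Rightarrow> 'x word \<Rightarrow> 'x word" where
  "ad_word s 0 t = t"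
| "ad_word s (Suc n) t = Br s (ad_word s n t)"

text \<open>
  \<open>Wd True w\<close> and \<open>Wd False w\<close> stand for the word \<open>w\<close> in the \<open>e\<^sub>i\<close> and in the \<open>f\<^sub>i\<close>, \<open>Cart (Some i)\<close> for
  \<open>h\<^sub>i\<close>, and \<open>Cart None\<close> for the degree derivation.  Similarly the Boolean argument of the operators below
  selects \<open>e\<close> (\<open>True\<close>) or \<open>f\<close> (\<open>False\<close>).
\<close>

datatype 'i vbasis = Wd bool "'i word" | Cart "'i option"

definition emb :: "bool \<Rightarrow> ('i word \<Rightarrow>\<^sub>0 complex) \<Rightarrow> 'i vbasis \<Rightarrow>\<^sub>0 complex" where
  "emb b = lin (\<lambda>w. sgl (Wd b w))"

lemma islin_emb [simp]: "islin (emb b)"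
  by (simp add: emb_def)

lemmas emb_simps [simp] = islin_simps[OF islin_emb]

lemma emb_sgl [simp]: "emb b (sgl w) = sgl (Wd b w)"
  by (simp add: emb_def)

locale bkm_matrix =
  fixes A :: "'i::countable \<Rightarrow> 'i \<Rightarrow> real" and \<Psi> :: "'i set"
  assumes bkm: "bkm_supermatrix A \<Psi>"
begin

abbreviation par :: "'i \<Rightarrow> bit" where "par \<equiv> vertex_parity \<Psi>"

abbreviation wp :: "'i word \<Rightarrow> bit" where "wp \<equiv> word_deg par"

text \<open>The eigenvalue of \<open>Cart x\<close> on e_j; the value 1 at \<open>None\<close> makes
  \<open>wt None\<close> the length of a word.\<close>

definition weight :: "'i option \<Rightarrow> 'i \<Rightarrow> complex" where
  "weight x j = (case x of None \<Rightarrow> 1 | Some i \<Rightarrow> complex_of_real (A i j))"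

abbreviation wt :: "'i option \<Rightarrow> 'i word \<Rightarrow> complex" where "wt x \<equiv> word_deg (weight x)"

text \<open>The sign in [x_i, h] = \<open>side_sign b\<close> * weight * x_i, where x_i is e_i or
  f_i according to \<open>b\<close>.\<close>

definition side_sign :: "bool \<Rightarrow> complex" where "side_sign b = (if b then -1 else 1)"

text \<open>The factor of h_i in the bracket of the generator of side \<open>b\<close> with the
  opposite one: [e_i, f_i] = h_i, hence [f_i, e_i] = -h_i for even i and h_i for odd i.\<close>

definition chev_coeff :: "bool \<Rightarrow> 'i \<Rightarrow> complex" where
  "chev_coeff b i = (if b then 1 else - super_sign (par i) (par i))"

lemma side_sign_simps [simp]: "side_sign (\<not> b) = - side_sign b" "side_sign b * side_sign b
    = 1" "side_sign b * (side_sign b * z) = z"  "side_sign b \<noteq> 0"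
  by (auto simp: side_sign_def)

lemma chev_coeff_simps: "super_sign (par i) (par i) * (chev_coeff (\<not> b) i * z) =
    - chev_coeff b i * z" "chev_coeff b i \<noteq> 0"
  by (auto simp: chev_coeff_def)

text \<open>
  \<open>tderiv l\<close> is the component in \<open>W\<close> of the derivation \<open>[e\<^sub>l, -]\<close> on words in the \<open>f\<^sub>i\<close>.  The last two summands
  are the brackets with \<open>h\<^sub>l = [e\<^sub>l, f\<^sub>l]\<close>; the component in \<open>\<hh>\<close> is nonzero only on the generator \<open>l\<close> and is
  treated in \<open>chev_basis\<close>.
\<close>

primrec tderiv :: "'i \<Rightarrow> 'i word \<Rightarrow> 'i word \<Rightarrow>\<^sub>0 complex" where
  "tderiv l (Gen j) = 0"
| "tderiv l (Br s t) = nmul (tderiv l s) (sgl t) + scl (super_sign (par l) (wp s)) (nmul (sgl s)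
    (tderiv l t))
     - (if s = Gen l then scl (wt (Some l) t) (sgl t) else 0)
     + (if t = Gen l then scl (super_sign (par l) (wp s) * wt (Some l) s) (sgl s) else 0)"

lemma homo_tderiv:
  fixes deg :: "'i \<Rightarrow> 'd::ab_group_add"
  shows "tderiv l w \<in> homo deg (word_deg deg w - deg l)"
proof (induction w)
  case (Gen x)
  then show ?case by (simp add: homo_closed)
next
  case (Br s t)
  have "nmul (tderiv l s) (sgl t) \<in> homo deg (word_deg deg (Br s t) - deg l)"
    using homo_nmul[OF Br.IH(1), of "sgl t" "word_deg deg t"] by (simp add: algebra_simps)
  moreover have "nmul (sgl s) (tderiv l t) \<in> homo deg (word_deg deg (Br s t) - deg l)"
    using homo_nmul[OF _ Br.IH(2), of "sgl s" "word_deg deg s"] by (simp add: algebra_simps)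
  ultimately show ?case
    unfolding tderiv.simps by (intro homo_closed) (auto intro!: homo_closed simp: algebra_simps)
qed

lemma homo_tderiv_par: "tderiv l w \<in> homo par (wp w + par l)"
  using homo_tderiv[of l w par] by simp

text \<open>A single \<open>tderiv\<close> serves both sides: it is [e_i, -] on words in the f_j,
  while [f_i, -] on words in the e_j differs from it by the sign
  \<open>super_sign (par i) (par i)\<close>. The factor
  \<open>- side_sign b * chev_coeff b i\<close> equals 1 in the first case and this sign in the
  second.\<close>

primrec chev_basis :: "bool \<Rightarrow> 'i \<Rightarrow> 'i vbasis \<Rightarrow> 'i vbasis \<Rightarrow>\<^sub>0 complex" where
  "chev_basis b i (Wd b' w) =
     (if b' = b then sgl (Wd b (Br (Gen i) w))
      else (if w = Gen i then scl (chev_coeff b i) (sgl (Cart (Some i))) else 0)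
          - scl (side_sign b * chev_coeff b i) (emb b' (tderiv i w)))"
| "chev_basis b i (Cart x) = scl (side_sign b * weight x i) (sgl (Wd b (Gen i)))"

primrec cartan_basis :: "'i option \<Rightarrow> 'i vbasis \<Rightarrow> 'i vbasis \<Rightarrow>\<^sub>0 complex" where
  "cartan_basis x (Wd b w) = scl (- side_sign b * wt x w) (sgl (Wd b w))"
| "cartan_basis x (Cart y) = 0"

abbreviation chev :: "bool \<Rightarrow> 'i \<Rightarrow> ('i vbasis \<Rightarrow>\<^sub>0 complex) \<Rightarrow> 'i vbasis \<Rightarrow>\<^sub>0 complex" where
  "chev b i \<equiv> lin (chev_basis b i)"

abbreviation cartan :: "'i option \<Rightarrow> ('i vbasis \<Rightarrow>\<^sub>0 complex) \<Rightarrow> 'i vbasis \<Rightarrow>\<^sub>0 complex" where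
  "cartan x \<equiv> lin (cartan_basis x)"

lemma cartan_emb: "u \<in> homo (weight x) m \<Longrightarrow> cartan x (emb b u) = scl (- side_sign b * m) (emb b u)"
  by (rule homo_induct[where P = "\<lambda>u. cartan x (emb b u) = scl (- side_sign b * m) (emb b u)"])
    (auto simp: pm.subspace_def pm.scale_right_distrib mult.commute)

lemma chev_emb: "chev b i (emb b u) = emb b (nmul (sgl (Gen i)) u)"
  by (rule lin_ext) (auto intro!: islin_comp[OF islin_emb] islin_comp[OF islin_lin])

lemma cartan_chev: "cartan x (chev b i v) - chev b i (cartan x v)
    = scl (- side_sign b * weight x i) (chev b i v)"
proof (rule lin_ext[of "\<lambda>v. cartan x (chev b i v) - chev b i (cartan x v)"])
  show "islin (\<lambda>v. cartan x (chev b i v) - chev b i (cartan x v))" "islin (\<lambda>v. scl (- side_sign b *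
      weight x i) (chev b i v))"
    by (intro islin_intros)+
  fix z :: "'i vbasis"
  have *: "cartan x (emb b' (tderiv i w)) = scl (- side_sign b' * (wt x w
      - weight x i)) (emb b' (tderiv i w))" for b' w
    by (rule cartan_emb[OF homo_tderiv])
  show "cartan x (chev b i (sgl z)) - chev b i (cartan x (sgl z))
      = scl (- side_sign b * weight x i) (chev b i (sgl z))"
  proof (cases z)
    case (Wd b' w)
    show ?thesis
    proof (cases "b' = b")
      case True
      then show ?thesis using Wd by (simp add: algebra_simps)
    next
      case False
      then have "b' = (\<not> b)" by auto
      then show ?thesis using Wd by (cases "w = Gen i") 
         (simp_all add: * algebra_simps pm.scale_right_diff_distrib)
    qed
  next
    case (Cart y)
    then show ?thesis by (simp add: algebra_simps flip: single_diff)
  qed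
qed

lemma A_0: "A i j = 0 \<Longrightarrow> A j i = 0"
  using bkm by (simp add: bkm_supermatrix_def)

text \<open>On a word \<open>w\<close> of side \<open>b\<close> the Leibniz terms of
  \<open>tderiv j (Br (Gen i) w)\<close> cancel. Its correction for i = j leaves the Cartan
  operator, and its correction for \<open>w = Gen j\<close> cancels the image of h_j under the
  generator i. No identity on words enters, so the equation holds before passing to the
  quotient.\<close>

lemma chev_chev:
  "chev b i (chev (\<not> b) j v) - scl (super_sign (par i) (par j)) (chev (\<not> b) j (chev b i v)) =
    (if i = j then scl (chev_coeff b i) (cartan (Some i) v) else 0)" (is "?L v = ?R v")
proof (rule lin_ext[of ?L ?R])
  show "islin ?L" by (intro islin_intros)
  show "islin ?R" by (cases "i = j") (simp_all add: islin_scale islin_zero)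
  fix z :: "'i vbasis"
  consider (main) w where "z = Wd b w" | (other) w where "z = Wd (\<not> b) w" | (Cart) y where "z
      = Cart y"
  proof (cases z)
    case (Wd b' w)
    then show thesis using that by (cases "b' = b") auto
  qed (use that in auto)
  then show "?L (sgl z) = ?R (sgl z)"
  proof cases
    case main
    show ?thesis
      unfolding main
      by (cases "w = Gen j"; cases "i = j"; simp add: chev_emb; cases b; cases "par j"; simp add:
          chev_coeff_def side_sign_def algebra_simps)
  next
    case other
    show ?thesis
      unfolding other
      by (cases "w = Gen i"; cases "i = j"; simp add: chev_emb; cases b; cases "par j"; simp add:
          chev_coeff_def side_sign_def algebra_simps)
  next
    case (Cart y)
    show ?thesis
      unfolding Cart
      by (cases "i = j"; simp add: chev_emb; cases b; cases "par j"; simp add: chev_coeff_def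
          side_sign_def algebra_simps)
  qed
qed

end

section \<open>Homogeneous generators of ideals; powers of ad of a single generator\<close>

lemma subspace_eq: "islin f \<Longrightarrow> islin g \<Longrightarrow> pm.subspace {u. f u = g u}"
  by (auto simp: pm.subspace_def islin_simps)

lemma islin_lookup: "islin (\<lambda>u. scl (Poly_Mapping.lookup u w * c) v)"
  by (simp add: islin_def lookup_add algebra_simps)

lemma scl_twice: "scl (2 * c) u = scl c u + scl c u"
  by (simp flip: pm.scale_left_distrib)

lemma ideal_gens_homo:
  fixes deg :: "'x \<Rightarrow> 'd::comm_monoid_add"
  assumes "x \<in> ideal_gens par S" and "\<And>x. x \<in> S \<Longrightarrow> \<exists>d. x \<in> homo deg d"
  shows "\<exists>d. x \<in> homo deg d"
  using assms
proof induction
  case (ideal_gens_rel x)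
  then show ?case by auto
next
  case (ideal_gens_anti s t)
  show ?case
    by (rule exI[of _ "word_deg deg s + word_deg deg t"]) (intro homo_closed; simp add: add_ac)
next
  case (ideal_gens_jac r s t)
  show ?case
    by (rule exI[of _ "word_deg deg r + word_deg deg s
        + word_deg deg t"]) (intro homo_closed; simp add: add_ac)
next
  case (ideal_gens_left x w)
  then show ?case by (meson homo_nmul homo_sgl)
next
  case (ideal_gens_right x w)
  then show ?case by (meson homo_nmul homo_sgl)
qed

lemma ideal_gens_homo_words:
  fixes deg :: "'x \<Rightarrow> 'd::comm_monoid_add"
  assumes "x \<in> ideal_gens par (sgl ` SW)"
  obtains d where "x \<in> homo deg d"
  using ideal_gens_homo[OF assms, of deg] by fastforce

text \<open>Generators are the only words on which an opposite generator has a Cartan component, and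
  they trigger the correction terms of \<open>tderiv\<close> in a product. Both effects disappear on
  this subspace.\<close>

definition nogen :: "('x word \<Rightarrow>\<^sub>0 complex) set" where
  "nogen = {u. \<forall>l. Poly_Mapping.lookup u (Gen l) = 0}"

lemma subspace_nogen: "pm.subspace nogen"
  by (auto simp: pm.subspace_def nogen_def lookup_add)

lemma nogen_Br [simp]: "sgl (Br s t) \<in> nogen"
  by (simp add: nogen_def lookup_single)

lemma nogen_nmul: "nmul u v \<in> nogen"
  unfolding nmul_def by (intro lin_in subspace_nogen nogen_Br)

lemma nogen_ideal_gens:
  assumes "x \<in> ideal_gens par S" "S \<subseteq> nogen"
  shows "x \<in> nogen"
  using assms
  by induction (auto intro!: nogen_nmul pm.subspace_add[OF subspace_nogen] pm.subspace_diff[OF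
      subspace_nogen]
      pm.subspace_scale[OF subspace_nogen])

lemma super_ideal_Br_left: "sgl w \<in> super_ideal par S \<Longrightarrow> sgl (Br s w) \<in> super_ideal par S"
  using super_ideal_left[of "sgl w" par S "sgl s"] by simp

lemma super_ideal_scl_cancel:
  assumes "scl c u \<in> super_ideal par S" "c \<noteq> 0" shows "u \<in> super_ideal par S"
  using super_ideal_scl[OF assms(1), of "inverse c"] assms(2) by simp

lemma super_ideal_even_square:
  assumes "par i = 0" shows "sgl (Br (Gen i) (Gen i)) \<in> super_ideal par S"
proof -
  have "scl 2 (sgl (Br (Gen i) (Gen i))) \<in> super_ideal par S"
    using super_ideal_base[OF ideal_gens_anti[of "Gen i" "Gen i" par S]] assms
    by (simp add: pm.scale_left_distrib[of 1 1, simplified])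
  then show ?thesis by (rule super_ideal_scl_cancel) simp
qed

text \<open>For even e_i already [e_i, e_i] vanishes. For odd e_i put x = [e_i, [e_i, e_i]] and y =
  [[e_i, e_i], e_i]: the Jacobi identity gives x = y - x, antisymmetry gives y = -x, so 3x =
  0.\<close>

lemma super_ideal_cube: "sgl (Br (Gen i) (Br (Gen i) (Gen i))) \<in> super_ideal par S"
proof (cases "par i")
  case zero
  then show ?thesis by (intro super_ideal_Br_left super_ideal_even_square)
next
  case one
  let ?x = "sgl (Br (Gen i) (Br (Gen i) (Gen i)))" and ?y = "sgl (Br (Br (Gen i) (Gen i)) (Gen i))"
  have "?x - (?y - ?x) \<in> super_ideal par S" "?y + ?x \<in> super_ideal par S"
    using super_ideal_base[OF ideal_gens_jac[of "Gen i" "Gen i" "Gen i" par S]]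
      super_ideal_base[OF ideal_gens_anti[of "Br (Gen i) (Gen i)" "Gen i" par S]] one by auto
  then have "?x - (?y - ?x) + (?y + ?x) \<in> super_ideal par S" by (rule super_ideal_add)
  also have "?x - (?y - ?x) + (?y + ?x) = scl 3 ?x"
    using pm.scale_left_distrib[of 1 2 ?x] pm.scale_left_distrib[of 1 1 ?x] by simp
  finally show ?thesis by (rule super_ideal_scl_cancel) simp
qed

lemma super_ideal_ad_word:
  assumes "n \<ge> 2 \<or> n = 1 \<and> par i = 0"
  shows "sgl (ad_word (Gen i) n (Gen i)) \<in> super_ideal par S"
proof (cases "n \<ge> 2")
  case True
  then show ?thesis
  proof (induction n rule: dec_induct)
    case base
    then show ?case by (simp add: numeral_2_eq_2 super_ideal_cube)
  next
    case (step n)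
    then show ?case by (simp add: super_ideal_Br_left)
  qed
next
  case False
  then show ?thesis using assms by (auto simp: super_ideal_even_square)
qed

text \<open>The Jacobi identity for two copies of an odd e_i reads ad [e_i, e_i] = 2 (ad e_i)^2; the
  q-th power of this is the claim.\<close>

lemma super_ideal_ad_word_square:
  assumes "par i = 1"
  shows "sgl (ad_word (Br (Gen i) (Gen i)) q w) - scl (2 ^ q) (sgl (ad_word (Gen i) (2 * q) w))
      \<in> super_ideal par S"
proof (induction q)
  case 0
  then show ?case by simp
next
  case (Suc q)
  let ?e = "sgl (Gen i)" and ?z = "sgl (ad_word (Br (Gen i) (Gen i)) q w)" and ?y
      = "sgl (ad_word (Gen i) (2 * q) w)"
  have 1: "nmul ?e (nmul ?e ?z) - (nmul (nmul ?e ?e) ?z - nmul ?e (nmul ?e ?z)) \<in> super_ideal par S"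
    using super_ideal_jac[of ?e par 1 ?e 1 ?z S] assms by simp
  have 2: "nmul ?e (nmul ?e (?z - scl (2 ^ q) ?y)) \<in> super_ideal par S"
    by (intro super_ideal_left Suc.IH)
  have "scl 2 (nmul ?e (nmul ?e (?z - scl (2 ^ q) ?y))) - (nmul ?e (nmul ?e ?z)
      - (nmul (nmul ?e ?e) ?z - nmul ?e (nmul ?e ?z)))
    \<in> super_ideal par S"
    by (intro super_ideal_diff super_ideal_scl 1 2)
  also have "scl 2 (nmul ?e (nmul ?e (?z - scl (2 ^ q) ?y))) - (nmul ?e (nmul ?e ?z)
      - (nmul (nmul ?e ?e) ?z - nmul ?e (nmul ?e ?z)))
    = sgl (ad_word (Br (Gen i) (Gen i)) (Suc q) w) - scl (2 ^ Suc q) (sgl (ad_word (Gen i) (2 * Suc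
        q) w))"
    using pm.scale_left_distrib[of 1 1 "sgl (Br (Gen i) (Br (Gen i) (ad_word (Br (Gen i) (Gen i)) q
        w)))"] 
    by (simp add: algebra_simps)
  finally show ?case .
qed

section \<open>The Serre words and the ideal J\<close>

context bkm_matrix
begin

definition serre_words_real :: "'i word set" where
  "serre_words_real = {ad_word (Gen i) (nat \<lfloor>1 - A i j\<rfloor>) (Gen j) | i j. i \<in> I_re A \<and> i \<noteq> j}"

definition serre_words_odd :: "'i word set" where
  "serre_words_odd = {ad_word (Br (Gen i) (Gen i)) (nat \<lfloor>1 - A i j / 2\<rfloor>) (Gen j) | i j. i
      \<in> Psi_re A \<Psi> \<and> i \<noteq> j}"

definition serre_words_null :: "'i word set" where
  "serre_words_null = {ad_word (Gen i) (nat \<lfloor>1 - A i i / 2\<rfloor>) (Gen i) | i. i \<in> Psi_0 A \<Psi>}"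

definition serre_words_short :: "'i word set" where
  "serre_words_short = {ad_word (Gen i) (nat \<lfloor>1 - A i j / 2\<rfloor>) (Gen j) | i j. i \<in> Psi_re A \<Psi>
      \<and> i \<noteq> j}"

definition comm_words :: "'i word set" where
  "comm_words = {Br (Gen i) (Gen j) | i j. i \<noteq> j \<and> \<not> dynkin_adj A i j}"

text \<open>The ideal J. It contains \<open>serre_words_odd\<close> as a consequence of
  \<open>serre_words_real\<close> (\<open>serre_words_odd_serre_ideal\<close>), so stability under
  the derivations has to be verified on three families.\<close>

definition serre_ideal :: "('i word \<Rightarrow>\<^sub>0 complex) set" where
  "serre_ideal = super_ideal par (sgl ` (comm_words \<union> serre_words_real \<union> serre_words_null))"

lemma par_eq: "par i = 1 \<longleftrightarrow> i \<in> \<Psi>" "par i = 0 \<longleftrightarrow> i \<notin> \<Psi>"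
  by (auto simp: vertex_parity_def)

lemma real_entry:
  assumes "i \<in> I_re A" "i \<noteq> j"
  obtains n where "A i j = - real n" "nat \<lfloor>1 - A i j\<rfloor> = Suc n"
proof -
  have "A i j \<in> \<int>" "A i j \<le> 0"
    using assms bkm by (auto simp: I_re_def bkm_supermatrix_def)
  then obtain z where z: "A i j = of_int z" "z \<le> 0" by (auto elim!: Ints_cases)
  then have "A i j = - real (nat (- z))" "nat \<lfloor>1 - A i j\<rfloor> = Suc (nat (- z))"
    by (simp_all add: nat_add_distrib algebra_simps)
  then show thesis by (rule that)
qed

lemma odd_real_entry:
  assumes "i \<in> Psi_re A \<Psi>" "i \<noteq> j"
  obtains p where "A i j = - 2 * real p" "nat \<lfloor>1 - A i j\<rfloor> = Suc (2 * p)" "nat \<lfloor>1 - A i j / 2\<rfloor>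
      = Suc p"
proof -
  have "A i j / 2 \<in> \<int>" "A i j \<le> 0"
    using assms bkm by (auto simp: I_re_def bkm_supermatrix_def Psi_re_def)
  then obtain z where z: "A i j / 2 = of_int z" "z \<le> 0" by (auto elim!: Ints_cases)
  then have *: "A i j = - 2 * real (nat (- z))" "A i j / 2 = of_int z" by simp_all
  have "nat \<lfloor>1 - A i j / 2\<rfloor> = Suc (nat (- z))"
    unfolding *(2) using z(2) by simp
  moreover have "nat \<lfloor>1 - A i j\<rfloor> = Suc (2 * nat (- z))"
  proof -
    have "1 - A i j = of_int (1 - 2 * z)" using z by simp
    then show ?thesis using z(2) by (simp only: floor_of_int)
  qed
  ultimately show thesis using * that by blast
qed

lemma comm_words_eq: "comm_words = {Br (Gen i) (Gen j) | i j. i \<noteq> j \<and> A i j = 0}"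
  by (auto simp: comm_words_def dynkin_adj_def)

lemma serre_words_null_eq: "serre_words_null = {Br (Gen i) (Gen i) | i. i \<in> \<Psi> \<and> A i i = 0}"
  by (force simp: serre_words_null_def Psi_0_def)

text \<open>The commutation relations of the BKM superalgebra include i = j with a_ii = 0. For odd i
  this is the isotropic Serre element, whose exponent is then 1; for even i it is
  antisymmetry.\<close>

lemma serre_ideal_comm:
  assumes "A i j = 0"
  shows "sgl (Br (Gen i) (Gen j)) \<in> serre_ideal"
proof (cases "i = j")
  case True
  show ?thesis
  proof (cases "i \<in> \<Psi>")
    case True
    then show ?thesis unfolding serre_ideal_def using assms \<open>i = j\<close>
        by (intro super_ideal_rel) (auto simp: serre_words_null_eq)
  next
    case False
    then show ?thesis using assms \<open>i = j\<close> super_ideal_even_square[of par i]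
        by (simp add: serre_ideal_def par_eq)
  qed
next
  case False
  then show ?thesis unfolding serre_ideal_def using assms
      by (intro super_ideal_rel) (auto simp: comm_words_eq)
qed

text \<open>With a_ij = -2p the element is 2^(p+1) (ad e_i)^(2p+2) e_j modulo the super identities,
  one application of ad e_i beyond the exponent 2p+1 of the first family.\<close>

lemma serre_words_odd_serre_ideal:
  assumes "w \<in> serre_words_odd" shows "sgl w \<in> serre_ideal"
proof -
  obtain i j where ij: "i \<in> Psi_re A \<Psi>" "i \<noteq> j" and w: "w = ad_word (Br (Gen i) (Gen i)) (nat \<lfloor>1
      - A i j / 2\<rfloor>) (Gen j)"
    using assms by (auto simp: serre_words_odd_def)
  obtain p where p: "A i j = - 2 * real p" "nat \<lfloor>1 - A i j\<rfloor> = Suc (2 * p)" "nat \<lfloor>1 - A i j / 2\<rfloor>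
      = Suc p"
    using odd_real_entry[OF ij] .
  have i: "i \<in> I_re A" "par i = 1" using ij by (auto simp: Psi_re_def par_eq)
  have "sgl (ad_word (Gen i) (Suc (2 * p)) (Gen j)) \<in> serre_ideal"
    unfolding serre_ideal_def serre_words_real_def using i(1) ij(2) p(2)
    by (intro super_ideal_rel imageI UnI1 UnI2 CollectI exI[of _ i] exI[of _ j]) simp
  then have "scl (2 ^ Suc p) (sgl (ad_word (Gen i) (2 * Suc p) (Gen j))) \<in> serre_ideal"
    unfolding serre_ideal_def by (auto intro!: super_ideal_scl super_ideal_Br_left)
  with super_ideal_ad_word_square[of par i "Suc p" "Gen j"] i(2) show ?thesis
    unfolding w p(3) serre_ideal_def by (metis super_ideal_add diff_add_cancel)
qed

subsection \<open>Stability under the derivations\<close>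

lemma wt_ad_word [simp]: "word_deg (weight x) (ad_word s m t) = of_nat m * wt x s + wt x t"
  by (induction m) (simp_all add: algebra_simps)

lemma ad_word_eq_Gen [simp]: "ad_word s m (Gen j) = Gen l \<longleftrightarrow> m = 0 \<and> j = l"
  by (cases m) auto

lemma tderiv_ad_word_other:
  assumes "l \<noteq> i" "l \<noteq> j"
  shows "tderiv l (ad_word (Gen i) m (Gen j)) = 0"
  using assms by (induction m) auto

text \<open>Only the innermost bracket [e_i, e_j] contains the letter j; it contributes a_ji e_i,
  and each passage of an e_i contributes a sign.\<close>

lemma tderiv_ad_word_end:
  assumes "i \<noteq> j"
  shows "tderiv j (ad_word (Gen i) (Suc m) (Gen j))
      = scl (super_sign (par j) (par i) ^ Suc m * A j i) (sgl (ad_word (Gen i) m (Gen i)))"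
  using assms by (induction m) (auto simp: weight_def mult_ac)

text \<open>The scalar c_m in \<open>tderiv i\<close> of (ad e_i)^m e_j = c_m (ad e_i)^(m-1) e_j for
  real i and a = a_ij. In the recursion 2m + a is the h_i-weight of (ad e_i)^m e_j, and
  \<open>\<sigma>\<close> is the sign of moving the derivation past e_i.\<close>

primrec serre_coeff :: "complex \<Rightarrow> complex \<Rightarrow> nat \<Rightarrow> complex" where
  "serre_coeff \<sigma> a 0 = 0"
| "serre_coeff \<sigma> a (Suc m) = \<sigma> * serre_coeff \<sigma> a m - (2 * of_nat m + a)"

lemma serre_coeff_even: "serre_coeff 1 a m = - (of_nat m * (of_nat m - 1 + a))"
  by (induction m) (simp_all add: algebra_simps)

lemma serre_coeff_odd: "serre_coeff (-1) a (2 * p) = - 2 * of_nat p"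
  by (induction p) (simp_all add: algebra_simps)

lemma tderiv_ad_word_start:
  assumes "i \<noteq> j" "i \<in> I_re A"
  shows "tderiv i (ad_word (Gen i) (Suc m) (Gen j)) =
    scl (serre_coeff (super_sign (par i) (par i)) (A i j) (Suc m)) (sgl (ad_word (Gen i) m (Gen
        j)))"
proof (induction m)
  case 0
  then show ?case using assms by (simp add: weight_def)
next
  case (Suc m)
  have *: "weight (Some i) i = 2" using assms by (simp add: weight_def I_re_def)
  show ?case
    unfolding ad_word.simps(2)[of _ "Suc m"] tderiv.simps Suc.IH serre_coeff.simps(2)[of _ _ "Suc
        m"] using assms(1)
    by (simp add: * weight_def[of _ j] algebra_simps del: serre_coeff.simps)
qed

lemma tderiv_serre_words_real:
  assumes "w \<in> serre_words_real" shows "tderiv l w \<in> serre_ideal"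
proof -
  obtain i j where ij: "i \<in> I_re A" "i \<noteq> j" and w: "w = ad_word (Gen i) (nat \<lfloor>1 - A i j\<rfloor>) (Gen j)"
    using assms by (auto simp: serre_words_real_def)
  obtain n where n: "A i j = - real n" "nat \<lfloor>1 - A i j\<rfloor> = Suc n"
    using real_entry[OF ij] .
  have even: "even n" if "i \<in> \<Psi>"
  proof -
    have "i \<in> Psi_re A \<Psi>" using that ij by (simp add: Psi_re_def)
    then obtain p where "A i j = - 2 * real p" using odd_real_entry ij by metis
    with n(1) have "real n = real (2 * p)" by simp
    then show ?thesis by (metis even_mult_iff even_numeral of_nat_eq_iff)
  qed
  consider "l = i" | "l = j" "l \<noteq> i" | "l \<noteq> i" "l \<noteq> j" by blast
  then show ?thesis
  proof cases
    case 1
    \<comment> \<open>The rank one computation. For even i the closed form has the factor m - 1 + a,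
      which is zero at m = n + 1 and a = -n. For odd i the number n = 2p is even, and c_(2p+1) = 2p
      - (4p - 2p) = 0.\<close>
    have "serre_coeff (super_sign (par i) (par i)) (A i j) (Suc n) = 0"
    proof (cases "par i")
      case zero
      then show ?thesis unfolding n(1) by (simp only: super_sign_0 serre_coeff_even) simp
    next
      case one
      then obtain p where "n = 2 * p" using even par_eq by (metis evenE)
      then show ?thesis unfolding n(1) using one by (simp add: serre_coeff_odd)
    qed
    then show ?thesis unfolding w n(2) 1 using tderiv_ad_word_start[of i j n] ij
        by (simp add: serre_ideal_def)
  next
    case 2
    \<comment> \<open>For n = 0 the factor a_ji vanishes together with a_ij. Otherwise (ad e_i)^n
      e_i is zero by the super identities alone; the one exception, n = 1 with odd i, is excluded
      because n is even for odd i.\<close>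
    have "scl (A j i) (sgl (ad_word (Gen i) n (Gen i))) \<in> serre_ideal"
    proof (cases "n = 0")
      case True
      then have "A j i = 0" using n(1) A_0 by simp
      then show ?thesis by (simp add: serre_ideal_def)
    next
      case False
      then have "n \<ge> 2 \<or> n = 1 \<and> par i = 0"
        using even by (cases "i \<in> \<Psi>") (auto simp: par_eq elim!: evenE)
      then show ?thesis unfolding serre_ideal_def by (intro super_ideal_scl super_ideal_ad_word)
    qed
    then have "scl (super_sign (par j) (par i) ^ Suc n) (scl (A j i) (sgl (ad_word (Gen i) n (Gen
        i)))) \<in> serre_ideal"
      unfolding serre_ideal_def by (rule super_ideal_scl)
    then show ?thesis unfolding w n(2) 2 using tderiv_ad_word_end[of i j n] ij by simp
  next
    case 3
    then show ?thesis unfolding w by (simp add: tderiv_ad_word_other serre_ideal_def)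
  qed
qed

lemma tderiv_rel:
  assumes "w \<in> comm_words \<union> serre_words_real \<union> serre_words_null" shows "tderiv l w \<in> serre_ideal"
proof -
  have "tderiv l (Br (Gen i) (Gen j)) = 0" if "A i j = 0" for i j
    using that A_0[OF that] by (auto simp: weight_def)
  then show ?thesis using assms tderiv_serre_words_real
      by (auto simp: comm_words_eq serre_words_null_eq serre_ideal_def)
qed

text \<open>The Leibniz terms are antisymmetry elements for the pairs with one entry differentiated.
  The bracket with h_l contributed by \<open>s = Gen l\<close> in one product cancels the one in the
  swapped product, and likewise for \<open>t\<close>.\<close>

lemma tderiv_anti: "lin (tderiv l) (sgl (Br s t) + scl (ssign par s t) (sgl (Br t s)))
    \<in> serre_ideal"
proof -
  let ?\<epsilon> = "super_sign (par l) (wp s)"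
  have 1: "nmul (tderiv l s) (sgl t) + scl (super_sign (wp s
      + par l) (wp t)) (nmul (sgl t) (tderiv l s)) \<in> serre_ideal"
    unfolding serre_ideal_def by (rule super_ideal_anti) (rule homo_tderiv_par homo_sgl[THEN iffD2,
        OF refl])+
  have 2: "nmul (sgl s) (tderiv l t) + scl (super_sign (wp s) (wp t
      + par l)) (nmul (tderiv l t) (sgl s)) \<in> serre_ideal"
    unfolding serre_ideal_def by (rule super_ideal_anti) (rule homo_tderiv_par homo_sgl[THEN iffD2,
        OF refl])+
  have "lin (tderiv l) (sgl (Br s t) + scl (ssign par s t) (sgl (Br t s))) =
    (nmul (tderiv l s) (sgl t) + scl (super_sign (wp s
        + par l) (wp t)) (nmul (sgl t) (tderiv l s))) +
    scl ?\<epsilon> (nmul (sgl s) (tderiv l t) + scl (super_sign (wp s) (wp t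
        + par l)) (nmul (tderiv l t) (sgl s)))"
    by (cases "s = Gen l"; cases "t = Gen l"; cases "wp s"; cases "wp t"; cases "par l"; simp add:
        algebra_simps)
  then show ?thesis using 1 2 unfolding serre_ideal_def
      by (simp only: super_ideal_add super_ideal_scl)
qed

definition jac :: "complex \<Rightarrow> ('i word \<Rightarrow>\<^sub>0 complex) \<Rightarrow> ('i word \<Rightarrow>\<^sub>0 complex) \<Rightarrow> ('i word \<Rightarrow>\<^sub>0 complex)
    \<Rightarrow> 'i word \<Rightarrow>\<^sub>0 complex"
  where "jac \<epsilon> u v z = nmul u (nmul v z) - (nmul (nmul u v) z + scl \<epsilon> (nmul v (nmul u z)))"

text \<open>The Leibniz terms are Jacobi elements with one entry differentiated. The corrections at
  \<open>r\<close> and \<open>s\<close> cancel because weights are additive, that is, h_l acts as a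
  derivation. The correction at \<open>t\<close> produces [r, [s, h_l]] and its companions, which
  leave a multiple of an antisymmetry element.\<close>

lemma tderiv_jac: "lin (tderiv l) (sgl (Br r (Br s t)) - (sgl (Br (Br r s) t)
    + scl (ssign par r s) (sgl (Br s (Br r t))))) \<in> serre_ideal"
proof -
  let ?\<epsilon>r = "super_sign (par l) (wp r)" and ?\<epsilon>s = "super_sign (par l) (wp s)"
  have 1: "jac (super_sign (wp r + par l) (wp s)) (tderiv l r) (sgl s) (sgl t) \<in> serre_ideal"
    unfolding serre_ideal_def jac_def by (rule super_ideal_jac) (rule homo_tderiv_par homo_sgl[THEN
        iffD2, OF refl])+
  have 2: "jac (super_sign (wp r) (wp s + par l)) (sgl r) (tderiv l s) (sgl t) \<in> serre_ideal"
    unfolding serre_ideal_def jac_def by (rule super_ideal_jac) (rule homo_tderiv_par homo_sgl[THEN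
        iffD2, OF refl])+
  have 3: "jac (super_sign (wp r) (wp s)) (sgl r) (sgl s) (tderiv l t) \<in> serre_ideal"
    unfolding serre_ideal_def jac_def by (rule super_ideal_jac) auto
  have 4: "sgl (Br r s) + scl (ssign par r s) (sgl (Br s r)) \<in> serre_ideal"
    unfolding serre_ideal_def by (intro super_ideal_base ideal_gens_anti)
  have "lin (tderiv l) (sgl (Br r (Br s t)) - (sgl (Br (Br r s) t)
      + scl (ssign par r s) (sgl (Br s (Br r t))))) =
    jac (super_sign (wp r + par l) (wp s)) (tderiv l r) (sgl s) (sgl t) +
    scl ?\<epsilon>r (jac (super_sign (wp r) (wp s + par l)) (sgl r) (tderiv l s) (sgl t)) +
    scl (?\<epsilon>r * ?\<epsilon>s) (jac (super_sign (wp r) (wp s)) (sgl r) (sgl s) (tderiv l t)) -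
    scl (if t = Gen l then ?\<epsilon>r * ?\<epsilon>s * wt (Some l) r else 0) (sgl (Br r s)
        + scl (ssign par r s) (sgl (Br s r)))"
    unfolding jac_def
    by (cases "r = Gen l"; cases "s = Gen l"; cases "t
        = Gen l"; cases "wp r"; cases "wp s"; cases "par l";
        simp add: algebra_simps scl_twice)
  then show ?thesis using 1 2 3 4 unfolding serre_ideal_def
      by (simp only: super_ideal_add super_ideal_scl super_ideal_diff)
qed

lemma tderiv_nmul_left:
  assumes "x \<in> homo (weight (Some l)) m" "x \<in> nogen"
  shows "lin (tderiv l) (nmul (sgl w) x) = nmul (tderiv l w) x
      + scl (super_sign (par l) (wp w)) (nmul (sgl w) (lin (tderiv l) x))
    - (if w = Gen l then scl m x else 0)"
proof -
  \<comment> \<open>The last summand, the coordinate of \<open>x\<close> at \<open>Gen l\<close>,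
    makes the formula linear in \<open>x\<close>, so that it can be checked on words;
    \<open>nogen\<close> then removes it. \<open>tderiv_nmul_right\<close> proceeds in the same
    way.\<close>
  have "lin (tderiv l) (nmul (sgl w) x) = nmul (tderiv l w) x
      + scl (super_sign (par l) (wp w)) (nmul (sgl w) (lin (tderiv l) x))
    - (if w = Gen l then scl m x else 0) + scl (Poly_Mapping.lookup x (Gen l) * super_sign (par l)
        (wp w) * wt (Some l) w) (sgl w)"
  proof (rule homo_induct[OF assms(1)])
    show "pm.subspace {x. lin (tderiv l) (nmul (sgl w) x) = nmul (tderiv l w) x
        + scl (super_sign (par l) (wp w)) (nmul (sgl w) (lin (tderiv l) x))
    - (if w = Gen l then scl m x else 0) + scl (Poly_Mapping.lookup x (Gen l) * super_sign (par l)
        (wp w) * wt (Some l) w) (sgl w)}"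
      by (cases "w = Gen l"; simp only: if_True if_False mult.assoc simp_thms; intro subspace_eq
          islin_nmul_intros islin_lookup)
  qed (auto simp: lookup_single)
  then show ?thesis using assms(2) by (simp add: nogen_def)
qed

lemma tderiv_nmul_right:
  assumes "x \<in> homo par p" "x \<in> homo (weight (Some l)) m" "x \<in> nogen"
  shows "lin (tderiv l) (nmul x (sgl w)) = nmul (lin (tderiv l) x) (sgl w)
      + scl (super_sign (par l) p) (nmul x (tderiv l w))
    + (if w = Gen l then scl (super_sign (par l) p * m) x else 0)"
proof -
  have "lin (tderiv l) (nmul x (sgl w)) = nmul (lin (tderiv l) x) (sgl w)
      + scl (super_sign (par l) p) (nmul x (tderiv l w))
    - scl (Poly_Mapping.lookup x (Gen l) * wt (Some l) w) (sgl w)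
    + (if w = Gen l then scl (super_sign (par l) p) (lin (\<lambda>t. scl (wt (Some l) t) (sgl t)) x) else
        0)"
  proof (rule homo_induct[OF assms(1)])
    show "pm.subspace {x. lin (tderiv l) (nmul x (sgl w)) = nmul (lin (tderiv l) x) (sgl w)
        + scl (super_sign (par l) p) (nmul x (tderiv l w))
    - scl (Poly_Mapping.lookup x (Gen l) * wt (Some l) w) (sgl w)
    + (if w = Gen l then scl (super_sign (par l) p) (lin (\<lambda>t. scl (wt (Some l) t) (sgl t)) x) else
        0)}"
      by (cases "w = Gen l"; simp only: if_True if_False mult.assoc simp_thms; intro subspace_eq
          islin_nmul_intros islin_lookup)
  qed (auto simp: lookup_single)
  moreover have "lin (\<lambda>t. scl (wt (Some l) t) (sgl t)) x = scl m x"
    by (rule homo_induct[OF assms(2)]) (auto simp: pm.subspace_def algebra_simps)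
  ultimately show ?thesis using assms(3) by (simp add: nogen_def)
qed

abbreviation "serre_rels \<equiv> sgl ` (comm_words \<union> serre_words_real \<union> serre_words_null)"

lemma serre_rels_nogen: "serre_rels \<subseteq> nogen"
proof -
  have "\<exists>s t. w = Br s t" if "w \<in> comm_words \<union> serre_words_real \<union> serre_words_null" for w
  proof (cases "w \<in> serre_words_real")
    case True
    then obtain i j where ij: "i \<in> I_re A" "i \<noteq> j" and w: "w = ad_word (Gen i) (nat \<lfloor>1
        - A i j\<rfloor>) (Gen j)"
      by (auto simp: serre_words_real_def)
    obtain n where "nat \<lfloor>1 - A i j\<rfloor> = Suc n" using real_entry[OF ij] .
    then show ?thesis unfolding w by simp
  next
    case False
    then show ?thesis using that by (auto simp: comm_words_eq serre_words_null_eq)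
  qed
  then show ?thesis by force
qed

lemma tderiv_ideal_gens:
  assumes "x \<in> ideal_gens par serre_rels" shows "lin (tderiv l) x \<in> serre_ideal"
  using assms
proof induction
  case (ideal_gens_rel x)
  then show ?case using tderiv_rel by auto
next
  case (ideal_gens_anti s t)
  show ?case by (rule tderiv_anti)
next
  case (ideal_gens_jac r s t)
  show ?case by (rule tderiv_jac)
next
  case (ideal_gens_left x w)
  obtain m where m: "x \<in> homo (weight (Some l)) m" using ideal_gens_homo_words ideal_gens_left.hyps
      by blast
  have "x \<in> serre_ideal" using ideal_gens_left by (simp add: serre_ideal_def super_ideal_base)
  then show ?case using ideal_gens_left.IH
    unfolding tderiv_nmul_left[OF m nogen_ideal_gens[OF ideal_gens_left.hyps serre_rels_nogen]]
        serre_ideal_def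
    by (auto intro!: super_ideal_diff super_ideal_add super_ideal_scl super_ideal_left)
next
  case (ideal_gens_right x w)
  obtain m where m: "x \<in> homo (weight (Some l)) m" using ideal_gens_homo_words ideal_gens_right.hyps
      by blast
  obtain p where p: "x \<in> homo par p" using ideal_gens_homo_words ideal_gens_right.hyps by blast
  have "x \<in> serre_ideal" using ideal_gens_right by (simp add: serre_ideal_def super_ideal_base)
  then show ?case using ideal_gens_right.IH
    unfolding tderiv_nmul_right[OF p m nogen_ideal_gens[OF ideal_gens_right.hyps serre_rels_nogen]]
        serre_ideal_def
    by (auto intro!: super_ideal_diff super_ideal_add super_ideal_scl super_ideal_right)
qed

end

section \<open>Substitution of generators\<close>

lemma word_deg_map_word: "word_deg deg (map_word f w) = word_deg (\<lambda>x. deg (f x)) w"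
  by (induction w) auto

definition sub :: "('x \<Rightarrow> 'y) \<Rightarrow> ('x word \<Rightarrow>\<^sub>0 complex) \<Rightarrow> 'y word \<Rightarrow>\<^sub>0 complex" where
  "sub f = lin (\<lambda>w. sgl (map_word f w))"

lemma islin_sub [simp]: "islin (sub f)"
  by (simp add: sub_def)

lemmas sub_simps [simp] = islin_simps[OF islin_sub]

lemma sub_sgl [simp]: "sub f (sgl w) = sgl (map_word f w)"
  by (simp add: sub_def)

lemma sub_nmul: "sub f (nmul u v) = nmul (sub f u) (sub f v)"
proof (rule lin_ext[of "\<lambda>u. sub f (nmul u v)"])
  show "islin (\<lambda>u. sub f (nmul u v))" "islin (\<lambda>u. nmul (sub f u) (sub f v))"
    by (auto intro: islin_comp[OF islin_sub] islin_comp[OF islin_nmul_left])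
  show "sub f (nmul (sgl s) v) = nmul (sub f (sgl s)) (sub f v)" for s
    by (rule lin_ext[of "\<lambda>v. sub f (nmul (sgl s) v)"])
      (auto intro: islin_comp[OF islin_sub] islin_comp[OF islin_nmul_right])
qed

lemma sub_super_ideal:
  assumes "\<And>x. par' (f x) = par x" and "\<And>x. x \<in> S \<Longrightarrow> sub f x \<in> super_ideal par' S'" and "u
      \<in> super_ideal par S"
  shows "sub f u \<in> super_ideal par' S'"
proof -
  have deg: "word_deg par' (map_word f w) = word_deg par w" for w
    using assms(1) by (simp add: word_deg_map_word)
  have "super_ideal par S \<subseteq> {u. sub f u \<in> super_ideal par' S'}"
  proof (rule super_ideal_least)
    show "nideal {u. sub f u \<in> super_ideal par' S'}"
      unfolding nideal_def using subspace_vimage[OF islin_sub super_ideal_subspace]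
      by (simp add: sub_nmul super_ideal_left super_ideal_right)
    show "sgl (Br s t) + scl (ssign par s t) (sgl (Br t s)) \<in> {u. sub f u
        \<in> super_ideal par' S'}" for s t
      using super_ideal_base[OF ideal_gens_anti[of "map_word f s" "map_word f t" par' S']]
          by (simp add: deg)
    show "sgl (Br r (Br s t)) - (sgl (Br (Br r s) t) + scl (ssign par r s) (sgl (Br s (Br r t))))
        \<in> {u. sub f u \<in> super_ideal par' S'}" for r s t
      using super_ideal_base[OF ideal_gens_jac[of "map_word f r" "map_word f s" "map_word f t" par'
          S']] by (simp add: deg)
  qed (use assms(2) in auto)
  with assms(3) show ?thesis by auto
qed

section \<open>Words as operators on the lifted adjoint module\<close>

context bkm_matrix
begin

abbreviation gp :: "'i bkm_generator \<Rightarrow> bit" where "gp \<equiv> bkm_parity \<Psi>"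

primrec gen_rep :: "'i bkm_generator \<Rightarrow> ('i vbasis \<Rightarrow>\<^sub>0 complex) \<Rightarrow> 'i vbasis \<Rightarrow>\<^sub>0 complex" where
  "gen_rep (E i) = chev True i"
| "gen_rep (F i) = chev False i"
| "gen_rep (H i) = cartan (Some i)"

primrec word_rep :: "'i bkm_generator word \<Rightarrow> ('i vbasis \<Rightarrow>\<^sub>0 complex) \<Rightarrow> 'i vbasis \<Rightarrow>\<^sub>0 complex" where
  "word_rep (Gen g) = gen_rep g"
| "word_rep (Br s t) = (\<lambda>v. word_rep s (word_rep t v)
    - scl (ssign gp s t) (word_rep t (word_rep s v)))"

lemma islin_gen_rep [simp]: "islin (gen_rep g)"
  by (cases g) auto

lemma islin_word_rep [simp]: "islin (word_rep w)"
proof (induction w)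
  case (Br s t)
  then show ?case unfolding word_rep.simps by (intro islin_minus' islin_scale islin_comp[OF Br.IH]
      islin_comp[OF Br.IH(2,1)])
qed simp

lemmas word_rep_simps [simp] = islin_simps[OF islin_word_rep] islin_simps[OF islin_gen_rep]

definition rep :: "('i bkm_generator word \<Rightarrow>\<^sub>0 complex) \<Rightarrow> ('i vbasis \<Rightarrow>\<^sub>0 complex)
    \<Rightarrow> 'i vbasis \<Rightarrow>\<^sub>0 complex" where
  "rep u v = lin (\<lambda>w. word_rep w v) u"

lemma islin_rep_left [simp]: "islin (\<lambda>u. rep u v)"
  by (simp add: rep_def)

lemma islin_rep_right [simp]: "islin (rep u)"
  unfolding rep_def by (rule islin_lin_param) simp

lemmas rep_simps [simp] = islin_simps[OF islin_rep_left] islin_simps[OF islin_rep_right]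

lemma rep_sgl [simp]: "rep (sgl w) v = word_rep w v"
  by (simp add: rep_def)

lemmas islin_rep_intros = islin_nmul_intros islin_comp[OF islin_rep_left] islin_comp[OF
    islin_rep_right]
  islin_comp[OF islin_word_rep]

lemma rep_nmul:
  assumes "u \<in> homo gp p" "v \<in> homo gp q"
  shows "rep (nmul u v) x = rep u (rep v x) - scl (super_sign p q) (rep v (rep u x))"
proof (rule homo_induct[OF assms(1)])
  show "pm.subspace {u. rep (nmul u v) x = rep u (rep v x)
      - scl (super_sign p q) (rep v (rep u x))}"
    by (intro subspace_eq islin_rep_intros)
  fix s assume s: "word_deg gp s = p"
  show "rep (nmul (sgl s) v) x = rep (sgl s) (rep v x)
      - scl (super_sign p q) (rep v (rep (sgl s) x))"
  proof (rule homo_induct[OF assms(2)])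
    show "pm.subspace {v. rep (nmul (sgl s) v) x = rep (sgl s) (rep v x)
        - scl (super_sign p q) (rep v (rep (sgl s) x))}"
      unfolding rep_sgl by (intro subspace_eq islin_rep_intros)
  qed (use s in auto)
qed

definition gen :: "bool \<Rightarrow> 'i \<Rightarrow> 'i bkm_generator" where
  "gen b = (if b then E else F)"

abbreviation side_word :: "bool \<Rightarrow> 'i word \<Rightarrow> 'i bkm_generator word" where
  "side_word b \<equiv> map_word (gen b)"

lemma gp_gen [simp]: "gp (gen b i) = par i"
  by (simp add: gen_def)

lemma gp_side_word: "word_deg gp (side_word b w) = wp w"
  by (simp add: word_deg_map_word)

lemma gen_rep_gen [simp]: "gen_rep (gen b i) = chev b i"
  by (simp add: gen_def)

abbreviation side_rep :: "bool \<Rightarrow> 'i word \<Rightarrow> ('i vbasis \<Rightarrow>\<^sub>0 complex) \<Rightarrow> 'i vbasis \<Rightarrow>\<^sub>0 complex" where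
  "side_rep b w \<equiv> word_rep (side_word b w)"

lemma cartan_side_rep: "cartan x (side_rep b w v) = side_rep b w (cartan x v)
    + scl (- side_sign b * wt x w) (side_rep b w v)"
proof (induction w arbitrary: v)
  case (Gen i)
  show ?case using cartan_chev[of x b i v] by (simp add: algebra_simps)
next
  case (Br s t)
  show ?case by (simp add: Br.IH algebra_simps)
qed

text \<open>The inductive step of \<open>chev_side_rep\<close> in the abstract: \<open>Y\<close> is
  the opposite generator, \<open>S\<close> and \<open>R\<close> are the operators of two words,
  \<open>N\<close> is the Cartan operator, \<open>DS\<close> and \<open>DT\<close> come from the
  derivatives. A coefficient \<open>h1\<close> or \<open>h2\<close> is nonzero only when the word is
  the generator l itself, and then the commutation sign \<open>g\<close> agrees with
  \<open>e2\<close> or \<open>e1\<close>; this is what the disjunctions express.\<close>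

lemma super_commutator_step:
  assumes lin: "islin Y" "islin S" "islin R"
    and S: "\<And>v. Y (S v) = scl e1 (S (Y v)) + scl h1 (N v) + scl k (DS v)"
    and R: "\<And>v. Y (R v) = scl e2 (R (Y v)) + scl h2 (N v) + scl k (DT v)"
    and N: "\<And>v. N (S v) = S (N v) + scl m1 (S v)" "\<And>v. N (R v) = R (N v) + scl m2 (R v)"
    and e: "h1 = 0 \<or> g * e2 = 1" "h2 = 0 \<or> g = e1" "e1 * e1 = 1"
  shows "Y (S (R v) - scl g (R (S v))) = scl (e1 * e2) (S (R (Y v)) - scl g (R (S (Y v)))) +
    scl k (DS (R v) - scl (g * e2) (R (DS v)) + scl e1 (S (DT v) - scl (g * e1) (DT (S v)))) +
    scl (h1 * m2) (R v) - scl (h2 * g * m1) (S v)"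
proof -
  have 0: "e2 * (g * h1) = h1" using e(1) by (metis mult.assoc mult.commute mult_1 mult_zero_right)
  then have 1: "e2 * (g * h1) = h1" "e2 * (g * (h1 * x)) = h1 * x" for x
      by (simp_all flip: mult.assoc)
  have 2: "g * h2 = e1 * h2" "g * (h2 * x) = e1 * (h2 * x)" for x using e(2) by auto
  have 3: "e1 * (e1 * x) = x" for x using e(3) by (simp flip: mult.assoc)
  show ?thesis
    by (simp add: islin_simps[OF lin(1)] islin_simps[OF lin(2)] islin_simps[OF lin(3)] S R N
        pm.scale_right_distrib pm.scale_right_diff_distrib mult_ac 1 2 3)
qed

text \<open>The super commutator of an opposite generator with the operator of a word has the shape
  of its action on the word itself: a Cartan term on the generator l and a multiple of the operator
  of \<open>tderiv l t\<close>. This lets the stability of J under \<open>tderiv\<close> control the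
  operators given by J.\<close>

lemma chev_side_rep:
  "chev (\<not> b) l (side_rep b t v) = scl (super_sign (par l) (wp t)) (side_rep b t (chev (\<not> b) l v))
     + (if t = Gen l then scl (chev_coeff (\<not> b) l) (cartan (Some l) v) else 0)
     + scl (side_sign b * chev_coeff (\<not> b) l) (rep (sub (gen b) (tderiv l t)) v)"
proof (induction t arbitrary: v)
  case (Gen j)
  show ?case using chev_chev[of "\<not> b" l j v] by (simp add: algebra_simps)
next
  case (Br s t)
  have d: "sub (gen b) (tderiv l w) \<in> homo gp (wp w + par l)" for w
  proof -
    have "lin (\<lambda>w. sgl (side_word b w)) (tderiv l w) \<in> homo gp (wp w + par l)"
      using homo_tderiv_par[of l w] by (intro lin_in subspace_homo) (auto simp: gp_side_word
          homo_def[of par])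
    then show ?thesis by (simp add: sub_def)
  qed
  have 1: "rep (nmul (sub (gen b) (tderiv l s)) (sgl (side_word b t))) v
      = rep (sub (gen b) (tderiv l s)) (side_rep b t v)
     - scl (super_sign (wp s + par l) (wp t)) (side_rep b t (rep (sub (gen b) (tderiv l s)) v))"
    using rep_nmul[OF d, of "sgl (side_word b t)" "wp t" s v] by (simp add: gp_side_word)
  have 2: "rep (nmul (sgl (side_word b s)) (sub (gen b) (tderiv l t))) v
      = side_rep b s (rep (sub (gen b) (tderiv l t)) v)
     - scl (super_sign (wp s) (wp t + par l)) (rep (sub (gen b) (tderiv l t)) (side_rep b s v))"
    using rep_nmul[OF _ d, of "sgl (side_word b s)" "wp s" t v] by (simp add: gp_side_word)
  let ?h = "\<lambda>t. if t = Gen l then chev_coeff (\<not> b) l else 0"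
  have h: "(if t = Gen l then scl (chev_coeff (\<not> b) l) (cartan (Some l) v) else 0)
      = scl (?h t) (cartan (Some l) v)" for t v
    by simp
  have 3: "chev (\<not> b) l (side_rep b (Br s t) v) =
    scl (super_sign (par l) (wp s) * super_sign (par l) (wp t)) (side_rep b (Br s t) (chev (\<not> b) l
        v)) +
    scl (side_sign b * chev_coeff (\<not> b) l) (
      rep (sub (gen b) (tderiv l s)) (side_rep b t v)
          - scl (ssign par s t * super_sign (par l) (wp t)) (side_rep b t (rep (sub (gen b) (tderiv
          l s)) v)) +
      scl (super_sign (par l) (wp s)) (side_rep b s (rep (sub (gen b) (tderiv l t)) v)
        - scl (ssign par s t * super_sign (par l) (wp s)) (rep (sub (gen b) (tderiv l t)) (side_rep
            b s v)))) +
    scl (?h s * (- side_sign b * wt (Some l) t)) (side_rep b t v)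
        - scl (?h t * ssign par s t * (- side_sign b * wt (Some l) s)) (side_rep b s v)"
    unfolding word.map word_rep.simps gp_side_word
    by (rule super_commutator_step[where N = "cartan (Some l)"])
      (auto simp: cartan_side_rep Br.IH[unfolded h] super_sign_commute)
  show ?case
    unfolding 3
    by (auto simp: sub_nmul 1 2 super_sign_add super_sign_add' super_sign_commute algebra_simps)
qed

section \<open>The invariant subspace and the action modulo it\<close>

lemma chev_emb_opposite:
  "chev b i (emb (\<not> b) x) = scl (Poly_Mapping.lookup x (Gen i) * chev_coeff b i) (sgl (Cart (Some
      i)))
     - scl (side_sign b * chev_coeff b i) (emb (\<not> b) (lin (tderiv i) x))"
proof (rule lin_ext[of "\<lambda>x. chev b i (emb (\<not> b) x)"])
  show "islin (\<lambda>x. chev b i (emb (\<not> b) x))" by (intro islin_comp[OF islin_lin] islin_emb)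
  show "islin (\<lambda>x. scl (Poly_Mapping.lookup x (Gen i) * chev_coeff b i) (sgl (Cart (Some i)))
      - scl (side_sign b * chev_coeff b i) (emb (\<not> b) (lin (tderiv i) x)))"
    by (intro islin_minus' islin_lookup islin_scale islin_comp[OF islin_emb] islin_lin)
qed (auto simp: lookup_single)

text \<open>The invariant subspace J + 0 + J. The quotient by it is expressed through membership of
  differences, and the homogeneous spanning set of J makes invariance a check on
  \<open>ideal_gens\<close>.\<close>

definition null_space :: "('i vbasis \<Rightarrow>\<^sub>0 complex) set" where
  "null_space = pm.span {emb b x | b x. x \<in> ideal_gens par serre_rels}"

lemma null_space_subspace [simp]: "pm.subspace null_space"
  by (simp add: null_space_def)

lemmas null_space_0 [simp] = pm.subspace_0[OF null_space_subspace]
lemmas null_space_add = pm.subspace_add[OF null_space_subspace]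
  and null_space_diff = pm.subspace_diff[OF null_space_subspace]
  and null_space_scl = pm.subspace_scale[OF null_space_subspace]

lemma emb_serre_ideal: "u \<in> serre_ideal \<Longrightarrow> emb b u \<in> null_space"
  unfolding serre_ideal_def super_ideal_def
  by (rule span_image_sub[OF islin_emb null_space_subspace]) (auto simp: null_space_def intro!:
      pm.span_base)

lemma serre_ideal_subspace [simp]: "pm.subspace serre_ideal"
  by (simp add: serre_ideal_def)

lemma null_space_serre_ideal: assumes "emb b u \<in> null_space" shows "u \<in> serre_ideal"
proof -
  \<comment> \<open>The projection onto the copy \<open>b\<close>; it sends the spanning set of
    \<open>null_space\<close> into J.\<close>
  define P where "P = lin (\<lambda>z. case z of Wd b' w \<Rightarrow> if b' = b then sgl w else 0 | Cart y
      \<Rightarrow> (0 :: 'i word \<Rightarrow>\<^sub>0 complex))"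
  have P: "P (emb b' x) = (if b' = b then x else 0)" for b' x
    by (cases "b' = b"; simp; rule lin_ext) (auto simp: P_def islin_zero intro!: islin_comp[OF
        islin_lin])
  have "P (emb b u) \<in> serre_ideal"
    using assms unfolding null_space_def
    by (rule span_image_sub[rotated -1]) (auto simp: P, auto simp: P_def serre_ideal_def
        super_ideal_base)
  then show ?thesis by (simp add: P)
qed

lemma chev_null_space: assumes "v \<in> null_space" shows "chev b i v \<in> null_space"
proof (rule span_image_sub[OF islin_lin null_space_subspace _ assms[unfolded null_space_def]])
  fix z assume "z \<in> {emb b x | b x. x \<in> ideal_gens par serre_rels}"
  then obtain b' x where x: "x \<in> ideal_gens par serre_rels" and z: "z = emb b' x" by auto
  show "chev b i z \<in> null_space"
  proof (cases "b' = b")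
    case True
    have "nmul (sgl (Gen i)) x \<in> ideal_gens par serre_rels" using x by (rule ideal_gens_left)
    then show ?thesis unfolding z True chev_emb by (auto simp: null_space_def intro!: pm.span_base)
  next
    case False
    then have b': "b' = (\<not> b)" by auto
    have "Poly_Mapping.lookup x (Gen i) = 0"
      using nogen_ideal_gens[OF x serre_rels_nogen] by (simp add: nogen_def)
    then show ?thesis unfolding z b' chev_emb_opposite
        using emb_serre_ideal[OF tderiv_ideal_gens[OF x]]
      by (simp add: pm.subspace_neg null_space_scl)
  qed
qed

lemma cartan_null_space: assumes "v \<in> null_space" shows "cartan x v \<in> null_space"
proof (rule span_image_sub[OF islin_lin null_space_subspace _ assms[unfolded null_space_def]])
  fix z assume "z \<in> {emb b x | b x. x \<in> ideal_gens par serre_rels}"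
  then obtain b u where u: "u \<in> ideal_gens par serre_rels" and z: "z = emb b u" by auto
  obtain m where "u \<in> homo (weight x) m" using ideal_gens_homo_words u by blast
  then show "cartan x z \<in> null_space" unfolding z using u
    by (auto simp: cartan_emb serre_ideal_def super_ideal_base intro!: null_space_scl
        emb_serre_ideal pm.subspace_neg)
qed

lemma word_rep_null_space: "v \<in> null_space \<Longrightarrow> word_rep w v \<in> null_space"
proof (induction w arbitrary: v)
  case (Gen g)
  then show ?case by (cases g) (auto simp: chev_null_space cartan_null_space)
qed (auto intro!: null_space_diff null_space_scl)

lemma rep_null_space: "v \<in> null_space \<Longrightarrow> rep u v \<in> null_space"
  unfolding rep_def by (intro lin_in word_rep_null_space null_space_subspace)

text \<open>Generators act on their own copy by left multiplication. The Jacobi elements lie in J,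
  so modulo J left multiplication by [s, t] is the super commutator of those by s and t, and the
  rule passes from generators to words.\<close>

lemma side_rep_emb: "side_rep b w (emb b v) - emb b (nmul (sgl w) v) \<in> null_space"
proof (induction w arbitrary: v)
  case (Gen i)
  show ?case by (simp add: chev_emb)
next
  case (Br s t)
  have *: "side_rep b s (side_rep b t (emb b v)) - emb b (nmul (sgl s) (nmul (sgl t) v))
      \<in> null_space"
    if "\<And>v. side_rep b s (emb b v) - emb b (nmul (sgl s) v)
        \<in> null_space" "\<And>v. side_rep b t (emb b v) - emb b (nmul (sgl t) v) \<in> null_space" for s t
  proof -
    have "side_rep b s (side_rep b t (emb b v) - emb b (nmul (sgl t) v))
        + (side_rep b s (emb b (nmul (sgl t) v)) - emb b (nmul (sgl s) (nmul (sgl t) v)))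
        \<in> null_space"
      by (intro null_space_add word_rep_null_space that)
    then show ?thesis by simp
  qed
  have "emb b (nmul (sgl s) (nmul (sgl t) v) - (nmul (nmul (sgl s) (sgl t)) v
      + scl (ssign par s t) (nmul (sgl t) (nmul (sgl s) v)))) \<in> null_space"
    unfolding serre_ideal_def by (intro emb_serre_ideal[unfolded serre_ideal_def] super_ideal_jac)
        auto
  from null_space_add[OF null_space_diff[OF *[OF Br.IH] null_space_scl[OF *[OF Br.IH(2,1)], of
      "ssign par s t"]] this]
  show ?case by (simp add: gp_side_word algebra_simps)
qed

text \<open>This is [w, h] = -wt(w) w and its mirror image. The two halves of the super commutator
  give wt(t) [s, t] and a multiple wt(s) of [t, s]; antisymmetry modulo J merges them into (wt(s) +
  wt(t)) [s, t].\<close>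

lemma side_rep_Cart: "side_rep b w (sgl (Cart x)) - scl (side_sign b * wt x w) (emb b (sgl w))
    \<in> null_space"
proof (induction w)
  case (Gen i)
  show ?case by (simp)
next
  case (Br s t)
  have *: "side_rep b s (side_rep b t (sgl (Cart x)))
      - scl (side_sign b * wt x t) (sgl (Wd b (Br s t))) \<in> null_space"
    if "side_rep b t (sgl (Cart x)) - scl (side_sign b * wt x t) (emb b (sgl t))
        \<in> null_space" for s t
  proof -
    have "side_rep b s (side_rep b t (sgl (Cart x)) - scl (side_sign b * wt x t) (emb b (sgl t)))
        + scl (side_sign b * wt x t) (side_rep b s (emb b (sgl t)) - emb b (nmul (sgl s) (sgl t)))
        \<in> null_space"
      by (intro null_space_add word_rep_null_space that null_space_scl side_rep_emb)
    then show ?thesis by (simp add: algebra_simps)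
  qed
  have "emb b (sgl (Br s t) + scl (ssign par s t) (sgl (Br t s))) \<in> null_space"
    by (intro emb_serre_ideal) (simp add: serre_ideal_def super_ideal_base ideal_gens_anti)
  from null_space_diff[OF null_space_diff[OF *[OF Br.IH(2), of s] null_space_scl[OF *[OF Br.IH(1),
      of t], of "ssign par s t"]] null_space_scl[OF this, of "side_sign b * wt x s"]]
  show ?case by (simp add: gp_side_word algebra_simps)
qed

text \<open>On its own copy \<open>u\<close> acts as left multiplication by an element of J, and on
  a Cartan vector it returns a multiple of itself, its weight being well defined by
  homogeneity.\<close>

lemma serre_ideal_annihilates_main:
  assumes "u \<in> ideal_gens par serre_rels"
  shows "rep (sub (gen b) u) (emb b v) \<in> null_space" "rep (sub (gen b) u) (sgl (Cart x))
      \<in> null_space"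
proof -
  have R: "rep (sub (gen b) u) v = lin (\<lambda>w. side_rep b w v) u" for u v
    by (rule lin_ext) (auto intro: islin_comp[OF islin_rep_left islin_sub])
  have u: "u \<in> serre_ideal" using assms by (simp add: serre_ideal_def super_ideal_base)
  have "lin (\<lambda>w. side_rep b w (emb b v) - emb b (nmul (sgl w) v)) u \<in> null_space"
    by (intro lin_in null_space_subspace side_rep_emb)
  also have "lin (\<lambda>w. side_rep b w (emb b v) - emb b (nmul (sgl w) v)) u
      = rep (sub (gen b) u) (emb b v) - emb b (nmul u v)"
    by (rule lin_ext) (auto intro!: islin_minus' islin_comp[OF islin_rep_left] islin_comp[OF
        islin_emb])
  finally have "rep (sub (gen b) u) (emb b v) - emb b (nmul u v) \<in> null_space" .
  moreover have "emb b (nmul u v) \<in> null_space" using u unfolding serre_ideal_def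
      by (intro emb_serre_ideal[unfolded serre_ideal_def] super_ideal_right)
  ultimately show "rep (sub (gen b) u) (emb b v) \<in> null_space"
      by (metis null_space_add diff_add_cancel)
  obtain m where m: "u \<in> homo (weight x) m" using ideal_gens_homo_words assms by blast
  have "rep (sub (gen b) u) (sgl (Cart x)) - scl (side_sign b * m) (emb b u) \<in> null_space"
  proof (rule homo_induct[OF m])
    show "pm.subspace {u. rep (sub (gen b) u) (sgl (Cart x)) - scl (side_sign b * m) (emb b u)
        \<in> null_space}"
      by (intro subspace_vimage null_space_subspace islin_minus' islin_comp[OF islin_rep_left]
          islin_scale) auto
  qed (use side_rep_Cart[of b _ x] in auto)
  moreover have "scl (side_sign b * m) (emb b u) \<in> null_space" using u
      by (intro null_space_scl emb_serre_ideal)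
  ultimately show "rep (sub (gen b) u) (sgl (Cart x)) \<in> null_space"
      by (metis null_space_add diff_add_cancel)
qed

lemma wt_None: "\<exists>n>0. wt None w = of_nat n"
proof (induction w)
  case (Gen x)
  show ?case by (rule exI[of _ 1]) (simp add: weight_def)
next
  case (Br s t)
  then show ?case by (metis add_pos_pos of_nat_add word_deg.simps(2))
qed

lemma wt_None_nonzero [simp]: "wt None w \<noteq> 0"
  using wt_None[of w] by auto

text \<open>
  On the opposite side the claim is propagated from \<open>\<hh>\<close>: the vectors annihilated by the ideal are stable under
  the opposite generators, and these reach every opposite word from the degree derivation.
\<close>

lemma serre_ideal_annihilates:
  assumes "u \<in> serre_ideal"
  shows "rep (sub (gen b) u) v \<in> null_space"
proof -
  define X where "X = {v. \<forall>u\<in>ideal_gens par serre_rels. rep (sub (gen b) u) v \<in> null_space}"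
  have subX: "pm.subspace X"
    unfolding X_def by (auto simp: pm.subspace_def null_space_add null_space_scl)
  have GX: "chev (\<not> b) l v \<in> X" if v: "v \<in> X" for l v
    unfolding X_def
  proof (intro CollectI ballI)
    fix u assume u: "u \<in> ideal_gens par serre_rels"
    obtain p where p: "u \<in> homo par p" using ideal_gens_homo_words u by blast
    \<comment> \<open>The linear extension of \<open>chev_side_rep\<close> in \<open>u\<close>.
      Since \<open>u\<close> has no generator coordinate the Cartan term drops out, and the
      derivative of \<open>u\<close> is again in J and so annihilates \<open>v\<close>.\<close>
    have "chev (\<not> b) l (rep (sub (gen b) u) v) = scl (super_sign (par l) p) (rep (sub (gen b) u)
        (chev (\<not> b) l v))
     + scl (Poly_Mapping.lookup u (Gen l) * chev_coeff (\<not> b) l) (cartan (Some l) v)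
     + scl (side_sign b * chev_coeff (\<not> b) l) (rep (sub (gen b) (lin (tderiv l) u)) v)"
    proof (rule homo_induct[OF p])
      show "pm.subspace {u. chev (\<not> b) l (rep (sub (gen b) u) v)
          = scl (super_sign (par l) p) (rep (sub (gen b) u) (chev (\<not> b) l v))
        + scl (Poly_Mapping.lookup u (Gen l) * chev_coeff (\<not> b) l) (cartan (Some l) v)
        + scl (side_sign b * chev_coeff (\<not> b) l) (rep (sub (gen b) (lin (tderiv l) u)) v)}"
        by (intro subspace_eq islin_plus islin_scale islin_lookup islin_comp[OF islin_lin]
            islin_comp[OF islin_rep_left] 
            islin_comp[OF islin_sub] islin_sub islin_lin)
    qed (auto simp: chev_side_rep lookup_single)
    moreover have "Poly_Mapping.lookup u (Gen l) = 0"
      using nogen_ideal_gens[OF u serre_rels_nogen] by (simp add: nogen_def)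
    ultimately have "scl (super_sign (par l) p) (rep (sub (gen b) u) (chev (\<not> b) l v)) =
      chev (\<not> b) l (rep (sub (gen b) u) v) - scl (side_sign b * chev_coeff (\<not> b) l) (rep (sub (gen
          b) (lin (tderiv l) u)) v)"
      by simp
    also have "\<dots> \<in> null_space"
    proof (intro null_space_diff null_space_scl chev_null_space)
      show "rep (sub (gen b) u) v \<in> null_space" using u v by (simp add: X_def)
      have "lin (tderiv l) u \<in> pm.span (ideal_gens par serre_rels)" using tderiv_ideal_gens[OF u]
          by (simp add: serre_ideal_def super_ideal_def)
      then show "rep (sub (gen b) (lin (tderiv l) u)) v \<in> null_space"
        by (rule span_image_sub[rotated -1, where f = "\<lambda>u. rep (sub (gen b) u) v"])
          (use v in \<open>auto simp: X_def intro!: islin_comp[OF islin_rep_left islin_sub]\<close>)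
    qed
    finally have "scl (super_sign (par l) p) (scl (super_sign (par l) p) (rep (sub (gen b) u) (chev
        (\<not> b) l v))) \<in> null_space"
      by (rule null_space_scl)
    then show "rep (sub (gen b) u) (chev (\<not> b) l v) \<in> null_space" by simp
  qed
  have side_rep: "side_rep (\<not> b) w v \<in> X" if "v \<in> X" for w v
    using that
  proof (induction w arbitrary: v)
    case (Gen i)
    then show ?case using GX by (cases b) auto
  next
    case (Br s t)
    then show ?case by (auto intro!: pm.subspace_diff[OF subX] pm.subspace_scale[OF subX])
  qed
  have Cart: "sgl (Cart x) \<in> X" for x
    by (simp add: X_def serre_ideal_annihilates_main)
  have ZX: "null_space \<subseteq> X" by (auto simp: X_def rep_null_space)
  have "v \<in> X"
  proof (rule pm_induct[of "\<lambda>v. v \<in> X"])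
    fix z :: "'i vbasis"
    show "sgl z \<in> X"
    proof (cases z)
      case (Wd b' w)
      show ?thesis
      proof (cases "b' = b")
        case True
        then show ?thesis using serre_ideal_annihilates_main(1)[of _ b "sgl w"] Wd
            by (simp add: X_def)
      next
        case False
        then have b': "b' = (\<not> b)" by auto
        \<comment> \<open>The word \<open>w\<close> is reached from the degree derivation, where the
          scalar \<open>wt None w\<close> is the nonzero length of \<open>w\<close> and may be
          divided out.\<close>
        have "side_rep b' w (sgl (Cart None)) \<in> X" using side_rep[OF Cart] b' by simp
        moreover have "side_rep b' w (sgl (Cart None))
            - scl (side_sign b' * wt None w) (emb b' (sgl w)) \<in> X"
          using side_rep_Cart ZX by blast
        ultimately have "side_rep b' w (sgl (Cart None)) - (side_rep b' w (sgl (Cart None))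
            - scl (side_sign b' * wt None w) (emb b' (sgl w))) \<in> X"
          by (rule pm.subspace_diff[OF subX])
        then have "scl (side_sign b' * wt None w) (sgl z) \<in> X" by (simp add: Wd)
        from pm.subspace_scale[OF subX this, of "1 / (side_sign b' * wt None w)"] show ?thesis
          by (simp add: field_simps)
      qed
    qed (simp add: Cart)
  qed (use subX in simp)
  show ?thesis
    by (rule span_image_sub[where f = "\<lambda>u. rep (sub (gen b) u) v", OF _ null_space_subspace _
        assms[unfolded serre_ideal_def super_ideal_def]])
      (use \<open>v \<in> X\<close> in \<open>auto simp: X_def intro!: islin_comp[OF islin_rep_left islin_sub]\<close>)
qed

end

section \<open>The relations of the BKM superalgebra act as zero\<close>

context bkm_matrix
begin

definition serre_words :: "'i word set" where
  "serre_words = serre_words_real \<union> serre_words_odd \<union> serre_words_null"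

definition bkm_rels :: "('i bkm_generator word \<Rightarrow>\<^sub>0 complex) set" where
  "bkm_rels = {sgl (Br (Gen (H i)) (Gen (H j))) | i j. True} \<union>
    {sgl (Br (Gen (H i)) (Gen (E j))) - scl (A i j) (sgl (Gen (E j))) | i j. True} \<union>
    {sgl (Br (Gen (H i)) (Gen (F j))) + scl (A i j) (sgl (Gen (F j))) | i j. True} \<union>
    {sgl (Br (Gen (E i)) (Gen (F j))) - (if i = j then sgl (Gen (H i)) else 0) | i j. True} \<union>
    sgl ` map_word E ` serre_words \<union> sgl ` map_word F ` serre_words \<union>
    {sgl (Br (Gen (E i)) (Gen (E j))) | i j. A i j = 0}
        \<union> {sgl (Br (Gen (F i)) (Gen (F j))) | i j. A i j = 0}"

text \<open>\<open>rep_nmul\<close> turns a product into a super commutator only for factors of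
  definite parity; this supplies the parity when relations are multiplied by words.\<close>

lemma bkm_rels_homo: "x \<in> bkm_rels \<Longrightarrow> \<exists>p. x \<in> homo gp p"
proof -
  have W: "\<exists>p. sgl w \<in> homo gp p" for w by simp
  have P: "\<exists>p. sgl w + scl c (sgl w') \<in> homo gp p" if "word_deg gp w = word_deg gp w'" for w w' c
    by (rule exI[of _ "word_deg gp w'"]) (intro homo_closed; simp add: that)
  have M: "\<exists>p. sgl w - scl c (sgl w') \<in> homo gp p" if "word_deg gp w = word_deg gp w'" for w w' c
    by (rule exI[of _ "word_deg gp w'"]) (intro homo_closed; simp add: that)
  have EF: "\<exists>p. sgl (Br (Gen (E i)) (Gen (F j))) - (if i = j then sgl (Gen (H i)) else 0)
      \<in> homo gp p" for i j
    by (rule exI[of _ "par i + par j"]) (cases "i = j"; simp only: if_True if_False simp_thms; intro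
        homo_closed; simp)
  assume "x \<in> bkm_rels"
  then show ?thesis
    unfolding bkm_rels_def by (elim UnE CollectE exE conjE imageE; simp only:; intro W P M EF; simp)
qed

lemma serre_words_serre_ideal: "w \<in> serre_words \<Longrightarrow> sgl w \<in> serre_ideal"
proof (cases "w \<in> serre_words_odd")
  case False
  assume "w \<in> serre_words"
  with False show ?thesis unfolding serre_ideal_def serre_words_def by (intro super_ideal_rel) auto
qed (rule serre_words_odd_serre_ideal)

lemma gen_simps: "gen True = E" "gen False = F"
  by (simp_all add: gen_def fun_eq_iff)

lemma bkm_rels_annihilates:
  assumes "x \<in> bkm_rels" shows "rep x v \<in> null_space"
proof -
  have word: "rep (sgl (map_word E w)) v \<in> null_space" "rep (sgl (map_word F w)) v
      \<in> null_space" if "sgl w \<in> serre_ideal" for w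
    using serre_ideal_annihilates[OF that, of True v] serre_ideal_annihilates[OF that, of False v]
        by (auto simp: gen_simps)
  have cartan: "rep (sgl (Br (Gen (H i)) (Gen (H j)))) v = 0" for i j
  proof -
    have "cartan (Some i) (cartan (Some j) v) = cartan (Some j) (cartan (Some i) v)"
    proof (rule lin_ext[of "\<lambda>v. cartan (Some i) (cartan (Some j) v)"])
      fix z :: "'i vbasis"
      show "cartan (Some i) (cartan (Some j) (sgl z)) = cartan (Some j) (cartan (Some i) (sgl z))"
        by (cases z) (simp_all add: mult_ac)
    qed (intro islin_intros)+
    then show ?thesis by simp
  qed
  have HE: "rep (sgl (Br (Gen (H i)) (Gen (E j))) - scl (A i j) (sgl (Gen (E j)))) v = 0" for i j
    using cartan_chev[of "Some i" True j v] by (simp add: weight_def side_sign_def)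
  have HF: "rep (sgl (Br (Gen (H i)) (Gen (F j))) + scl (A i j) (sgl (Gen (F j)))) v = 0" for i j
    using cartan_chev[of "Some i" False j v] by (simp add: weight_def side_sign_def)
  have EF: "rep (sgl (Br (Gen (E i)) (Gen (F j))) - (if i = j then sgl (Gen (H i)) else 0)) v
      = 0" for i j
    using chev_chev[of True i j v] by (simp add: chev_coeff_def)
  have "rep (sgl (Br (Gen (E i)) (Gen (E j)))) v \<in> null_space" "rep (sgl (Br (Gen (F i)) (Gen (F
      j)))) v \<in> null_space" if "A i j = 0" for i j
    using word[OF serre_ideal_comm[OF that]] by simp_all
  note EE = this
  show ?thesis
    using assms unfolding bkm_rels_def
    by (elim UnE CollectE exE conjE imageE; simp only: cartan HE HF EF EE null_space_0 word
        serre_words_serre_ideal)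
qed

text \<open>Operators under the super commutator satisfy antisymmetry and the Jacobi identity
  exactly, so these generators act as zero; the relations map into \<open>null_space\<close>, which
  is invariant under all word operators.\<close>

lemma super_ideal_annihilates:
  assumes "x \<in> super_ideal gp bkm_rels" shows "rep x v \<in> null_space"
proof -
  have "rep x v \<in> null_space" if "x \<in> ideal_gens gp bkm_rels" for x v
    using that
  proof (induction arbitrary: v)
    case (ideal_gens_rel x)
    then show ?case by (rule bkm_rels_annihilates)
  next
    case (ideal_gens_anti s t)
    show ?case by (simp add: algebra_simps super_sign_commute)
  next
    case (ideal_gens_jac r s t)
    show ?case
      by (cases "word_deg gp r"; cases "word_deg gp s"; cases "word_deg gp t"; simp add:
          algebra_simps)
  next
    case (ideal_gens_left x w)
    obtain p where "x \<in> homo gp p" using ideal_gens_homo[OF ideal_gens_left.hyps bkm_rels_homo]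
        by blast
    then show ?case using ideal_gens_left.IH by (subst rep_nmul[where p
        = "word_deg gp w"]) (auto intro!: null_space_diff null_space_scl word_rep_null_space)
  next
    case (ideal_gens_right x w)
    obtain p where "x \<in> homo gp p" using ideal_gens_homo[OF ideal_gens_right.hyps bkm_rels_homo]
        by blast
    then show ?case using ideal_gens_right.IH by (subst rep_nmul[where q
        = "word_deg gp w"]) (auto intro!: null_space_diff null_space_scl word_rep_null_space)
  qed
  then show ?thesis
    by (rule span_image_sub[where f = "\<lambda>u. rep u v", OF islin_rep_left null_space_subspace _
        assms[unfolded super_ideal_def]])
qed

abbreviation deg1 :: "'i \<Rightarrow> 'i \<Rightarrow>\<^sub>0 nat" where "deg1 i \<equiv> Poly_Mapping.single i 1"

lemma wt_None_deg1: "wt None w = of_nat (Sum_any (Poly_Mapping.lookup (word_deg deg1 w)))"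
proof (induction w)
  case (Gen i)
  have "Sum_any (Poly_Mapping.lookup (deg1 i)) = 1"
    by (subst Sum_any.expand_superset[of "{i}"]) (auto simp: lookup_single when_def)
  then show ?case by (simp add: weight_def del: One_nat_def)
next
  case (Br s t)
  have "Sum_any (Poly_Mapping.lookup (word_deg deg1 (Br s t))) =
    Sum_any (Poly_Mapping.lookup (word_deg deg1 s))
        + Sum_any (Poly_Mapping.lookup (word_deg deg1 t))"
    unfolding word_deg.simps lookup_add[abs_def] by (rule Sum_any.distrib) (rule finite_lookup)+
  then show ?case using Br by simp
qed

text \<open>Evaluating at the degree derivation turns annihilation into membership.\<close>

lemma sub_E_reflects_serre_ideal:
  assumes "u \<in> homo deg1 k" "sub E u \<in> super_ideal gp bkm_rels"
  shows "u \<in> serre_ideal"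
proof (cases "u = 0")
  case False
  then obtain w where w: "w \<in> Poly_Mapping.keys u" by (metis keys_eq_empty ex_in_conv)
  define m where "m = wt None w"
  have "word_deg deg1 z = word_deg deg1 w" if "z \<in> Poly_Mapping.keys u" for z
    using assms(1) w that unfolding homo_def by auto
  then have "wt None z = m" if "z \<in> Poly_Mapping.keys u" for z
    using that unfolding m_def wt_None_deg1 by simp
  then have m: "u \<in> homo (weight None) m" unfolding homo_def by blast
  have "m \<noteq> 0" unfolding m_def by simp
  have "rep (sub E u) (sgl (Cart None)) - scl (side_sign True * m) (emb True u) \<in> null_space"
  proof (rule homo_induct[OF m])
    show "pm.subspace {u. rep (sub E u) (sgl (Cart None)) - scl (side_sign True * m) (emb True u)
        \<in> null_space}"
      by (intro subspace_vimage null_space_subspace islin_minus' islin_comp[OF islin_rep_left]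
          islin_scale) auto
    show "rep (sub E (sgl w)) (sgl (Cart None)) - scl (side_sign True * m) (emb True (sgl w))
        \<in> null_space" if "wt None w = m" for w
      using side_rep_Cart[of True w None] that by (simp only: gen_simps sub_sgl rep_sgl)
  qed
  from null_space_diff[OF super_ideal_annihilates[OF assms(2), of "sgl (Cart None)"] this]
  have "emb True (scl (side_sign True * m) u) \<in> null_space" by simp
  then have "scl (side_sign True * m) u \<in> serre_ideal" by (rule null_space_serre_ideal)
  then show ?thesis unfolding serre_ideal_def by (rule super_ideal_scl_cancel) (use \<open>m \<noteq> 0\<close> in simp)
qed (simp add: serre_ideal_def)

lemma sub_E_serre_ideal: "u \<in> super_ideal par (sgl ` (comm_words \<union> serre_words_real
    \<union> serre_words_odd \<union> serre_words_null)) \<Longrightarrow> sub E u \<in> super_ideal gp bkm_rels"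
proof (rule sub_super_ideal[of gp E par])
  fix x assume "x \<in> sgl ` (comm_words \<union> serre_words_real \<union> serre_words_odd \<union> serre_words_null)"
  then show "sub E x \<in> super_ideal gp bkm_rels"
    by (intro super_ideal_rel) (auto simp: bkm_rels_def comm_words_eq serre_words_def)
qed auto

subsection \<open>Degrees of the Serre elements\<close>

abbreviation all_rels :: "('i word \<Rightarrow>\<^sub>0 complex) set" where
  "all_rels \<equiv> sgl ` (comm_words \<union> serre_words_real \<union> serre_words_odd \<union> serre_words_null
      \<union> serre_words_short)"

text \<open>An ideal (\<open>big_nmul\<close>) without nonzero elements in any degree k with k_i at
  most 1.\<close>

definition big :: "'i \<Rightarrow> ('i word \<Rightarrow>\<^sub>0 complex) set" where
  "big i = {u. \<forall>w\<in>Poly_Mapping.keys u. 2 \<le> Poly_Mapping.lookup (word_deg deg1 w) i}"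

lemma subspace_big: "pm.subspace (big i)"
  unfolding pm.subspace_def big_def using keys_add keys_scl by fastforce

lemma big_nmul: "u \<in> big i \<Longrightarrow> nmul u v \<in> big i \<and> nmul v u \<in> big i"
  unfolding nmul_def by (intro conjI lin_in subspace_big) (auto simp: big_def lookup_add)

lemma lookup_deg1_ad_word: "Poly_Mapping.lookup (word_deg deg1 (ad_word s m t)) i =
    m * Poly_Mapping.lookup (word_deg deg1 s) i + Poly_Mapping.lookup (word_deg deg1 t) i"
  by (induction m) (auto simp: lookup_add)

lemma big_ad_word: "2 \<le> m * Poly_Mapping.lookup (word_deg deg1 s) i \<Longrightarrow> sgl (ad_word s m t) \<in> big i"
  by (simp add: big_def lookup_deg1_ad_word del: One_nat_def)

text \<open>A Serre word in (ad e_i) e_j with exponent 1 has a_ij = 0 and is a commutation word.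
  With a larger exponent, or with [e_i, e_i] in place of e_i, the letter i occurs at least
  twice.\<close>

lemma relation_cases:
  assumes "w \<in> comm_words \<union> serre_words_real \<union> serre_words_odd \<union> serre_words_null
      \<union> serre_words_short"
  shows "w \<in> comm_words \<or> (\<exists>i \<in> I_re A \<union> Psi_0 A \<Psi>. sgl w \<in> big i)"
proof -
  have 1: ?thesis if w: "w \<in> serre_words_real"
  proof -
    obtain i j where ij: "i \<in> I_re A" "i \<noteq> j" and w_eq: "w = ad_word (Gen i) (nat \<lfloor>1
        - A i j\<rfloor>) (Gen j)"
      using w by (auto simp: serre_words_real_def)
    obtain n where n: "A i j = - real n" "nat \<lfloor>1 - A i j\<rfloor> = Suc n"
      using real_entry[OF ij] .
    show ?thesis
    proof (cases n)
      case 0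
      then show ?thesis unfolding w_eq n(2) using ij n(1) by (auto simp: comm_words_eq)
    next
      case (Suc n')
      then have "sgl w \<in> big i" unfolding w_eq n(2) by (intro big_ad_word) simp
      then show ?thesis using ij by blast
    qed
  qed
  have 2: ?thesis if w: "w \<in> serre_words_odd"
  proof -
    obtain i j where ij: "i \<in> Psi_re A \<Psi>" "i \<noteq> j" and w_eq: "w
        = ad_word (Br (Gen i) (Gen i)) (nat \<lfloor>1 - A i j / 2\<rfloor>) (Gen j)"
      using w by (auto simp: serre_words_odd_def)
    obtain p where p: "nat \<lfloor>1 - A i j / 2\<rfloor> = Suc p"
      using odd_real_entry[OF ij] .
    have "sgl w \<in> big i" unfolding w_eq p by (intro big_ad_word) (simp add: lookup_add)
    then show ?thesis using ij by (auto simp: Psi_re_def)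
  qed
  have 3: ?thesis if w: "w \<in> serre_words_null"
  proof -
    obtain i where "i \<in> Psi_0 A \<Psi>" "w = Br (Gen i) (Gen i)"
      using w by (auto simp: serre_words_null_eq Psi_0_def)
    then have "sgl w \<in> big i" by (simp add: big_def lookup_add)
    then show ?thesis using \<open>i \<in> Psi_0 A \<Psi>\<close> by blast
  qed
  have 4: ?thesis if w: "w \<in> serre_words_short"
  proof -
    obtain i j where ij: "i \<in> Psi_re A \<Psi>" "i \<noteq> j" and w_eq: "w = ad_word (Gen i) (nat \<lfloor>1
        - A i j / 2\<rfloor>) (Gen j)"
      using w by (auto simp: serre_words_short_def)
    obtain p where p: "A i j = - 2 * real p" "nat \<lfloor>1 - A i j / 2\<rfloor> = Suc p"
      using odd_real_entry[OF ij] .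
    show ?thesis
    proof (cases p)
      case 0
      then show ?thesis unfolding w_eq p(2) using ij p(1) by (auto simp: comm_words_eq)
    next
      case (Suc n')
      then have "sgl w \<in> big i" unfolding w_eq p(2) by (intro big_ad_word) simp
      then show ?thesis using ij by (auto simp: Psi_re_def)
    qed
  qed
  show ?thesis using assms 1 2 3 4 by blast
qed

lemma ideal_gens_all_rels:
  assumes "x \<in> ideal_gens par all_rels"
  shows "x \<in> super_ideal par (sgl ` comm_words) \<or> (\<exists>i \<in> I_re A \<union> Psi_0 A \<Psi>. x \<in> big i)"
  using assms
proof induction
  case (ideal_gens_rel x)
  then show ?case using relation_cases by (auto intro: super_ideal_rel)
next
  case (ideal_gens_left x w)
  then show ?case using super_ideal_left[of x par "sgl ` comm_words" "sgl w"] big_nmul[of x _ "sgl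
      w"] by blast
next
  case (ideal_gens_right x w)
  then show ?case using super_ideal_right[of x par "sgl ` comm_words" "sgl w"] big_nmul[of x _ "sgl
      w"] by blast
qed (intro disjI1 super_ideal_base ideal_gens_anti ideal_gens_jac)+

lemma all_rels_component:
  assumes k: "\<forall>i \<in> I_re A \<union> Psi_0 A \<Psi>. Poly_Mapping.lookup k i \<le> 1"
    and u: "u \<in> super_ideal par all_rels" "u \<in> homo deg1 k"
  shows "u \<in> super_ideal par (sgl ` comm_words)"
proof -
  \<comment> \<open>The projection onto degree \<open>k\<close>. It preserves the ideal of the
    commutation relations, whose spanning set is homogeneous, kills every \<open>big i\<close> in
    question, and fixes \<open>u\<close>.\<close>
  define P where "P = lin (\<lambda>w::'i word. if word_deg deg1 w = k then sgl w else 0)"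
  have P: "P x = (if d = k then x else 0)" if "x \<in> homo deg1 d" for x d
  proof -
    have "P x = lin (if d = k then sgl else (\<lambda>_. 0)) x"
      unfolding P_def using that by (intro lin_cong) (auto simp: homo_def)
    then show ?thesis by (auto simp: lin_id) (simp add: lin_def)
  qed
  have comm_words: "P x \<in> super_ideal par (sgl ` comm_words)" if "x
      \<in> super_ideal par (sgl ` comm_words)" for x
  proof (rule span_image_sub[where f = P, OF _ super_ideal_subspace _ that[unfolded
      super_ideal_def]])
    fix x :: "'i word \<Rightarrow>\<^sub>0 complex" assume x: "x \<in> ideal_gens par (sgl ` comm_words)"
    obtain d where "x \<in> homo deg1 d" using ideal_gens_homo_words x by blast
    then show "P x \<in> super_ideal par (sgl ` comm_words)" using x by (auto simp: P super_ideal_base)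
  qed (simp add: P_def)
  have "P u \<in> super_ideal par (sgl ` comm_words)"
  proof (rule span_image_sub[where f = P, OF _ super_ideal_subspace _ u(1)[unfolded
      super_ideal_def]])
    fix x :: "'i word \<Rightarrow>\<^sub>0 complex" assume x: "x \<in> ideal_gens par all_rels"
    have "P x = 0" if "x \<in> big i" "i \<in> I_re A \<union> Psi_0 A \<Psi>" for i
    proof -
      have "word_deg deg1 w \<noteq> k" if "w \<in> Poly_Mapping.keys x" for w
      proof -
        have "2 \<le> Poly_Mapping.lookup (word_deg deg1 w) i"
          using that \<open>x \<in> big i\<close> unfolding big_def by blast
        moreover have "Poly_Mapping.lookup k i \<le> 1" using k \<open>i \<in> _\<close> by blast
        ultimately show ?thesis by auto
      qed
      then show ?thesis unfolding P_def lin_def by (intro sum.neutral) auto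
    qed
    then show "P x \<in> super_ideal par (sgl ` comm_words)" using ideal_gens_all_rels[OF x] comm_words
        by fastforce
  qed (simp add: P_def)
  then show ?thesis using P[OF u(2)] by simp
qed

end

section \<open>Triangular decomposition\<close>

lemma subspace_image:
  assumes "islin f" "pm.subspace S"
  shows "pm.subspace (f ` S)"
  unfolding pm.subspace_def
proof (intro conjI ballI allI; (elim imageE)?)
  show "0 \<in> f ` S" using pm.subspace_0[OF assms(2)] islin_0[OF assms(1)] by (metis imageI)
next
  fix x y u v assume "x = f u" "u \<in> S" "y = f v" "v \<in> S"
  then show "x + y \<in> f ` S"
    using pm.subspace_add[OF assms(2)] islin_add[OF assms(1)] by (metis imageI)
next
  fix c x u assume "x = f u" "u \<in> S"
  then show "scl c x \<in> f ` S"
    using pm.subspace_scale[OF assms(2)] islin_scl[OF assms(1)] by (metis imageI)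
qed

context bkm_matrix
begin

abbreviation bkm_ideal :: "('i bkm_generator word \<Rightarrow>\<^sub>0 complex) set" where "bkm_ideal \<equiv> super_ideal
    gp bkm_rels"

abbreviation root_deg :: "'i bkm_generator word \<Rightarrow> 'i \<Rightarrow>\<^sub>0 int" where "root_deg \<equiv> word_deg bkm_degree"

text \<open>The Cartan generators are counted on both sides: bracketing a word of one side with an
  opposite generator leads out of the words of that side only into the h_i.\<close>

definition side_basis :: "bool \<Rightarrow> ('i \<Rightarrow>\<^sub>0 int) \<Rightarrow> 'i bkm_generator word set" where
  "side_basis b d = {side_word b w | w. root_deg (side_word b w) = d} \<union> {Gen (H i) | i. d = 0}"

definition mod_bkm :: "'i bkm_generator word set \<Rightarrow> ('i bkm_generator word \<Rightarrow>\<^sub>0 complex) set" where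
  "mod_bkm S = {u. \<exists>v\<in>pm.span (sgl ` S). u - v \<in> bkm_ideal}"

lemma subspace_mod_bkm: "pm.subspace (mod_bkm S)"
  unfolding pm.subspace_def mod_bkm_def
proof (intro conjI ballI allI CollectI; (elim CollectE bexE)?)
  show "\<exists>v\<in>pm.span (sgl ` S). 0 - v \<in> bkm_ideal" by (rule bexI[of _ 0]) (auto simp: pm.span_zero)
next
  fix x y v v'
  assume "v \<in> pm.span (sgl ` S)" "v' \<in> pm.span (sgl ` S)" "x - v \<in> bkm_ideal" "y - v' \<in> bkm_ideal"
  then show "\<exists>v\<in>pm.span (sgl ` S). x + y - v \<in> bkm_ideal"
    using super_ideal_add[of "x - v" gp bkm_rels "y - v'"] by (intro bexI[of _ "v
        + v'"] pm.span_add) (auto simp: algebra_simps)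
next
  fix c x v
  assume "v \<in> pm.span (sgl ` S)" "x - v \<in> bkm_ideal"
  then show "\<exists>v\<in>pm.span (sgl ` S). scl c x - v \<in> bkm_ideal"
    using super_ideal_scl[of "x - v" gp bkm_rels c]
        by (intro bexI[of _ "scl c v"] pm.span_scale) (auto simp: algebra_simps)
qed

lemmas mod_bkm_closed = pm.subspace_add[OF subspace_mod_bkm] pm.subspace_diff[OF subspace_mod_bkm]
  pm.subspace_scale[OF subspace_mod_bkm] pm.subspace_neg[OF subspace_mod_bkm] pm.subspace_0[OF
      subspace_mod_bkm]

lemma mod_bkm_base: "w \<in> S \<Longrightarrow> sgl w \<in> mod_bkm S"
  unfolding mod_bkm_def by (auto intro!: bexI[of _ "sgl w"] pm.span_base)

lemma bkm_ideal_mod_bkm: "u \<in> bkm_ideal \<Longrightarrow> u \<in> mod_bkm S"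
  unfolding mod_bkm_def by (auto intro!: bexI[of _ 0] pm.span_zero)

lemma mod_bkm_cong: "u - v \<in> bkm_ideal \<Longrightarrow> v \<in> mod_bkm S \<Longrightarrow> u \<in> mod_bkm S"
  using pm.subspace_add[OF subspace_mod_bkm bkm_ideal_mod_bkm[of "u - v" S]] by fastforce

lemma mod_bkm_mono: "S \<subseteq> S' \<Longrightarrow> mod_bkm S \<subseteq> mod_bkm S'"
  unfolding mod_bkm_def using pm.span_mono[of "sgl ` S" "sgl ` S'"] by blast

lemma mod_bkm_map:
  assumes "islin f" "\<And>v. v \<in> bkm_ideal \<Longrightarrow> f v \<in> bkm_ideal" "\<And>w. w \<in> S \<Longrightarrow> f (sgl w) \<in> mod_bkm S'" "u
      \<in> mod_bkm S"
  shows "f u \<in> mod_bkm S'"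
proof -
  obtain v where v: "v \<in> pm.span (sgl ` S)" "u - v \<in> bkm_ideal" using assms(4)
      by (auto simp: mod_bkm_def)
  have "f v \<in> mod_bkm S'"
    by (rule span_image_sub[OF assms(1) subspace_mod_bkm _ v(1)]) (use assms(3) in auto)
  moreover have "f u - f v \<in> bkm_ideal" using assms(2)[OF v(2)]
      by (simp add: islin_simps[OF assms(1)])
  ultimately show ?thesis by (rule mod_bkm_cong[rotated])
qed

lemma bkm_ideal_anti: "nmul (sgl s) (sgl t) + scl (ssign gp s t) (nmul (sgl t) (sgl s)) \<in> bkm_ideal"
  by (rule super_ideal_anti) auto

lemma bkm_ideal_jac: "nmul (nmul (sgl s) (sgl t)) z - (nmul (sgl s) (nmul (sgl t) z)
    - scl (ssign gp s t) (nmul (sgl t) (nmul (sgl s) z))) \<in> bkm_ideal"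
  using super_ideal_neg[OF super_ideal_jac[of "sgl s" gp "word_deg gp s" "sgl t" "word_deg gp t" z
      bkm_rels]] by (simp add: algebra_simps)

lemma bkm_ideal_flip:
  assumes "nmul (sgl s) (sgl t) \<in> mod_bkm S" shows "nmul (sgl t) (sgl s) \<in> mod_bkm S"
proof -
  have "nmul (sgl t) (sgl s) - scl (- ssign gp t s) (nmul (sgl s) (sgl t)) \<in> bkm_ideal"
    using bkm_ideal_anti[of t s] by simp
  then show ?thesis by (rule mod_bkm_cong) (intro mod_bkm_closed assms)
qed

lemma bkm_ideal_rel:
  shows cartan_bkm_ideal: "sgl (Br (Gen (H i)) (Gen (H j))) \<in> bkm_ideal"
    and HG_bkm_ideal: "sgl (Br (Gen (H i)) (Gen (gen b j)))
        - scl (- side_sign b * A i j) (sgl (Gen (gen b j))) \<in> bkm_ideal"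
    and EF_bkm_ideal: "sgl (Br (Gen (E i)) (Gen (F j))) - (if i = j then sgl (Gen (H i)) else 0)
        \<in> bkm_ideal"
proof -
  show "sgl (Br (Gen (H i)) (Gen (H j))) \<in> bkm_ideal"
    by (intro super_ideal_rel) (unfold bkm_rels_def, blast)
  show "sgl (Br (Gen (E i)) (Gen (F j))) - (if i = j then sgl (Gen (H i)) else 0) \<in> bkm_ideal"
    by (intro super_ideal_rel) (unfold bkm_rels_def, blast)
  have "sgl (Br (Gen (H i)) (Gen (E j))) - scl (A i j) (sgl (Gen (E j))) \<in> bkm_ideal"
    "sgl (Br (Gen (H i)) (Gen (F j))) + scl (A i j) (sgl (Gen (F j))) \<in> bkm_ideal"
    by (intro super_ideal_rel; unfold bkm_rels_def; blast)+
  then show "sgl (Br (Gen (H i)) (Gen (gen b j))) - scl (- side_sign b * A i j) (sgl (Gen (gen b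
      j))) \<in> bkm_ideal"
    by (cases b) (simp_all add: gen_def side_sign_def)
qed

lemma H_word: "\<exists>c. nmul (sgl (Gen (H i))) (sgl (side_word b w)) - scl c (sgl (side_word b w))
    \<in> bkm_ideal"
proof (induction w)
  case (Gen j)
  show ?case by (rule exI[of _ "- side_sign b * A i j"]) (use HG_bkm_ideal[of i b j] in simp)
next
  case (Br s t)
  let ?h = "sgl (Gen (H i))" and ?s = "sgl (side_word b s)" and ?t = "sgl (side_word b t)"
  obtain c c' where c: "nmul ?h ?s - scl c ?s \<in> bkm_ideal" "nmul ?h ?t - scl c' ?t \<in> bkm_ideal"
    using Br by blast
  have 1: "nmul ?h (nmul ?s ?t) - (nmul (nmul ?h ?s) ?t + nmul ?s (nmul ?h ?t)) \<in> bkm_ideal"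
    using super_ideal_jac[of ?h gp 0 ?s "word_deg gp (side_word b s)" ?t bkm_rels] by simp
  have "nmul ?h (nmul ?s ?t) - (nmul (nmul ?h ?s) ?t + nmul ?s (nmul ?h ?t)) + nmul (nmul ?h ?s
      - scl c ?s) ?t
     + nmul ?s (nmul ?h ?t - scl c' ?t) \<in> bkm_ideal"
    by (intro super_ideal_add 1 super_ideal_left super_ideal_right c)
  then show ?case by (intro exI[of _ "c + c'"]) (simp add: algebra_simps)
qed

lemma H_side: "u \<in> mod_bkm (side_basis b d) \<Longrightarrow> nmul (sgl (Gen (H i))) u \<in> mod_bkm (side_basis b d)"
proof (rule mod_bkm_map[of "nmul (sgl (Gen (H i)))"])
  fix w assume w: "w \<in> side_basis b d"
  show "nmul (sgl (Gen (H i))) (sgl w) \<in> mod_bkm (side_basis b d)"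
  proof (cases "\<exists>j. w = Gen (H j)")
    case True
    then show ?thesis using cartan_bkm_ideal by (auto intro: bkm_ideal_mod_bkm)
  next
    case False
    then obtain w' where w': "w = side_word b w'" using w by (auto simp: side_basis_def)
    obtain c where "nmul (sgl (Gen (H i))) (sgl w) - scl c (sgl w) \<in> bkm_ideal" using H_word w'
        by blast
    then show ?thesis by (rule mod_bkm_cong) (intro mod_bkm_closed mod_bkm_base w)
  qed
qed (auto intro: super_ideal_left)

lemma side_word_side: "side_word b w \<in> side_basis b (root_deg (side_word b w))"
  by (auto simp: side_basis_def)

lemma side_word_left:
  assumes "u \<in> mod_bkm (side_basis b d)"
  shows "nmul (sgl (side_word b w)) u \<in> mod_bkm (side_basis b (root_deg (side_word b w) + d))"
proof (rule mod_bkm_map[of "nmul (sgl (side_word b w))", OF _ _ _ assms])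
  fix z assume z: "z \<in> side_basis b d"
  show "nmul (sgl (side_word b w)) (sgl z) \<in> mod_bkm (side_basis b (root_deg (side_word b w) + d))"
  proof (cases "\<exists>j. z = Gen (H j) \<and> d = 0")
    case True
    then obtain j where z: "z = Gen (H j)" and d: "d = 0" by blast
    from bkm_ideal_flip[OF H_side[OF mod_bkm_base[OF side_word_side[of b w]], of j]] show ?thesis
        unfolding z d by simp
  next
    case False
    then obtain w' where w': "z = side_word b w'" "root_deg z = d" using z
        by (auto simp: side_basis_def)
    have "Br (side_word b w) z \<in> side_basis b (root_deg (side_word b w) + d)"
      using side_word_side[of b "Br w w'"] w' by simp
    then show ?thesis by (simp add: mod_bkm_base)
  qed
qed (auto intro: super_ideal_left)

lemma side_word_right:
  assumes "u \<in> mod_bkm (side_basis b d)"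
  shows "nmul u (sgl (side_word b w)) \<in> mod_bkm (side_basis b (d + root_deg (side_word b w)))"
proof (rule mod_bkm_map[of "\<lambda>u. nmul u (sgl (side_word b w))", OF _ _ _ assms])
  fix z assume z: "z \<in> side_basis b d"
  then show "nmul (sgl z) (sgl (side_word b w)) \<in> mod_bkm (side_basis b (d
      + root_deg (side_word b w)))"
    using side_word_left[OF mod_bkm_base[OF z], of w] by
        - (rule bkm_ideal_flip, simp only: add.commute)
qed (auto intro: super_ideal_right)

text \<open>The opposite generator is moved inward by the Jacobi identity until it meets a single
  letter, where the bracket is a Cartan generator or zero. A Cartan generator created inside is
  absorbed, since words of one side are eigenvectors for it.\<close>

lemma opposite_word:
  "nmul (sgl (Gen (gen (\<not> b) i))) (sgl (side_word b w))
      \<in> mod_bkm (side_basis b (bkm_degree (gen (\<not> b) i) + root_deg (side_word b w)))"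
proof (induction w)
  case (Gen j)
  show ?case
  proof (cases "i = j")
    case True
    have *: "sgl (Gen (H i)) \<in> mod_bkm (side_basis b 0)"
        by (intro mod_bkm_base) (auto simp: side_basis_def)
    have EF: "sgl (Br (Gen (E i)) (Gen (F i))) \<in> mod_bkm (side_basis b 0)"
      using mod_bkm_cong[OF _ *] EF_bkm_ideal[of i i] by simp
    then have "nmul (sgl (Gen (F i))) (sgl (Gen (E i))) \<in> mod_bkm (side_basis b 0)"
      by - (rule bkm_ideal_flip, simp)
    with EF show ?thesis using True by (cases b) (simp_all add: gen_def)
  next
    case False
    have EF: "nmul (sgl (Gen (E i))) (sgl (Gen (F j))) \<in> mod_bkm S" if "i \<noteq> j" for i j S
      using EF_bkm_ideal[of i j] that by (auto intro: bkm_ideal_mod_bkm)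
    show ?thesis using False EF[of i j] bkm_ideal_flip[OF EF[of j i]]
        by (cases b) (simp_all add: gen_def)
  qed
next
  case (Br s t)
  let ?g = "Gen (gen (\<not> b) i)" and ?d = "bkm_degree (gen (\<not> b) i)"
  have 1: "nmul (nmul (sgl ?g) (sgl (side_word b s))) (sgl (side_word b t))
      \<in> mod_bkm (side_basis b (?d + root_deg (side_word b (Br s t))))"
    using side_word_right[OF Br.IH(1), of t] by (simp add: add_ac)
  have 2: "nmul (sgl (side_word b s)) (nmul (sgl ?g) (sgl (side_word b t)))
      \<in> mod_bkm (side_basis b (?d + root_deg (side_word b (Br s t))))"
    using side_word_left[OF Br.IH(2), of s] by (simp add: add_ac)
  have "nmul (sgl ?g) (nmul (sgl (side_word b s)) (sgl (side_word b t))) -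
    (nmul (nmul (sgl ?g) (sgl (side_word b s))) (sgl (side_word b t))
        + scl (ssign gp ?g (side_word b s)) (nmul (sgl (side_word b s)) (nmul (sgl ?g) (sgl
        (side_word b t))))) \<in> bkm_ideal"
    by (rule super_ideal_jac) auto
  then have "nmul (sgl ?g) (nmul (sgl (side_word b s)) (sgl (side_word b t)))
      \<in> mod_bkm (side_basis b (?d + root_deg (side_word b (Br s t))))"
    by (rule mod_bkm_cong) (intro mod_bkm_closed 1 2)
  then show ?case by simp
qed

definition tri_basis :: "('i \<Rightarrow>\<^sub>0 int) \<Rightarrow> 'i bkm_generator word set" where
  "tri_basis d = side_basis True d \<union> side_basis False d"

lemma side_tri: "u \<in> mod_bkm (side_basis b d) \<Longrightarrow> u \<in> mod_bkm (tri_basis d)"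
  using mod_bkm_mono[of "side_basis b d" "tri_basis d"] by (cases b) (auto simp: tri_basis_def)

lemma generator_tri:
  assumes "u \<in> mod_bkm (tri_basis d)"
  shows "nmul (sgl (Gen g)) u \<in> mod_bkm (tri_basis (bkm_degree g + d))"
proof (rule mod_bkm_map[of "nmul (sgl (Gen g))", OF _ _ _ assms])
  fix z assume "z \<in> tri_basis d"
  then obtain b where z: "z \<in> side_basis b d" unfolding tri_basis_def by blast
  show "nmul (sgl (Gen g)) (sgl z) \<in> mod_bkm (tri_basis (bkm_degree g + d))"
  proof (cases "\<exists>i. g = H i")
    case True
    then obtain i where g: "g = H i" by blast
    show ?thesis using side_tri[OF H_side[OF mod_bkm_base[OF z], of i]] unfolding g by simp
  next
    case False
    then obtain b' i where g: "g = gen b' i" by (cases g) (metis gen_simps)+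
    show ?thesis
    proof (cases "b' = b \<or> (\<exists>j. z = Gen (H j) \<and> d = 0)")
      case True
      then have "z \<in> side_basis b' d" using z by (auto simp: side_basis_def)
      from side_word_left[OF mod_bkm_base[OF this], of "Gen i"] show ?thesis
        unfolding g by (intro side_tri) simp
    next
      case False
      then have b': "b' = (\<not> b)" by auto
      obtain w where "z = side_word b w" "root_deg z = d" using z False
          by (auto simp: side_basis_def)
      then show ?thesis using opposite_word[of b i w] unfolding g b' by (intro side_tri) simp
    qed
  qed
qed (auto intro: super_ideal_left)

text \<open>The Jacobi identity writes left multiplication by a bracket as a super commutator of
  left multiplications, so stability of the triangular span under generators extends to all
  words.\<close>

lemma word_tri:
  "u \<in> mod_bkm (tri_basis d) \<Longrightarrow> nmul (sgl w) u \<in> mod_bkm (tri_basis (root_deg w + d))"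
proof (induction w arbitrary: u d)
  case (Gen g)
  then show ?case using generator_tri by simp
next
  case (Br s t)
  have 1: "nmul (sgl s) (nmul (sgl t) u) \<in> mod_bkm (tri_basis (root_deg (Br s t) + d))"
    using Br.IH(1)[OF Br.IH(2)[OF Br.prems]] by (simp add: add_ac)
  have 2: "nmul (sgl t) (nmul (sgl s) u) \<in> mod_bkm (tri_basis (root_deg (Br s t) + d))"
    using Br.IH(2)[OF Br.IH(1)[OF Br.prems]] by (simp add: add_ac)
  have "nmul (nmul (sgl s) (sgl t)) u \<in> mod_bkm (tri_basis (root_deg (Br s t) + d))"
    by (rule mod_bkm_cong[OF bkm_ideal_jac]) (intro mod_bkm_closed 1 2)
  then show ?case by simp
qed

lemma tri_decomposition: "sgl w \<in> mod_bkm (tri_basis (root_deg w))"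
proof (induction w)
  case (Gen g)
  have "Gen g \<in> tri_basis (bkm_degree g)"
    by (cases g) (auto simp: tri_basis_def side_basis_def gen_def intro!: exI[of _ "Gen _"])
  then show ?case by (simp add: mod_bkm_base)
next
  case (Br s t)
  show ?case using word_tri[OF Br.IH(2), of s] by simp
qed

lemma lookup_eta: "Poly_Mapping.lookup (eta k) i = int (Poly_Mapping.lookup k i)"
  unfolding eta_def by (simp add: lookup_sum lookup_single when_def in_keys_iff)

lemma eta_add: "eta (k + k') = eta k + eta k'"
  by (intro poly_mapping_eqI) (simp add: lookup_eta lookup_add)

lemma eta_inj: "eta k = eta k' \<longleftrightarrow> k = k'"
  by (metis lookup_eta of_nat_eq_iff poly_mapping_eqI)

lemma root_deg_E: "root_deg (map_word E w) = eta (word_deg deg1 w)"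
proof (induction w)
  case (Gen i)
  show ?case by (intro poly_mapping_eqI) (simp add: lookup_eta lookup_single when_def)
qed (simp_all add: eta_add)

lemma root_deg_F: "root_deg (map_word F w) = - eta (word_deg deg1 w)"
proof (induction w)
  case (Gen i)
  show ?case by (intro poly_mapping_eqI) (simp add: lookup_eta lookup_single when_def)
qed (simp_all add: eta_add)

lemma positive_component:
  assumes "k \<noteq> 0" "u \<in> homo bkm_degree (eta k)"
  shows "\<exists>v\<in>homo deg1 k. u - sub E v \<in> bkm_ideal"
proof -
  have "eta k \<noteq> 0" using assms(1) eta_inj[of k 0] by (simp add: eta_def)
  have F: "- eta m \<noteq> eta k" for m
  proof
    assume *: "- eta m = eta k"
    have "Poly_Mapping.lookup k i = 0" for i
      using arg_cong[OF *, of "\<lambda>p. Poly_Mapping.lookup p i"] by (simp add: lookup_eta)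
    then show False using assms(1) by (metis poly_mapping_eqI lookup_zero)
  qed
  \<comment> \<open>\<open>eta k\<close> is nonzero, which excludes the Cartan generators, and it is
    not minus a sum of simple roots, which excludes the words in the f_i.\<close>
  have tri: "tri_basis (eta k) = {map_word E w | w. word_deg deg1 w = k}"
    using \<open>eta k \<noteq> 0\<close> F by (auto simp: tri_basis_def side_basis_def gen_def root_deg_E root_deg_F
        eta_inj)
  have "u \<in> mod_bkm (tri_basis (eta k))"
  proof (rule homo_induct[OF assms(2)])
    show "sgl w \<in> mod_bkm (tri_basis (eta k))" if "root_deg w = eta k" for w
      using tri_decomposition[of w] unfolding that .
  qed (use subspace_mod_bkm in simp)
  then obtain v where v: "v \<in> pm.span (sgl ` tri_basis (eta k))" "u - v \<in> bkm_ideal"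
      by (auto simp: mod_bkm_def)
  have "v \<in> sub E ` homo deg1 k"
  proof -
    have "sgl ` tri_basis (eta k) \<subseteq> sub E ` homo deg1 k"
    proof
      fix x assume "x \<in> sgl ` tri_basis (eta k)"
      then obtain w where "x = sub E (sgl w)" "sgl w \<in> homo deg1 k" unfolding tri by auto
      then show "x \<in> sub E ` homo deg1 k" by blast
    qed
    then have "pm.span (sgl ` tri_basis (eta k)) \<subseteq> sub E ` homo deg1 k"
      by (intro pm.span_minimal subspace_image islin_sub subspace_homo)
    then show ?thesis using v(1) by blast
  qed
  then show ?thesis using v(2) by blast
qed

end

section \<open>Presented superalgebras as quotients of the free non-associative algebra\<close>

lemma free_nonassoc_simps [simp]:
  "carrier (free_nonassoc par) = UNIV" "x \<oplus>\<^bsub>free_nonassoc par\<^esub> y = x + y"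
  "c \<odot>\<^bsub>free_nonassoc par\<^esub> x = scl c x" "\<zero>\<^bsub>free_nonassoc par\<^esub> = 0"
  "homog (free_nonassoc par) p = homo par p"
  by (simp_all add: free_nonassoc_def scl_def homo_def)

lemma free_nonassoc_mult [simp]: "x \<otimes>\<^bsub>free_nonassoc par\<^esub> y = nmul x y"
  by (simp add: free_nonassoc_def nmul_def lin_def scl_single pm.scale_sum_right)

text \<open>A superalgebra \<open>L\<close> seen as the free non-associative algebra modulo
  \<open>K\<close>. Working with the projection instead of cosets turns statements on subspaces,
  spans and ideals of \<open>L\<close> into statements on preimages, although the presented algebras
  consist of cosets of cosets.\<close>

locale free_quotient =
  fixes \<pi> :: "('x word \<Rightarrow>\<^sub>0 complex) \<Rightarrow> 'a" and L :: "'a superalg" and par :: "'x \<Rightarrow> bit"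
    and K :: "('x word \<Rightarrow>\<^sub>0 complex) set"
  assumes carrier_eq: "carrier L = range \<pi>"
    and add_eq: "\<pi> u \<oplus>\<^bsub>L\<^esub> \<pi> v = \<pi> (u + v)"
    and smult_eq: "c \<odot>\<^bsub>L\<^esub> \<pi> u = \<pi> (scl c u)"
    and zero_eq: "\<zero>\<^bsub>L\<^esub> = \<pi> 0"
    and mult_eq: "\<pi> u \<otimes>\<^bsub>L\<^esub> \<pi> v = \<pi> (nmul u v)"
    and homog_eq: "homog L p = \<pi> ` homo par p"
    and eq_iff: "\<pi> u = \<pi> v \<longleftrightarrow> u - v \<in> K"
begin

lemma abelian_group: "abelian_group L"
proof (rule abelian_groupI)
  show "\<exists>y\<in>carrier L. y \<oplus>\<^bsub>L\<^esub> x = \<zero>\<^bsub>L\<^esub>" if x: "x \<in> carrier L" for x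
  proof -
    obtain u where "x = \<pi> u" using x by (auto simp: carrier_eq)
    then have "\<pi> (- u) \<oplus>\<^bsub>L\<^esub> x = \<zero>\<^bsub>L\<^esub>" by (simp add: add_eq zero_eq)
    then show ?thesis by (auto simp: carrier_eq)
  qed
qed (auto simp: carrier_eq add_eq zero_eq add_ac)

sublocale Lm: vectorspace class_ring L
  unfolding vectorspace_def
proof
  show "Module.module class_ring L"
    by (rule Module.moduleI[OF class_cring.is_cring abelian_group])
      (auto simp: carrier_eq add_eq smult_eq pm.scale_left_distrib pm.scale_right_distrib)
qed (rule class_field)

lemma minus_eq: "\<pi> u \<ominus>\<^bsub>L\<^esub> \<pi> v = \<pi> (u - v)"
proof -
  have "\<ominus>\<^bsub>L\<^esub> \<pi> v = \<pi> (- v)"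
    by (rule Lm.minus_equality) (auto simp: carrier_eq add_eq zero_eq)
  then show ?thesis by (simp add: a_minus_def add_eq)
qed

lemma eq_zero_iff: "\<pi> u = \<zero>\<^bsub>L\<^esub> \<longleftrightarrow> u \<in> K"
  using eq_iff[of u 0] by (simp add: zero_eq)

lemma K_sub: "pm.subspace K"
proof -
  have "0 \<in> K" using eq_iff[of 0 0] by simp
  moreover have "u + v \<in> K" if "u \<in> K" "v \<in> K" for u v
    using that add_eq[of u v] add_eq[of 0 0] unfolding eq_zero_iff[symmetric] zero_eq by simp
  moreover have "scl c u \<in> K" if "u \<in> K" for c u
    using that smult_eq[of c u] smult_eq[of c 0] unfolding eq_zero_iff[symmetric] zero_eq by simp
  ultimately show ?thesis by (simp add: pm.subspace_def)
qed

lemma submodule_image_iff: "submodule class_ring (\<pi> ` J) L \<longleftrightarrow> pm.subspace {u. \<pi> u \<in> \<pi> ` J}"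
proof
  assume "submodule class_ring (\<pi> ` J) L"
  then interpret submodule class_ring "\<pi> ` J" L .
  show "pm.subspace {u. \<pi> u \<in> \<pi> ` J}"
    using m_closed zero_closed smult_closed
    by (auto simp: pm.subspace_def simp flip: add_eq smult_eq zero_eq)
next
  assume J: "pm.subspace {u. \<pi> u \<in> \<pi> ` J}"
  show "submodule class_ring (\<pi> ` J) L"
  proof (rule submodule.intro)
    show "Module.module class_ring L" ..
    show "\<pi> ` J \<subseteq> carrier L" by (auto simp: carrier_eq)
    show "\<zero>\<^bsub>L\<^esub> \<in> \<pi> ` J" using pm.subspace_0[OF J] by (simp add: zero_eq)
    show "v \<oplus>\<^bsub>L\<^esub> w \<in> \<pi> ` J" if "v \<in> \<pi> ` J" "w \<in> \<pi> ` J" for v w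
      using that pm.subspace_add[OF J] by (fastforce simp: add_eq)
    show "c \<odot>\<^bsub>L\<^esub> v \<in> \<pi> ` J" if "v \<in> \<pi> ` J" for c v
      using that pm.subspace_scale[OF J] by (fastforce simp: smult_eq)
  qed
qed

lemma subspace_iff:
  assumes "X \<subseteq> carrier L"
  shows "subspace class_ring X L \<longleftrightarrow> pm.subspace {u. \<pi> u \<in> X}"
proof -
  have X: "X = \<pi> ` {u. \<pi> u \<in> X}" using assms by (auto simp: carrier_eq)
  have "subspace class_ring X L \<longleftrightarrow> submodule class_ring X L"
    unfolding VectorSpace.subspace_def using Lm.vectorspace_axioms by auto
  also have "\<dots> \<longleftrightarrow> pm.subspace {u. \<pi> u \<in> X}"
    using submodule_image_iff[of "{u. \<pi> u \<in> X}"] X by auto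
  finally show ?thesis .
qed

lemma subspace_image:
  assumes "pm.subspace S" shows "subspace class_ring (\<pi> ` S) L"
proof -
  have "{u. \<pi> u \<in> \<pi> ` S} = {u + v | u v. u \<in> K \<and> v \<in> S}"
    by (force simp: eq_iff algebra_simps image_iff)
  then have "pm.subspace {u. \<pi> u \<in> \<pi> ` S}"
    using pm.subspace_sums[OF K_sub assms] by simp
  then show ?thesis by (subst subspace_iff) (auto simp: carrier_eq)
qed

lemma span_image:
  shows "LinearCombinations.module.span class_ring L (\<pi> ` S) = \<pi> ` pm.span S"
proof
  have sub: "\<pi> ` S \<subseteq> carrier L" by (auto simp: carrier_eq)
  have "submodule class_ring (\<pi> ` pm.span S) L"
    by (intro Lm.is_module subspace_image pm.subspace_span)
  then show "Lm.span (\<pi> ` S) \<subseteq> \<pi> ` pm.span S"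
    by (intro Lm.span_is_subset image_mono pm.span_superset)
  have c: "Lm.span (\<pi> ` S) \<subseteq> carrier L" by (rule Lm.span_is_subset2[OF sub])
  have "pm.subspace {u. \<pi> u \<in> Lm.span (\<pi> ` S)}"
    using subspace_iff[OF c] Lm.span_is_subspace[OF sub] by simp
  then have "pm.span S \<subseteq> {u. \<pi> u \<in> Lm.span (\<pi> ` S)}"
    using Lm.in_own_span[OF sub] by (intro pm.span_minimal) auto
  then show "\<pi> ` pm.span S \<subseteq> Lm.span (\<pi> ` S)" by auto
qed

lemma dim_of_eq:
  assumes "pm.subspace S"
  shows "dim_of L (\<pi> ` S) =
    (LEAST n. \<exists>X. finite X \<and> card X = n \<and> X \<subseteq> \<pi> ` S \<and> LinearCombinations.module.span class_ring L X
        = \<pi> ` S)"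
proof -
  have sub: "subspace class_ring (\<pi> ` S) L" by (rule subspace_image[OF assms])
  interpret V: vectorspace class_ring "L\<lparr>carrier := \<pi> ` S\<rparr>"
    by (rule Lm.subspace_is_vs[OF sub])
  have "V.span X = Lm.span X" if "X \<subseteq> \<pi> ` S" for X
    using Lm.span_li_not_depend(1)[OF that Lm.is_module[OF sub]] by simp
  then have "V.gen_set X \<longleftrightarrow> Lm.span X = \<pi> ` S" if "X \<subseteq> \<pi> ` S" for X
    using that by simp
  then have *: "(finite X \<and> card X = n \<and> X \<subseteq> carrier (L\<lparr>carrier := \<pi> ` S\<rparr>) \<and> V.gen_set X) \<longleftrightarrow>
    (finite X \<and> card X = n \<and> X \<subseteq> \<pi> ` S \<and> Lm.span X = \<pi> ` S)" for X n
    by auto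
  show ?thesis unfolding dim_of_def V.dim_def * ..
qed

lemma superalg_ideal_iff:
  assumes "X \<subseteq> carrier L"
  shows "superalg_ideal X L \<longleftrightarrow> nideal {u. \<pi> u \<in> X}"
  unfolding superalg_ideal_def nideal_def subspace_iff[OF assms]
proof (intro conj_cong refl iffI)
  assume *: "\<forall>x\<in>carrier L. \<forall>y\<in>X. x \<otimes>\<^bsub>L\<^esub> y \<in> X \<and> y \<otimes>\<^bsub>L\<^esub> x \<in> X"
  show "\<forall>u. \<forall>v\<in>{u. \<pi> u \<in> X}. nmul u v \<in> {u. \<pi> u \<in> X} \<and> nmul v u \<in> {u. \<pi> u \<in> X}"
    using * by (auto simp: carrier_eq simp flip: mult_eq)
next
  assume *: "\<forall>u. \<forall>v\<in>{u. \<pi> u \<in> X}. nmul u v \<in> {u. \<pi> u \<in> X} \<and> nmul v u \<in> {u. \<pi> u \<in> X}"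
  show "\<forall>x\<in>carrier L. \<forall>y\<in>X. x \<otimes>\<^bsub>L\<^esub> y \<in> X \<and> y \<otimes>\<^bsub>L\<^esub> x \<in> X"
  proof (intro ballI)
    fix x y assume "x \<in> carrier L" and y: "y \<in> X"
    moreover have "y \<in> carrier L" using assms y by auto
    ultimately obtain u v where "x = \<pi> u" "y = \<pi> v" by (auto simp: carrier_eq)
    then show "x \<otimes>\<^bsub>L\<^esub> y \<in> X \<and> y \<otimes>\<^bsub>L\<^esub> x \<in> X" using * y by (auto simp: mult_eq)
  qed
qed

text \<open>Used twice, for the super identities and then for the relations, this collapses a
  presented algebra to a single quotient by a \<open>super_ideal\<close>.\<close>

lemma ideal_gen_preimage:
  "{u. \<pi> u \<in> ideal_gen L (\<pi> ` S)} = \<Inter>{J. nideal J \<and> K \<subseteq> J \<and> S \<subseteq> J}" (is "?l = ?r")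
proof
  show "?l \<subseteq> ?r"
  proof (intro subsetI InterI; elim CollectE conjE)
    fix u J assume u: "\<pi> u \<in> ideal_gen L (\<pi> ` S)" and J: "nideal J" "K \<subseteq> J" "S \<subseteq> J"
    have eq: "{u. \<pi> u \<in> \<pi> ` J} = J"
    proof -
      have "u \<in> J" if "u - v \<in> K" "v \<in> J" for u v
        using pm.subspace_add[of J "u - v" v] that J by (auto simp: nideal_def)
      then show ?thesis by (auto simp: image_iff eq_iff) (metis pm.subspace_0[OF K_sub]
          cancel_comm_monoid_add_class.diff_cancel)
    qed
    have "superalg_ideal (\<pi> ` J) L"
      using superalg_ideal_iff[of "\<pi> ` J"] J(1) by (auto simp: carrier_eq eq)
    then have "\<pi> u \<in> \<pi> ` J" using u J(3) by (auto simp: ideal_gen_def)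
    then show "u \<in> J" using eq by auto
  qed
  show "?r \<subseteq> ?l"
  proof
    fix u assume u: "u \<in> ?r"
    have "\<pi> u \<in> X" if X: "superalg_ideal X L" "\<pi> ` S \<subseteq> X" for X
    proof -
      have sub: "subspace class_ring X L" using X(1) by (simp add: superalg_ideal_def)
      then have c: "X \<subseteq> carrier L"
        unfolding VectorSpace.subspace_def submodule_def by auto
      have n: "nideal {u. \<pi> u \<in> X}" using superalg_ideal_iff[OF c] X(1) by simp
      moreover have "K \<subseteq> {u. \<pi> u \<in> X}"
        using pm.subspace_0[of "{u. \<pi> u \<in> X}"] n by (auto simp: nideal_def zero_eq simp flip:
            eq_zero_iff)
      ultimately show ?thesis using u X(2) by auto
    qed
    then show "u \<in> ?l" by (auto simp: ideal_gen_def)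
  qed
qed

lemma ideal_gen_is_ideal: "superalg_ideal (ideal_gen L (\<pi> ` S)) L"
proof -
  have "superalg_ideal (carrier L) L"
    by (subst superalg_ideal_iff) (auto simp: carrier_eq nideal_def)
  then have "ideal_gen L (\<pi> ` S) \<subseteq> carrier L"
    by (auto simp: ideal_gen_def carrier_eq)
  then show ?thesis
    by (simp add: superalg_ideal_iff ideal_gen_preimage) (auto simp: nideal_def pm.subspace_def)
qed

lemma quotient:
  assumes J: "superalg_ideal J L"
  shows "free_quotient (\<lambda>u. J +>\<^bsub>L\<^esub> \<pi> u) (quot L J) par {u. \<pi> u \<in> J}"
proof -
  have "J \<subseteq> carrier L"
    using J unfolding superalg_ideal_def VectorSpace.subspace_def submodule_def by auto
  define K' where "K' = {u. \<pi> u \<in> J}"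
  have K': "nideal K'" "K \<subseteq> K'" and JK: "J = \<pi> ` K'"
  proof -
    show n: "nideal K'" using superalg_ideal_iff[OF \<open>J \<subseteq> carrier L\<close>] J by (simp add: K'_def)
    show "K \<subseteq> K'"
      using pm.subspace_0[of K'] n by (auto simp: K'_def nideal_def zero_eq simp flip: eq_zero_iff)
    show "J = \<pi> ` K'" using \<open>J \<subseteq> carrier L\<close> by (auto simp: K'_def carrier_eq)
  qed
  have sub: "pm.subspace K'" using K' by (simp add: nideal_def)
  have coset: "J +>\<^bsub>L\<^esub> \<pi> u = \<pi> ` {v. v - u \<in> K'}" for u
  proof -
    have "J +>\<^bsub>L\<^esub> \<pi> u = (\<lambda>k. \<pi> (k + u)) ` K'"
      unfolding a_r_coset_def' JK by (auto simp: add_eq)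
    also have "\<dots> = \<pi> ` {v. v - u \<in> K'}"
      by (force simp: image_iff intro: exI[of _ "_ - u"])
    finally show ?thesis .
  qed
  have mem: "\<pi> v \<in> J +>\<^bsub>L\<^esub> \<pi> u \<longleftrightarrow> v - u \<in> K'" for u v
  proof
    assume "\<pi> v \<in> J +>\<^bsub>L\<^esub> \<pi> u"
    then obtain w where "v - w \<in> K'" "w - u \<in> K'" using K'(2) by (auto simp: coset eq_iff)
    then show "v - u \<in> K'" using pm.subspace_add[OF sub, of "v - w" "w - u"] by simp
  qed (auto simp: coset)
  have eq: "J +>\<^bsub>L\<^esub> \<pi> u = J +>\<^bsub>L\<^esub> \<pi> v \<longleftrightarrow> u - v \<in> K'" for u v
  proof
    assume "J +>\<^bsub>L\<^esub> \<pi> u = J +>\<^bsub>L\<^esub> \<pi> v"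
    then have "\<pi> u \<in> J +>\<^bsub>L\<^esub> \<pi> v" using mem[of u u] pm.subspace_0[OF sub] by simp
    then show "u - v \<in> K'" by (simp add: mem)
  next
    assume uv: "u - v \<in> K'"
    have "{w. w - u \<in> K'} = {w. w - v \<in> K'}"
      using pm.subspace_add[OF sub _ uv] pm.subspace_diff[OF sub _ uv]
          by (force simp: algebra_simps)
    then show "J +>\<^bsub>L\<^esub> \<pi> u = J +>\<^bsub>L\<^esub> \<pi> v" by (simp add: coset)
  qed
  \<comment> \<open>Scalar multiples and products in \<open>quot\<close> are unions over
    representatives. All terms are the same coset, and nonemptiness of the index set makes the union
    equal to it.\<close>
  have ne: "\<not> (\<forall>w. w - u \<notin> K')" for u
    using pm.subspace_0[OF sub] by (metis diff_self)
  show ?thesis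
    unfolding K'_def[symmetric]
  proof
    show "carrier (quot L J) = range (\<lambda>u. J +>\<^bsub>L\<^esub> \<pi> u)"
      by (auto simp: quot_def A_RCOSETS_def' carrier_eq)
    show "(J +>\<^bsub>L\<^esub> \<pi> u) \<oplus>\<^bsub>quot L J\<^esub> (J +>\<^bsub>L\<^esub> \<pi> v) = J +>\<^bsub>L\<^esub> \<pi> (u + v)" for u v
    proof -
      have "(J +>\<^bsub>L\<^esub> \<pi> u) \<oplus>\<^bsub>quot L J\<^esub> (J +>\<^bsub>L\<^esub> \<pi> v) = {\<pi> (a + b) | a b. a - u \<in> K' \<and> b - v \<in> K'}"
        by (auto simp: quot_def set_add_def' coset add_eq)
      also have "\<dots> = \<pi> ` {w. w - (u + v) \<in> K'}"
      proof (intro equalityI subsetI)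
        fix x assume "x \<in> {\<pi> (a + b) | a b. a - u \<in> K' \<and> b - v \<in> K'}"
        then obtain a b where "x = \<pi> (a + b)" "a - u \<in> K'" "b - v \<in> K'" by blast
        then show "x \<in> \<pi> ` {w. w - (u + v) \<in> K'}"
          using pm.subspace_add[OF sub, of "a - u" "b - v"] by (auto simp: algebra_simps)
      next
        fix x assume "x \<in> \<pi> ` {w. w - (u + v) \<in> K'}"
        then obtain w where "x = \<pi> ((w - v) + v)" "(w - v) - u \<in> K'" by (auto simp: algebra_simps)
        then show "x \<in> {\<pi> (a + b) | a b. a - u \<in> K' \<and> b - v \<in> K'}"
          using pm.subspace_0[OF sub] by (metis (mono_tags, lifting)
              cancel_comm_monoid_add_class.diff_cancel mem_Collect_eq)
      qed
      finally show ?thesis by (simp add: coset)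
    qed
    show "c \<odot>\<^bsub>quot L J\<^esub> (J +>\<^bsub>L\<^esub> \<pi> u) = J +>\<^bsub>L\<^esub> \<pi> (scl c u)" for c u
    proof -
      have "c \<odot>\<^bsub>quot L J\<^esub> (J +>\<^bsub>L\<^esub> \<pi> u) = (\<Union>w\<in>{w. w - u \<in> K'}. J +>\<^bsub>L\<^esub> \<pi> (scl c w))"
        by (simp add: quot_def coset[of u] smult_eq)
      also have "\<dots> = (\<Union>w\<in>{w. w - u \<in> K'}. J +>\<^bsub>L\<^esub> \<pi> (scl c u))"
        using pm.subspace_scale[OF sub, of _ c] by (intro SUP_cong refl) (auto simp: eq simp flip:
            pm.scale_right_diff_distrib)
      also have "\<dots> = J +>\<^bsub>L\<^esub> \<pi> (scl c u)" by (simp add: ne)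
      finally show ?thesis .
    qed
    show "\<zero>\<^bsub>quot L J\<^esub> = J +>\<^bsub>L\<^esub> \<pi> 0" by (simp add: quot_def coset flip: JK)
    show "(J +>\<^bsub>L\<^esub> \<pi> u) \<otimes>\<^bsub>quot L J\<^esub> (J +>\<^bsub>L\<^esub> \<pi> v) = J +>\<^bsub>L\<^esub> \<pi> (nmul u v)" for u v
    proof -
      have "(J +>\<^bsub>L\<^esub> \<pi> u) \<otimes>\<^bsub>quot L J\<^esub> (J +>\<^bsub>L\<^esub> \<pi> v) =
        (\<Union>a\<in>{a. a - u \<in> K'}. \<Union>b\<in>{b. b - v \<in> K'}. J +>\<^bsub>L\<^esub> \<pi> (nmul a b))"
        by (simp add: quot_def rcoset_mult_def coset[of u] coset[of v] mult_eq)
      also have "\<dots> = (\<Union>a\<in>{a. a - u \<in> K'}. \<Union>b\<in>{b. b - v \<in> K'}. J +>\<^bsub>L\<^esub> \<pi> (nmul u v))"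
      proof (intro SUP_cong refl)
        fix a b assume "a \<in> {a. a - u \<in> K'}" "b \<in> {b. b - v \<in> K'}"
        then have "nmul (a - u) b + nmul u (b - v) \<in> K'"
          using K'(1) unfolding nideal_def by (intro pm.subspace_add[OF sub]) blast+
        then show "J +>\<^bsub>L\<^esub> \<pi> (nmul a b) = J +>\<^bsub>L\<^esub> \<pi> (nmul u v)" by (simp add: eq)
      qed
      also have "\<dots> = J +>\<^bsub>L\<^esub> \<pi> (nmul u v)" by (simp add: ne)
      finally show ?thesis .
    qed
    show "homog (quot L J) p = (\<lambda>u. J +>\<^bsub>L\<^esub> \<pi> u) ` homo par p" for p
      by (auto simp: quot_def homog_eq)
  qed (rule eq)
qed

lemma word_eval: "word_eval L (\<lambda>x. \<pi> (sgl (Gen x))) w = \<pi> (sgl w)"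
  by (induction w) (simp_all add: mult_eq)

lemma graded_comp: "graded_comp L (\<lambda>x. \<pi> (sgl (Gen x))) deg d = \<pi> ` homo deg d"
proof -
  have "{word_eval L (\<lambda>x. \<pi> (sgl (Gen x))) w | w. word_deg deg w = d}
      = \<pi> ` (sgl ` {w. word_deg deg w = d})"
    by (auto simp: word_eval)
  then show ?thesis unfolding graded_comp_def by (simp only: span_image homo_span)
qed

lemma funpow_ad: "(ad L (\<pi> (sgl s)) ^^ n) (\<pi> (sgl t)) = \<pi> (sgl (ad_word s n t))"
  by (induction n) (simp_all add: ad_def mult_eq)

end

lemma free_quotient_nonassoc: "free_quotient (\<lambda>u. u) (free_nonassoc par) par {0}"
  by unfold_locales auto

text \<open>The identities are multilinear in homogeneous arguments, hence consequences of those for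
  words; conversely words are homogeneous.\<close>

lemma super_identities_super_ideal:
  "\<Inter>{J. nideal J \<and> {0} \<subseteq> J \<and> super_identities (free_nonassoc par) \<subseteq> J} = super_ideal par {}"
proof -
  interpret F: free_quotient "\<lambda>u. u" "free_nonassoc par" par "{0}"
    by (rule free_quotient_nonassoc)
  have SI: "super_identities (free_nonassoc par) =
    {nmul x y + scl (super_sign p q) (nmul y x) | p q x y. x \<in> homo par p \<and> y \<in> homo par q} \<union>
    {nmul x (nmul y z) - (nmul (nmul x y) z + scl (super_sign p q) (nmul y (nmul x z)))
      | p q x y z. x \<in> homo par p \<and> y \<in> homo par q}"
    by (simp add: super_identities_def F.minus_eq)
  show ?thesis
  proof (intro equalityI Inter_greatest)
    show "\<Inter>{J. nideal J \<and> {0} \<subseteq> J \<and> super_identities (free_nonassoc par) \<subseteq> J} \<subseteq> super_ideal par {}"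
      by (rule Inter_lower) (auto simp: SI nideal_super_ideal super_ideal_anti super_ideal_jac)
  next
    fix J assume "J \<in> {J. nideal J \<and> {0} \<subseteq> J \<and> super_identities (free_nonassoc par) \<subseteq> J}"
    then have J: "nideal J" "super_identities (free_nonassoc par) \<subseteq> J" by auto
    show "super_ideal par {} \<subseteq> J"
    proof (rule super_ideal_least[OF J(1)])
      show "sgl (Br s t) + scl (ssign par s t) (sgl (Br t s)) \<in> J" for s t
      proof (rule subsetD[OF J(2)])
        have "nmul (sgl s) (sgl t) + scl (ssign par s t) (nmul (sgl t) (sgl s))
            \<in> super_identities (free_nonassoc par)"
          unfolding SI by (rule UnI1, rule CollectI, intro exI conjI, rule refl) simp_all
        then show "sgl (Br s t) + scl (ssign par s t) (sgl (Br t s))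
            \<in> super_identities (free_nonassoc par)" by simp
      qed
      show "sgl (Br r (Br s t)) - (sgl (Br (Br r s) t) + scl (ssign par r s) (sgl (Br s (Br r t))))
          \<in> J" for r s t
      proof (rule subsetD[OF J(2)])
        have "nmul (sgl r) (nmul (sgl s) (sgl t)) - (nmul (nmul (sgl r) (sgl s)) (sgl t)
            + scl (ssign par r s) (nmul (sgl s) (nmul (sgl r) (sgl t))))
          \<in> super_identities (free_nonassoc par)"
          unfolding SI by (rule UnI2, rule CollectI, intro exI conjI, rule refl) simp_all
        then show "sgl (Br r (Br s t)) - (sgl (Br (Br r s) t)
            + scl (ssign par r s) (sgl (Br s (Br r t)))) \<in> super_identities (free_nonassoc par)"
          by simp
      qed
    qed simp
  qed
qed

definition free_proj :: "('x \<Rightarrow> bit) \<Rightarrow> ('x word \<Rightarrow>\<^sub>0 complex) \<Rightarrow> ('x word \<Rightarrow>\<^sub>0 complex) set" where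
  "free_proj par u = ideal_gen (free_nonassoc par) (super_identities (free_nonassoc par))
      +>\<^bsub>free_nonassoc par\<^esub> u"

lemma free_gen_eq: "free_gen par x = free_proj par (sgl (Gen x))"
  by (simp add: free_gen_def free_proj_def)

lemma free_quotient_free_lie: "free_quotient (free_proj par) (free_lie par) par (super_ideal par
    {})"
proof -
  interpret F: free_quotient "\<lambda>u. u" "free_nonassoc par" par "{0}"
    by (rule free_quotient_nonassoc)
  have "{u. u \<in> ideal_gen (free_nonassoc par) (super_identities (free_nonassoc par))}
      = super_ideal par {}"
    using F.ideal_gen_preimage[of "super_identities (free_nonassoc par)"]
    unfolding super_identities_super_ideal image_ident .
  then show ?thesis
    using F.quotient[OF F.ideal_gen_is_ideal[of "super_identities (free_nonassoc par)"]]
    by (simp add: free_lie_def free_proj_def[abs_def])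
qed

lemma Inter_super_ideal: "\<Inter>{J. nideal J \<and> super_ideal par S0 \<subseteq> J \<and> S \<subseteq> J} = super_ideal par (S0
    \<union> S)"
proof (intro equalityI Inter_greatest)
  show "\<Inter>{J. nideal J \<and> super_ideal par S0 \<subseteq> J \<and> S \<subseteq> J} \<subseteq> super_ideal par (S0 \<union> S)"
  proof (rule Inter_lower, intro CollectI conjI nideal_super_ideal)
    show "S \<subseteq> super_ideal par (S0 \<union> S)" by (auto intro: super_ideal_rel)
    show "super_ideal par S0 \<subseteq> super_ideal par (S0 \<union> S)"
        by (rule super_ideal_mono) (auto intro: super_ideal_rel)
  qed
next
  fix J assume "J \<in> {J. nideal J \<and> super_ideal par S0 \<subseteq> J \<and> S \<subseteq> J}"
  moreover have "S0 \<subseteq> super_ideal par S0" by (auto intro: super_ideal_rel)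
  ultimately show "super_ideal par (S0 \<union> S) \<subseteq> J" using super_ideal_least_over[of J "S0 \<union> S" par S0]
      by blast
qed

definition presented_proj ::
  "('x \<Rightarrow> bit) \<Rightarrow> ('x word \<Rightarrow>\<^sub>0 complex) set set \<Rightarrow> ('x word \<Rightarrow>\<^sub>0 complex) \<Rightarrow> 'x presented" where
  "presented_proj par R u = ideal_gen (free_lie par) R +>\<^bsub>free_lie par\<^esub> free_proj par u"

lemma presented_gen_eq: "presented_gen par R = (\<lambda>x. presented_proj par R (sgl (Gen x)))"
  by (simp add: presented_gen_def presented_proj_def free_gen_eq fun_eq_iff)

lemma free_quotient_presented:
  assumes "R = free_proj par ` S"
  shows "free_quotient (presented_proj par R) (presented_lie par R) par (super_ideal par S)"
proof -
  interpret F: free_quotient "free_proj par" "free_lie par" par "super_ideal par {}"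
    by (rule free_quotient_free_lie)
  have "{u. free_proj par u \<in> ideal_gen (free_lie par) R} = super_ideal par S"
    unfolding assms F.ideal_gen_preimage Inter_super_ideal by simp
  then show ?thesis
    using F.quotient[OF F.ideal_gen_is_ideal[of S]]
    by (simp add: presented_lie_def presented_proj_def[abs_def] assms)
qed

section \<open>The comparison map\<close>

lemma span_islin_image:
  assumes "islin f" shows "f ` pm.span S = pm.span (f ` S)"
proof
  show "f ` pm.span S \<subseteq> pm.span (f ` S)"
    using span_image_sub[OF assms pm.subspace_span, of S "f ` S"] by (auto intro: pm.span_base)
  show "pm.span (f ` S) \<subseteq> f ` pm.span S"
    by (intro pm.span_minimal subspace_image[OF assms] pm.subspace_span image_mono pm.span_superset)
qed

lemma map_word_ad_word: "map_word f (ad_word s n t) = ad_word (map_word f s) n (map_word f t)"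
  by (induction n) auto

context bkm_matrix
begin

lemma serre_elements_eq:
  assumes "free_quotient \<pi> L par' K"
  shows "serre_elements A \<Psi> L (\<lambda>i. \<pi> (sgl (Gen (f i)))) = \<pi> ` sgl ` map_word f ` serre_words"
    and "short_odd_serre_elements A \<Psi> L (\<lambda>i. \<pi> (sgl (Gen (f i))))
        = \<pi> ` sgl ` map_word f ` serre_words_short"
proof -
  interpret free_quotient \<pi> L par' K by (rule assms)
  have *: "(ad L (\<pi> (sgl (Gen x))) ^^ n) (\<pi> (sgl t)) = \<pi> (sgl (ad_word (Gen x) n t))"
    "(ad L (\<pi> (sgl (Gen x)) \<otimes>\<^bsub>L\<^esub> \<pi> (sgl (Gen x))) ^^ n) (\<pi> (sgl t))
        = \<pi> (sgl (ad_word (Br (Gen x) (Gen x)) n t))" for x n t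
    by (simp_all add: mult_eq funpow_ad)
  show "serre_elements A \<Psi> L (\<lambda>i. \<pi> (sgl (Gen (f i)))) = \<pi> ` sgl ` map_word f ` serre_words"
    unfolding serre_elements_def serre_words_def serre_words_real_def serre_words_odd_def
        serre_words_null_def image_Un *
    by (intro arg_cong2[where f = "(\<union>)"]; force simp: map_word_ad_word)
  show "short_odd_serre_elements A \<Psi> L (\<lambda>i. \<pi> (sgl (Gen (f i))))
      = \<pi> ` sgl ` map_word f ` serre_words_short"
    unfolding short_odd_serre_elements_def serre_words_short_def * by (force simp: map_word_ad_word)
qed

lemma bkm_relations_eq: "bkm_relations A \<Psi> = free_proj gp ` bkm_rels"
proof -
  interpret F: free_quotient "free_proj gp" "free_lie gp" gp "super_ideal gp {}"
    by (rule free_quotient_free_lie)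
  have if_eq: "(if i = j then free_proj gp (sgl (Gen (H i))) else \<zero>\<^bsub>free_lie gp\<^esub>) =
    free_proj gp (if i = j then sgl (Gen (H i)) else 0)" for i j
    by (simp add: F.zero_eq)
  show ?thesis
    unfolding bkm_relations_def Let_def free_gen_eq bkm_rels_def image_Un
      serre_elements_eq(1)[OF F.free_quotient_axioms] if_eq F.mult_eq F.smult_eq F.minus_eq F.add_eq
          nmul_sgl
    by (intro arg_cong2[where f = "(\<union>)"]; blast)
qed

lemma LS_relations_eq: "LS_relations (dynkin_adj A) \<Psi> = free_proj par ` sgl ` comm_words"
proof -
  interpret F: free_quotient "free_proj par" "free_lie par" par "super_ideal par {}"
    by (rule free_quotient_free_lie)
  show ?thesis
    unfolding LS_relations_def comm_words_def free_gen_eq F.mult_eq nmul_sgl by blast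
qed

abbreviation bkm_proj :: "('i bkm_generator word \<Rightarrow>\<^sub>0 complex) \<Rightarrow> 'i bkm_generator presented" where
  "bkm_proj \<equiv> presented_proj gp (bkm_relations A \<Psi>)"

abbreviation LS_proj :: "('i word \<Rightarrow>\<^sub>0 complex) \<Rightarrow> 'i presented" where
  "LS_proj \<equiv> presented_proj par (LS_relations (dynkin_adj A) \<Psi>)"

abbreviation "LSA \<equiv> LS (dynkin_adj A) \<Psi>"

sublocale B: free_quotient bkm_proj "bkm A \<Psi>" gp bkm_ideal
  unfolding bkm_def by (rule free_quotient_presented[OF bkm_relations_eq])

sublocale S: free_quotient LS_proj LSA par "super_ideal par (sgl ` comm_words)"
  unfolding LS_def by (rule free_quotient_presented[OF LS_relations_eq])

lemma bkm_gen_eq: "bkm_gen A \<Psi> = (\<lambda>x. bkm_proj (sgl (Gen x)))"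
  by (simp add: bkm_gen_def presented_gen_eq)

lemma LS_gen_eq: "LS_gen (dynkin_adj A) \<Psi> = (\<lambda>x. LS_proj (sgl (Gen x)))"
  by (simp add: LS_gen_def presented_gen_eq)

lemma root_space_eq: "root_space A \<Psi> \<alpha> = bkm_proj ` homo bkm_degree \<alpha>"
  unfolding root_space_def bkm_gen_eq by (rule B.graded_comp)

lemma LS_comp_eq: "LS_comp (dynkin_adj A) \<Psi> k = LS_proj ` homo deg1 k"
  unfolding LS_comp_def LS_gen_eq by (rule S.graded_comp)

text \<open>A representative is chosen; \<open>phi_proj\<close> shows that the choice is immaterial,
  since substituting the e_i sends the commutation relations into the relations of the BKM
  superalgebra.\<close>

definition phi :: "'i presented \<Rightarrow> 'i bkm_generator presented" where
  "phi X = bkm_proj (sub E (SOME u. LS_proj u = X))"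

lemma phi_proj: "phi (LS_proj u) = bkm_proj (sub E u)"
proof -
  have "LS_proj (SOME v. LS_proj v = LS_proj u) = LS_proj u" by (rule someI) (rule refl)
  then have "(SOME v. LS_proj v = LS_proj u) - u \<in> super_ideal par (sgl ` comm_words)"
      by (simp add: S.eq_iff)
  also have "\<dots> \<subseteq> super_ideal par (sgl ` (comm_words \<union> serre_words_real \<union> serre_words_odd
      \<union> serre_words_null))"
    by (rule super_ideal_mono) (auto intro!: super_ideal_rel)
  finally have "sub E ((SOME v. LS_proj v = LS_proj u) - u) \<in> bkm_ideal" by (rule sub_E_serre_ideal)
  then show ?thesis by (simp add: phi_def B.eq_iff)
qed

lemma homo_sub_E:
  assumes "u \<in> homo deg d" "\<And>w. word_deg deg w = d \<Longrightarrow> word_deg deg' (map_word E w) = d'"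
  shows "sub E u \<in> homo deg' d'"
proof (rule homo_induct[OF assms(1)])
  show "pm.subspace {u. sub E u \<in> homo deg' d'}" by (intro subspace_vimage islin_sub subspace_homo)
qed (simp add: assms(2))

lemma phi_hom: "phi \<in> superalg_hom LSA (bkm A \<Psi>)"
proof -
  have "phi \<in> LinearCombinations.module_hom class_ring LSA (bkm A \<Psi>)"
    unfolding LinearCombinations.module_hom_def
    by (auto simp: S.carrier_eq B.carrier_eq S.add_eq B.add_eq S.smult_eq B.smult_eq phi_proj)
  moreover have "phi (x \<otimes>\<^bsub>LSA\<^esub> y) = phi x \<otimes>\<^bsub>bkm A \<Psi>\<^esub> phi y"
    if "x \<in> carrier LSA" "y \<in> carrier LSA" for x y
    using that by (auto simp: S.carrier_eq S.mult_eq B.mult_eq phi_proj sub_nmul)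
  moreover have "phi ` homog LSA p \<subseteq> homog (bkm A \<Psi>) p" for p
    unfolding S.homog_eq B.homog_eq image_image phi_proj
    by (intro image_subsetI imageI homo_sub_E) (auto simp: word_deg_map_word)
  ultimately show ?thesis unfolding superalg_hom_def by blast
qed

lemma phi_image: "phi ` carrier LSA = n_plus A \<Psi>"
proof -
  have eq: "phi ` carrier LSA = bkm_proj ` range (sub E)"
    unfolding S.carrier_eq image_image phi_proj ..
  have alg: "subalgebra (bkm_proj ` range (sub E)) (bkm A \<Psi>)"
    unfolding subalgebra_def
  proof (intro conjI ballI)
    show "subspace class_ring (bkm_proj ` range (sub E)) (bkm A \<Psi>)"
      by (intro B.subspace_image subspace_image islin_sub) simp
    fix x y assume "x \<in> bkm_proj ` range (sub E)" "y \<in> bkm_proj ` range (sub E)"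
    then obtain u v where "x = bkm_proj (sub E u)" "y = bkm_proj (sub E v)" by blast
    then have "x \<otimes>\<^bsub>bkm A \<Psi>\<^esub> y = bkm_proj (sub E (nmul u v))" by (simp add: B.mult_eq sub_nmul)
    then show "x \<otimes>\<^bsub>bkm A \<Psi>\<^esub> y \<in> bkm_proj ` range (sub E)" by blast
  qed
  have gens: "range (\<lambda>i. bkm_proj (sgl (Gen (E i)))) \<subseteq> bkm_proj ` range (sub E)"
  proof (rule image_subsetI)
    fix i
    have "bkm_proj (sgl (Gen (E i))) = bkm_proj (sub E (sgl (Gen i)))" by simp
    then show "bkm_proj (sgl (Gen (E i))) \<in> bkm_proj ` range (sub E)" by blast
  qed
  have least: "bkm_proj ` range (sub E) \<subseteq> X"
    if X: "subalgebra X (bkm A \<Psi>)" "range (\<lambda>i. bkm_proj (sgl (Gen (E i)))) \<subseteq> X" for X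
  proof -
    have vs: "subspace class_ring X (bkm A \<Psi>)" using X(1) by (simp add: subalgebra_def)
    then have "X \<subseteq> carrier (bkm A \<Psi>)"
      unfolding VectorSpace.subspace_def submodule_def by auto
    then have "pm.subspace {u. bkm_proj u \<in> X}" using vs B.subspace_iff by blast
    then have s: "pm.subspace {u. bkm_proj (sub E u) \<in> X}"
      using subspace_vimage[OF islin_sub, of "{u. bkm_proj u \<in> X}" E] by simp
    have "bkm_proj (sgl (map_word E w)) \<in> X" for w
    proof (induction w)
      case (Gen i)
      then show ?case using X(2) by auto
    next
      case (Br s t)
      then have "bkm_proj (sgl (map_word E s)) \<otimes>\<^bsub>bkm A \<Psi>\<^esub> bkm_proj (sgl (map_word E t)) \<in> X"
        using X(1) by (simp add: subalgebra_def)
      then show ?case by (simp add: B.mult_eq)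
    qed
    then have "bkm_proj (sub E (sgl w)) \<in> X" for w
      by simp
    from pm_induct[OF s this] show ?thesis by (intro image_subsetI) auto
  qed
  show ?thesis
    unfolding eq n_plus_def subalgebra_gen_def bkm_gen_eq
  proof (rule equalityI)
    show "bkm_proj ` range (sub E) \<subseteq> \<Inter>{X. subalgebra X (bkm A \<Psi>)
        \<and> range (\<lambda>i. bkm_proj (sgl (Gen (E i)))) \<subseteq> X}"
      by (rule Inter_greatest, elim CollectE conjE, rule least)
    show "\<Inter>{X. subalgebra X (bkm A \<Psi>) \<and> range (\<lambda>i. bkm_proj (sgl (Gen (E i)))) \<subseteq> X}
        \<subseteq> bkm_proj ` range (sub E)"
      by (rule Inter_lower, intro CollectI conjI alg gens)
  qed
qed

lemma sub_E_degree:
  assumes "u \<in> homo deg1 m" shows "sub E u \<in> homo bkm_degree (eta m)"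
proof (rule homo_sub_E[OF assms])
  show "root_deg (map_word E w) = eta m" if "word_deg deg1 w = m" for w
    using root_deg_E[of w] unfolding that .
qed

lemma phi_LS_comp: "phi ` LS_comp (dynkin_adj A) \<Psi> m \<subseteq> root_space A \<Psi> (eta m)"
proof
  fix x assume "x \<in> phi ` LS_comp (dynkin_adj A) \<Psi> m"
  then obtain u where u: "u \<in> homo deg1 m" "x = phi (LS_proj u)" unfolding LS_comp_eq by blast
  then have "x = bkm_proj (sub E u)" by (simp only: phi_proj)
  then show "x \<in> root_space A \<Psi> (eta m)"
    unfolding root_space_eq using sub_E_degree[OF u(1)] by blast
qed

section \<open>The comparison in the degrees of the theorem\<close>

context
  fixes k :: "'i \<Rightarrow>\<^sub>0 nat"
  assumes k0: "k \<noteq> 0" and k1: "\<forall>i \<in> I_re A \<union> Psi_0 A \<Psi>. Poly_Mapping.lookup k i \<le> 1"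
begin

lemma phi_bij: "bij_betw phi (LS_comp (dynkin_adj A) \<Psi> k) (root_space A \<Psi> (eta k))"
  unfolding bij_betw_def
proof
  show "inj_on phi (LS_comp (dynkin_adj A) \<Psi> k)"
    unfolding LS_comp_eq
  proof (rule inj_onI, elim imageE)
    fix x y u v
    assume uv: "u \<in> homo deg1 k" "v \<in> homo deg1 k" "x = LS_proj u" "y = LS_proj v" and "phi x
        = phi y"
    then have "sub E (u - v) \<in> bkm_ideal" by (simp add: phi_proj B.eq_iff)
    moreover have d: "u - v \<in> homo deg1 k" using uv by (intro homo_closed)
    ultimately have "u - v \<in> serre_ideal" by (intro sub_E_reflects_serre_ideal)
    also have "serre_ideal \<subseteq> super_ideal par all_rels" unfolding serre_ideal_def
        by (rule super_ideal_mono) (auto intro!: super_ideal_rel)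
    finally have "u - v \<in> super_ideal par (sgl ` comm_words)"
        by (rule all_rels_component[OF k1 _ d])
    then show "x = y" using uv by (simp add: S.eq_iff)
  qed
  have "root_space A \<Psi> (eta k) \<subseteq> phi ` LS_comp (dynkin_adj A) \<Psi> k"
    unfolding root_space_eq LS_comp_eq
  proof (rule image_subsetI)
    fix u assume "u \<in> homo bkm_degree (eta k)"
    then obtain v where v: "v \<in> homo deg1 k" "u - sub E v \<in> bkm_ideal"
        using positive_component[OF k0] by blast
    then have "bkm_proj u = phi (LS_proj v)" by (simp add: phi_proj B.eq_iff)
    then show "bkm_proj u \<in> phi ` LS_proj ` homo deg1 k" using v(1) by blast
  qed
  then show "phi ` LS_comp (dynkin_adj A) \<Psi> k = root_space A \<Psi> (eta k)"
    using phi_LS_comp by blast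
qed

lemma phi_span:
  assumes "X \<subseteq> carrier LSA" shows "phi ` S.Lm.span X = B.Lm.span (phi ` X)"
proof -
  have im: "phi ` LS_proj ` S = bkm_proj ` sub E ` S" for S
    unfolding image_image phi_proj ..
  obtain S where X: "X = LS_proj ` S" using subset_imageE[OF assms[unfolded S.carrier_eq]] by metis
  show ?thesis
    unfolding X S.span_image im span_islin_image[OF islin_sub] B.span_image ..
qed

text \<open>The dimension is the least size of a finite spanning set. The bijection
  \<open>phi\<close> matches the finite spanning subsets of the two components size by size, so both
  sides are \<open>LEAST\<close> of the same predicate, whether or not a finite spanning set
  exists.\<close>

lemma root_mult_eq: "root_mult A \<Psi> (eta k) = dim_of LSA (LS_comp (dynkin_adj A) \<Psi> k)"
proof -
  define U V where "U = LS_comp (dynkin_adj A) \<Psi> k" and "V = root_space A \<Psi> (eta k)"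
  have inj: "inj_on phi U" and im: "phi ` U = V"
    using phi_bij by (simp_all add: bij_betw_def U_def V_def)
  have sub: "submodule class_ring U LSA"
    unfolding U_def LS_comp_eq by (intro S.Lm.is_module S.subspace_image subspace_homo)
  then have c: "U \<subseteq> carrier LSA" by (rule submodule.subset)
  have span: "phi ` S.Lm.span Y = B.Lm.span (phi ` Y)" if "Y \<subseteq> U" for Y
    using that c by (intro phi_span) (rule subset_trans)
  have "(\<exists>X. finite X \<and> card X = n \<and> X \<subseteq> V \<and> B.Lm.span X = V) \<longleftrightarrow>
        (\<exists>Y. finite Y \<and> card Y = n \<and> Y \<subseteq> U \<and> S.Lm.span Y = U)" for n
  proof (intro iffI; elim exE conjE)
    fix X assume X: "finite X" "card X = n" "X \<subseteq> V" "B.Lm.span X = V"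
    obtain Y where Y: "Y \<subseteq> U" "X = phi ` Y"
      using X(3) unfolding im[symmetric] by (rule subset_imageE)
    have injY: "inj_on phi Y" using inj Y(1) by (rule inj_on_subset)
    have "phi ` S.Lm.span Y = phi ` U"
      unfolding span[OF Y(1)] Y(2)[symmetric] X(4) im ..
    then have "S.Lm.span Y = U"
      by (rule inj_on_image_eq_iff[OF inj, THEN iffD1, rotated 2]) (use S.Lm.span_is_subset[OF Y(1)
          sub] in auto)
    moreover have "finite Y" using X(1) unfolding Y(2) by (rule finite_imageD[OF _ injY])
    moreover have "card Y = n" using X(2) unfolding Y(2) card_image[OF injY] .
    ultimately show "\<exists>Y. finite Y \<and> card Y = n \<and> Y \<subseteq> U \<and> S.Lm.span Y = U"
      using Y(1) by (intro exI[of _ Y] conjI)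
  next
    fix Y assume Y: "finite Y" "card Y = n" "Y \<subseteq> U" "S.Lm.span Y = U"
    have "finite (phi ` Y)" using Y(1) by (rule finite_imageI)
    moreover have "card (phi ` Y) = n" using card_image[OF inj_on_subset[OF inj Y(3)]] Y(2)
        by (rule trans)
    moreover have "phi ` Y \<subseteq> V" unfolding im[symmetric] using Y(3) by (rule image_mono)
    moreover have "B.Lm.span (phi ` Y) = V" unfolding span[OF Y(3), symmetric] Y(4) by (rule im)
    ultimately show "\<exists>X. finite X \<and> card X = n \<and> X \<subseteq> V \<and> B.Lm.span X = V"
      by (intro exI[of _ "phi ` Y"] conjI)
  qed
  moreover have "dim_of (bkm A \<Psi>) V = (LEAST n. \<exists>X. finite X \<and> card X = n \<and> X \<subseteq> V \<and> B.Lm.span X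
      = V)"
    unfolding V_def root_space_eq by (rule B.dim_of_eq[OF subspace_homo])
  moreover have "dim_of LSA U = (LEAST n. \<exists>Y. finite Y \<and> card Y = n \<and> Y \<subseteq> U \<and> S.Lm.span Y = U)"
    unfolding U_def LS_comp_eq by (rule S.dim_of_eq[OF subspace_homo])
  ultimately show ?thesis
    unfolding root_mult_def U_def[symmetric] V_def[symmetric] by (simp only:)
qed

text \<open>The set \<open>W\<close> is left free so that one argument covers the Serre elements
  with and without the shorter odd family.\<close>

lemma ideal_component:
  assumes "W \<subseteq> serre_words_real \<union> serre_words_odd \<union> serre_words_null \<union> serre_words_short"
  shows "ideal_gen LSA (LS_proj ` sgl ` W) \<inter> LS_comp (dynkin_adj A) \<Psi> k = {\<zero>\<^bsub>LSA\<^esub>}"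
proof -
  have mem: "LS_proj u \<in> ideal_gen LSA (LS_proj ` sgl ` W) \<longleftrightarrow> u \<in> super_ideal par (sgl ` comm_words
      \<union> sgl ` W)" for u
    using S.ideal_gen_preimage[of "sgl ` W"] unfolding Inter_super_ideal by blast
  have "super_ideal par (sgl ` comm_words \<union> sgl ` W) \<subseteq> super_ideal par all_rels"
    using assms by (intro super_ideal_mono) (auto intro!: super_ideal_rel)
  then have "LS_proj u = \<zero>\<^bsub>LSA\<^esub>" if "u \<in> homo deg1 k" "LS_proj u
      \<in> ideal_gen LSA (LS_proj ` sgl ` W)" for u
    using that all_rels_component[OF k1 _ that(1)] unfolding mem S.eq_zero_iff by blast
  moreover have "\<zero>\<^bsub>LSA\<^esub> \<in> ideal_gen LSA (LS_proj ` sgl ` W)" "\<zero>\<^bsub>LSA\<^esub> \<in> LS_proj ` homo deg1 k"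
    unfolding S.zero_eq mem by (auto intro: homo_closed)
  ultimately show ?thesis unfolding LS_comp_eq by blast
qed

lemma serre_component:
  "ideal_gen LSA (serre_elements A \<Psi> LSA (LS_gen (dynkin_adj A) \<Psi>)) \<inter> LS_comp (dynkin_adj A) \<Psi> k
      = {\<zero>\<^bsub>LSA\<^esub>}"
  "ideal_gen LSA (serre_elements A \<Psi> LSA (LS_gen (dynkin_adj A) \<Psi>) \<union>
    short_odd_serre_elements A \<Psi> LSA (LS_gen (dynkin_adj A) \<Psi>)) \<inter> LS_comp (dynkin_adj A) \<Psi> k
        = {\<zero>\<^bsub>LSA\<^esub>}"
proof -
  have id: "map_word (\<lambda>i. i) = (\<lambda>w :: 'i word. w)"
    by (simp add: fun_eq_iff word.map_ident)
  have eq: "serre_elements A \<Psi> LSA (LS_gen (dynkin_adj A) \<Psi>) = LS_proj ` sgl ` serre_words"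
    "short_odd_serre_elements A \<Psi> LSA (LS_gen (dynkin_adj A) \<Psi>) = LS_proj ` sgl ` serre_words_short"
    using serre_elements_eq[OF S.free_quotient_axioms, of "\<lambda>i. i"] unfolding LS_gen_eq id
        image_ident .
  show "ideal_gen LSA (serre_elements A \<Psi> LSA (LS_gen (dynkin_adj A) \<Psi>)) \<inter> LS_comp (dynkin_adj A) \<Psi>
      k = {\<zero>\<^bsub>LSA\<^esub>}"
    unfolding eq by (rule ideal_component) (auto simp: serre_words_def)
  show "ideal_gen LSA (serre_elements A \<Psi> LSA (LS_gen (dynkin_adj A) \<Psi>) \<union>
    short_odd_serre_elements A \<Psi> LSA (LS_gen (dynkin_adj A) \<Psi>)) \<inter> LS_comp (dynkin_adj A) \<Psi> k
        = {\<zero>\<^bsub>LSA\<^esub>}"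
    unfolding eq image_Un[symmetric] by (rule ideal_component) (auto simp: serre_words_def)
qed

end

end

text \<open>The last conjunct puts the shorter odd Serre elements into the generating set as well,
  so that part (2) holds for either form of the second Serre family.\<close>

theorem lemma1:
  fixes A :: "'i::countable \<Rightarrow> 'i \<Rightarrow> real" and \<Psi> :: "'i set" and k :: "'i \<Rightarrow>\<^sub>0 nat"
  assumes "bkm_supermatrix A \<Psi>"
    and "k \<noteq> 0"
    and "\<forall>i \<in> I_re A \<union> Psi_0 A \<Psi>. Poly_Mapping.lookup k i \<le> 1"
  shows
    "(\<exists>\<phi> \<in> superalg_hom (LS (dynkin_adj A) \<Psi>) (bkm A \<Psi>).
        (\<forall>i. \<phi> (LS_gen (dynkin_adj A) \<Psi> i) = bkm_gen A \<Psi> (E i)) \<and>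
        \<phi> ` carrier (LS (dynkin_adj A) \<Psi>) = n_plus A \<Psi> \<and>
        (\<forall>m. \<phi> ` LS_comp (dynkin_adj A) \<Psi> m \<subseteq> root_space A \<Psi> (eta m)) \<and>
        bij_betw \<phi> (LS_comp (dynkin_adj A) \<Psi> k) (root_space A \<Psi> (eta k))) \<and>
     root_mult A \<Psi> (eta k) = dim_of (LS (dynkin_adj A) \<Psi>) (LS_comp (dynkin_adj A) \<Psi> k) \<and>
     ideal_gen (LS (dynkin_adj A) \<Psi>)
         (serre_elements A \<Psi> (LS (dynkin_adj A) \<Psi>) (LS_gen (dynkin_adj A) \<Psi>))
         \<inter> LS_comp (dynkin_adj A) \<Psi> k
       = {\<zero>\<^bsub>LS (dynkin_adj A) \<Psi>\<^esub>} \<and>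
     ideal_gen (LS (dynkin_adj A) \<Psi>)
         (serre_elements A \<Psi> (LS (dynkin_adj A) \<Psi>) (LS_gen (dynkin_adj A) \<Psi>) \<union>
          short_odd_serre_elements A \<Psi> (LS (dynkin_adj A) \<Psi>) (LS_gen (dynkin_adj A) \<Psi>))
         \<inter> LS_comp (dynkin_adj A) \<Psi> k
       = {\<zero>\<^bsub>LS (dynkin_adj A) \<Psi>\<^esub>}"
proof -
  interpret bkm_matrix A \<Psi> by unfold_locales (rule assms(1))
  have gen: "phi (LS_gen (dynkin_adj A) \<Psi> i) = bkm_gen A \<Psi> (E i)" for i
    by (simp add: LS_gen_eq bkm_gen_eq phi_proj)
  show ?thesis
    by (intro conjI bexI[OF _ phi_hom] allI gen phi_image phi_LS_comp phi_bij root_mult_eq serre_component assms)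
qed

end
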